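(* Let $X_\Lambda$ be the LVM manifold of an admissible, minimally stable, polytopal configuration $\Lambda$ with $d\ge1$, with indispensable block $B$, and put $C_B=\operatorname{coker}B$ and $\delta=m-\operatorname{rank}_{\mathbb C}B$. For $0\le p\le N$, $$H^0(X_\Lambda,\Omega^p_{X_\Lambda})\cong\Lambda^pC_B^\vee .$$ Hence $h^{p,0}(X_\Lambda)=\binom{\delta}{p}$.
   Context: LVM data. Convex hulls are over $\mathbb R$ with $\mathbb C^m\cong\mathbb R^{2m}$; $\langle-,-\rangle$ is the standard complex-bilinear pairing on $\mathbb C^m$. A configuration $\Lambda=(\Lambda_1,\dots,\Lambda_n)$ in $\mathbb C^m$, $m\ge1$, is admissible if $0\in\operatorname{conv}(\Lambda_1,\dots,\Lambda_n)$ and $0\notin\operatorname{conv}\{\Lambda_i:i\in I\}$ whenever $1\le|I|\le2m$. Put $V_\Lambda=\{[z]\in\mathbb P^{n-1}:0\in\operatorname{conv}\{\Lambda_i:z_i\ne0\}\}$. Then $\mathbb C^m$ acts freely and properly on $V_\Lambda$ by $T\cdot[z]=[e^{\langle\Lambda_1,T\rangle}z_1:\cdots:e^{\langle\Lambda_n,T\rangle}z_n]$, and $X_\Lambda=V_\Lambda/\mathbb C^m$ is a compact complex manifold (the LVM manifold). A label $a$ is indispensable if $0\notin\operatorname{conv}\{\Lambda_i:i\neq a\}$; otherwise visible. $\Lambda$ is minimally stable if there are exactly $m+1$ indispensable labels $a_0,\dots,a_m$. The visible labels are identified with $[N]=\{1,\dots,N\}$, $N=n-m-1$. The visible complex $K$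 on $[N]$ has faces the $J\subseteq[N]$ with $0\in\operatorname{conv}\{\Lambda_i:i\notin J\}$ (complement in the full label set). Put $d=n-2m-1=N-m$. $\Lambda$ is polytopal if $K$ is the boundary complex of a $d$-dimensional simplicial convex polytope with vertex set $[N]$. Then $\dim_{\mathbb C}X_\Lambda=N$. The indispensable block $B:\mathbb C^m\to\mathbb C^m$ has rows $B_\mu(T)=\langle\Lambda_{a_\mu}-\Lambda_{a_0},T\rangle$, $1\le\mu\le m$. Notation: $h^{p,q}(X)=\dim_{\mathbb C}H^q(X,\Omega^p_X)$; binomial coefficients outside their usual range are zero. *)

theory Defs
  imports "HOL-Analysis.Analysis" "HOL-Library.Function_Algebras"
begin

section \<open>Configurations\<close>

text \<open>Labels are the elements of the finite type \<open>'n\<close>, so \<open>n = CARD('n)\<close>; and \<open>\<complex>\<^sup>m\<close> is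
  \<open>complex ^ 'm\<close>, with \<open>m = CARD('m)\<close>. Convex hulls are real ones.\<close>

definition bilin :: "complex ^ 'm \<Rightarrow> complex ^ 'm \<Rightarrow> complex"
  where "bilin x y = (\<Sum>j\<in>UNIV. x $ j * y $ j)"

definition admissible :: "('n::finite \<Rightarrow> complex ^ 'm) \<Rightarrow> bool"
  where "admissible \<Lambda> \<longleftrightarrow> 0 \<in> convex hull (range \<Lambda>) \<and>
    (\<forall>I. 1 \<le> card I \<and> card I \<le> 2 * CARD('m) \<longrightarrow> 0 \<notin> convex hull (\<Lambda> ` I))"

definition indispensable :: "('n::finite \<Rightarrow> complex ^ 'm) \<Rightarrow> 'n set"
  where "indispensable \<Lambda> = {a. 0 \<notin> convex hull (\<Lambda> ` {i. i \<noteq> a})}"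

definition visible :: "('n::finite \<Rightarrow> complex ^ 'm) \<Rightarrow> 'n set"
  where "visible \<Lambda> = - indispensable \<Lambda>"

definition minimally_stable :: "('n::finite \<Rightarrow> complex ^ 'm) \<Rightarrow> bool"
  where "minimally_stable \<Lambda> \<longleftrightarrow> card (indispensable \<Lambda>) = CARD('m) + 1"

text \<open>The visible labels themselves are used as the vertex set \<open>[N]\<close>.\<close>

definition visible_complex :: "('n::finite \<Rightarrow> complex ^ 'm) \<Rightarrow> 'n set set"
  where "visible_complex \<Lambda> = {J. J \<subseteq> visible \<Lambda> \<and> 0 \<in> convex hull (\<Lambda> ` (- J))}"

definition lvm_d :: "('n::finite \<Rightarrow> complex ^ 'm) \<Rightarrow> int"
  where "lvm_d \<Lambda> = int CARD('n) - 2 * int CARD('m) - 1"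

text \<open>The polytope is \<open>d\<close>-dimensional in the sense of its affine hull; it is placed in
  \<open>\<real>\<^sup>n\<close>, which is large enough to contain a copy of every \<open>d\<close>-dimensional polytope as \<open>d \<le> n\<close>.\<close>

definition polytopal :: "('n::finite \<Rightarrow> complex ^ 'm) \<Rightarrow> bool"
  where "polytopal \<Lambda> \<longleftrightarrow>
    (\<exists>(P :: (real ^ 'n) set) v.
       polytope P \<and> aff_dim P = lvm_d \<Lambda> \<and>
       (\<forall>F. F facet_of P \<longrightarrow> (lvm_d \<Lambda> - 1) simplex F) \<and>
       bij_betw v (visible \<Lambda>) {x. x extreme_point_of P} \<and>
       (\<forall>J \<subseteq> visible \<Lambda>. J \<in> visible_complex \<Lambda> \<longleftrightarrow>
          (\<exists>F. F face_of P \<and> F \<noteq> P \<and> v ` J = {x. x extreme_point_of F})))"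

text \<open>The rows are indexed by \<open>'m\<close>; \<open>a\<close> enumerates \<open>a\<^sub>1, \<dots>, a\<^sub>m\<close>.\<close>

definition indisp_block :: "('n::finite \<Rightarrow> complex ^ 'm) \<Rightarrow> 'n \<Rightarrow> ('m \<Rightarrow> 'n) \<Rightarrow> complex ^ 'm \<Rightarrow> complex ^ 'm"
  where "indisp_block \<Lambda> a0 a T = (\<chi> \<mu>. bilin (\<Lambda> (a \<mu>) - \<Lambda> a0) T)"


section \<open>The quotient \<open>V\<^sub>\<Lambda> / \<complex>\<^sup>m\<close> as a topological space\<close>

definition quotient_topology :: "'a topology \<Rightarrow> ('a \<Rightarrow> 'b) \<Rightarrow> 'b topology"
  where "quotient_topology X f =
    topology (\<lambda>U. U \<subseteq> f ` topspace X \<and> openin X {x \<in> topspace X. f x \<in> U})"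

lemma openin_quotient_topology:
  "openin (quotient_topology X f) U \<longleftrightarrow>
     U \<subseteq> f ` topspace X \<and> openin X {x \<in> topspace X. f x \<in> U}"
proof -
  have "istopology (\<lambda>U. U \<subseteq> f ` topspace X \<and> openin X {x \<in> topspace X. f x \<in> U})"
    unfolding istopology_def
  proof (rule conjI; intro allI impI)
    fix S T assume S: "S \<subseteq> f ` topspace X \<and> openin X {x \<in> topspace X. f x \<in> S}"
      and T: "T \<subseteq> f ` topspace X \<and> openin X {x \<in> topspace X. f x \<in> T}"
    have "{x \<in> topspace X. f x \<in> S \<inter> T} =
        {x \<in> topspace X. f x \<in> S} \<inter> {x \<in> topspace X. f x \<in> T}" by auto
    moreover have "openin X ({x \<in> topspace X. f x \<in> S} \<inter> {x \<in> topspace X. f x \<in> T})"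
      using S T by (intro openin_Int) simp_all
    ultimately show "S \<inter> T \<subseteq> f ` topspace X \<and> openin X {x \<in> topspace X. f x \<in> S \<inter> T}"
      using S by (simp add: le_infI1)
  next
    fix \<K> assume K: "\<forall>K\<in>\<K>. K \<subseteq> f ` topspace X \<and> openin X {x \<in> topspace X. f x \<in> K}"
    have "{x \<in> topspace X. f x \<in> \<Union>\<K>} = (\<Union>K\<in>\<K>. {x \<in> topspace X. f x \<in> K})" by auto
    moreover have "openin X (\<Union>K\<in>\<K>. {x \<in> topspace X. f x \<in> K})" using K by blast
    ultimately show "\<Union>\<K> \<subseteq> f ` topspace X \<and> openin X {x \<in> topspace X. f x \<in> \<Union>\<K>}"
      using K by auto
  qed
  then show ?thesis unfolding quotient_topology_def by (simp add: topology_inverse')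
qed

text \<open>Points of \<open>\<P>\<^sup>n\<^sup>-\<^sup>1\<close> are the punctured lines in \<open>\<complex>\<^sup>n\<close>.\<close>

type_synonym 'n ppoint = "(complex ^ 'n) set"

definition proj_pt :: "complex ^ 'n::finite \<Rightarrow> 'n ppoint"
  where "proj_pt z = {c *s z | c. c \<noteq> 0}"

definition proj_topology :: "('n::finite) ppoint topology"
  where "proj_topology = quotient_topology (top_of_set (- {0})) proj_pt"

definition lvm_V :: "('n::finite \<Rightarrow> complex ^ 'm) \<Rightarrow> 'n ppoint set"
  where "lvm_V \<Lambda> = {proj_pt z | z. z \<noteq> 0 \<and> 0 \<in> convex hull (\<Lambda> ` {i. z $ i \<noteq> 0})}"

definition lvm_act :: "('n::finite \<Rightarrow> complex ^ 'm) \<Rightarrow> complex ^ 'm \<Rightarrow> 'n ppoint \<Rightarrow> 'n ppoint"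
  where "lvm_act \<Lambda> T P = (\<lambda>z. \<chi> i. exp (bilin (\<Lambda> i) T) * z $ i) ` P"

definition lvm_orbit :: "('n::finite \<Rightarrow> complex ^ 'm) \<Rightarrow> 'n ppoint \<Rightarrow> 'n ppoint set"
  where "lvm_orbit \<Lambda> P = range (\<lambda>T. lvm_act \<Lambda> T P)"

text \<open>The underlying space of the LVM manifold; its points are the orbits in \<open>lvm_V \<Lambda>\<close>.\<close>

definition lvm_space :: "('n::finite \<Rightarrow> complex ^ 'm) \<Rightarrow> 'n ppoint set topology"
  where "lvm_space \<Lambda> = quotient_topology (subtopology proj_topology (lvm_V \<Lambda>)) (lvm_orbit \<Lambda>)"


section \<open>Complex structure\<close>

text \<open>A holomorphic map is one whose real derivatives are complex linear.\<close>

definition complex_derivative ::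
    "(complex \<Rightarrow> 'b \<Rightarrow> 'b) \<Rightarrow> (complex ^ 'a \<Rightarrow> 'b::real_normed_vector) \<Rightarrow>
     (complex ^ 'a \<Rightarrow> 'b) \<Rightarrow> complex ^ 'a \<Rightarrow> bool"
  where "complex_derivative scl f D x \<longleftrightarrow>
    (\<forall>c v. D (c *s v) = scl c (D v)) \<and> (f has_derivative D) (at x)"

text \<open>A chart with values in \<open>\<complex> ^ 'v\<close> is a pair \<open>(U, \<phi>)\<close>; values of \<open>\<phi>\<close> outside \<open>U\<close> are
  irrelevant. The complex structures of \<open>\<P>\<^sup>n\<^sup>-\<^sup>1\<close> and of the quotient by the free and proper
  action are the ones for which \<open>\<complex>\<^sup>n - 0 \<rightarrow> \<P>\<^sup>n\<^sup>-\<^sup>1\<close> and \<open>V\<^sub>\<Lambda> \<rightarrow> V\<^sub>\<Lambda> / \<complex>\<^sup>m\<close> are holomorphic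
  submersions, so a homeomorphism from an open set of the quotient onto an open set of
  \<open>\<complex> ^ 'v\<close> is a holomorphic chart iff its composition with both projections is a holomorphic
  submersion. This yields the maximal atlas.\<close>

definition lvm_atlas :: "('n::finite \<Rightarrow> complex ^ 'm) \<Rightarrow>
    ('n ppoint set set \<times> ('n ppoint set \<Rightarrow> complex ^ 'v)) set"
  where "lvm_atlas \<Lambda> = {(U, \<phi>).
    openin (lvm_space \<Lambda>) U \<and> open (\<phi> ` U) \<and>
    homeomorphic_map (subtopology (lvm_space \<Lambda>) U) (top_of_set (\<phi> ` U)) \<phi> \<and>
    (\<forall>z. z \<noteq> 0 \<and> proj_pt z \<in> lvm_V \<Lambda> \<and> lvm_orbit \<Lambda> (proj_pt z) \<in> U \<longrightarrow>
      (\<exists>D. complex_derivative (*s) (\<lambda>y. \<phi> (lvm_orbit \<Lambda> (proj_pt y))) D z \<and> surj D))}"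


section \<open>Alternating forms\<close>

text \<open>Complex multilinear alternating \<open>p\<close>-forms on a complex vector space given by a carrier,
  addition and scalar multiplication. A \<open>p\<close>-tuple is a list of length \<open>p\<close>, and a form is
  extended by zero to all other lists, so that forms are added pointwise. For a
  finite-dimensional space \<open>W\<close> this is the usual model of the exterior power
  \<open>\<Lambda>\<^sup>p W\<^sup>\<or>\<close> of the dual.\<close>

definition alt_forms ::
    "'a set \<Rightarrow> ('a \<Rightarrow> 'a \<Rightarrow> 'a) \<Rightarrow> (complex \<Rightarrow> 'a \<Rightarrow> 'a) \<Rightarrow> nat \<Rightarrow> ('a list \<Rightarrow> complex) set"
  where "alt_forms W add scl p = {A.
    (\<forall>xs. \<not> (length xs = p \<and> set xs \<subseteq> W) \<longrightarrow> A xs = 0) \<and>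
    (\<forall>xs i. length xs = p \<and> set xs \<subseteq> W \<and> i < p \<longrightarrow>
      (\<forall>x\<in>W. \<forall>y\<in>W. A (xs[i := add x y]) = A (xs[i := x]) + A (xs[i := y])) \<and>
      (\<forall>c. \<forall>x\<in>W. A (xs[i := scl c x]) = c * A (xs[i := x]))) \<and>
    (\<forall>xs. length xs = p \<and> set xs \<subseteq> W \<and> \<not> distinct xs \<longrightarrow> A xs = 0)}"

text \<open>The cokernel of a linear map \<open>B\<close> of \<open>\<complex>\<^sup>m\<close>: the cosets of \<open>range B\<close> with the quotient
  operations.\<close>

definition coker :: "(complex ^ 'm \<Rightarrow> complex ^ 'm) \<Rightarrow> (complex ^ 'm) set set"
  where "coker B = range (\<lambda>x. {x + b | b. b \<in> range B})"

definition coker_add :: "(complex ^ 'm) set \<Rightarrow> (complex ^ 'm) set \<Rightarrow> (complex ^ 'm) set"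
  where "coker_add S T = {x + y | x y. x \<in> S \<and> y \<in> T}"

definition coker_scale ::
    "(complex ^ 'm \<Rightarrow> complex ^ 'm) \<Rightarrow> complex \<Rightarrow> (complex ^ 'm) set \<Rightarrow> (complex ^ 'm) set"
  where "coker_scale B c S = {c *s x + b | x b. x \<in> S \<and> b \<in> range B}"


section \<open>Holomorphic forms on a space with a holomorphic atlas\<close>

text \<open>A global section of \<open>\<Omega>\<^sup>p\<close> is a family of holomorphic \<open>p\<close>-forms on the images of the
  charts which correspond to each other under pullback along the transition maps. Families
  vanish outside their proper domain, so that they are added pointwise.\<close>

type_synonym ('x, 'v) chart = "'x set \<times> ('x \<Rightarrow> complex ^ 'v)"
type_synonym ('x, 'v) form_family =
  "('x, 'v) chart \<Rightarrow> complex ^ 'v \<Rightarrow> (complex ^ 'v) list \<Rightarrow> complex"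

definition holomorphic_form_on ::
    "(complex ^ 'v) set \<Rightarrow> nat \<Rightarrow> (complex ^ 'v \<Rightarrow> (complex ^ 'v) list \<Rightarrow> complex) \<Rightarrow> bool"
  where "holomorphic_form_on S p \<eta> \<longleftrightarrow>
    (\<forall>x. x \<notin> S \<longrightarrow> \<eta> x = (\<lambda>_. 0)) \<and>
    (\<forall>x\<in>S. \<eta> x \<in> alt_forms UNIV (+) (*s) p) \<and>
    (\<forall>vs. length vs = p \<longrightarrow> (\<forall>x\<in>S. \<exists>D. complex_derivative (*) (\<lambda>y. \<eta> y vs) D x))"

definition form_pullback ::
    "(complex ^ 'v \<Rightarrow> complex ^ 'v) \<Rightarrow> (complex ^ 'v \<Rightarrow> (complex ^ 'v) list \<Rightarrow> complex) \<Rightarrow>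
     complex ^ 'v \<Rightarrow> (complex ^ 'v) list \<Rightarrow> complex"
  where "form_pullback f \<eta> x vs = \<eta> (f x) (map (frechet_derivative f (at x)) vs)"

definition holomorphic_forms :: "('x, 'v::finite) chart set \<Rightarrow> nat \<Rightarrow> ('x, 'v) form_family set"
  where "holomorphic_forms \<A> p = {\<omega>.
    (\<forall>k. k \<notin> \<A> \<longrightarrow> \<omega> k = (\<lambda>_ _. 0)) \<and>
    (\<forall>U \<phi>. (U, \<phi>) \<in> \<A> \<longrightarrow> holomorphic_form_on (\<phi> ` U) p (\<omega> (U, \<phi>))) \<and>
    (\<forall>U \<phi> W \<psi> y. (U, \<phi>) \<in> \<A> \<longrightarrow> (W, \<psi>) \<in> \<A> \<longrightarrow> y \<in> U \<longrightarrow> y \<in> W \<longrightarrow>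
       \<omega> (U, \<phi>) (\<phi> y) = form_pullback (\<psi> \<circ> inv_into U \<phi>) (\<omega> (W, \<psi>)) (\<phi> y))}"

definition form_scale :: "complex \<Rightarrow> ('x, 'v) form_family \<Rightarrow> ('x, 'v) form_family"
  where "form_scale c \<omega> = (\<lambda>k x vs. c * \<omega> k x vs)"

lemma vector_space_form_scale: "vector_space form_scale"
  by unfold_locales (auto simp: form_scale_def fun_eq_iff algebra_simps)

lemma subspace_holomorphic_forms:
  fixes \<A> :: "('x, 'v::finite) chart set"
  shows "module.subspace form_scale (holomorphic_forms \<A> p)"
proof -
  interpret vector_space form_scale by (rule vector_space_form_scale)
  have add: "holomorphic_form_on S p (\<lambda>x vs. f x vs + g x vs)"
    if h: "holomorphic_form_on S p f" "holomorphic_form_on S p g" for S f and g :: "complex ^ 'v \<Rightarrow> _"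
    unfolding holomorphic_form_on_def
  proof (intro conjI allI impI ballI)
    fix vs :: "(complex ^ 'v) list" and x assume v: "length vs = p" "x \<in> S"
    obtain D where D: "complex_derivative (*) (\<lambda>y. f y vs) D x"
      using h(1) v unfolding holomorphic_form_on_def by blast
    obtain E where E: "complex_derivative (*) (\<lambda>y. g y vs) E x"
      using h(2) v unfolding holomorphic_form_on_def by blast
    have "complex_derivative (*) (\<lambda>y. f y vs + g y vs) (\<lambda>v. D v + E v) x"
      using D E unfolding complex_derivative_def by (auto intro: has_derivative_add simp: algebra_simps)
    then show "\<exists>D. complex_derivative (*) (\<lambda>y. f y vs + g y vs) D x" by blast
  next
    fix x assume "x \<notin> S"
    then show "(\<lambda>vs. f x vs + g x vs) = (\<lambda>_. 0)"
      using h unfolding holomorphic_form_on_def by simp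
  next
    fix x assume "x \<in> S"
    then have "f x \<in> alt_forms UNIV (+) (*s) p" "g x \<in> alt_forms UNIV (+) (*s) p"
      using h unfolding holomorphic_form_on_def by auto
    then show "(\<lambda>vs. f x vs + g x vs) \<in> alt_forms UNIV (+) (*s) p"
      unfolding alt_forms_def by (simp add: algebra_simps)
  qed
  have scale: "holomorphic_form_on S p (\<lambda>x vs. c * f x vs)"
    if h: "holomorphic_form_on S p f" for S c and f :: "complex ^ 'v \<Rightarrow> _"
    unfolding holomorphic_form_on_def
  proof (intro conjI allI impI ballI)
    fix vs :: "(complex ^ 'v) list" and x assume v: "length vs = p" "x \<in> S"
    obtain D where D: "complex_derivative (*) (\<lambda>y. f y vs) D x"
      using h(1) v unfolding holomorphic_form_on_def by blast
    have "complex_derivative (*) (\<lambda>y. c * f y vs) (\<lambda>v. c * D v) x"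
      using D unfolding complex_derivative_def
      by (auto intro: has_derivative_mult_right simp: algebra_simps)
    then show "\<exists>D. complex_derivative (*) (\<lambda>y. c * f y vs) D x" by blast
  next
    fix x assume "x \<notin> S"
    then show "(\<lambda>vs. c * f x vs) = (\<lambda>_. 0)"
      using h unfolding holomorphic_form_on_def by simp
  next
    fix x assume "x \<in> S"
    then have "f x \<in> alt_forms UNIV (+) (*s) p"
      using h unfolding holomorphic_form_on_def by auto
    then show "(\<lambda>vs. c * f x vs) \<in> alt_forms UNIV (+) (*s) p"
      unfolding alt_forms_def by (simp add: algebra_simps)
  qed
  have zero: "holomorphic_form_on S p (\<lambda>_ _. 0)" for S :: "(complex ^ 'v) set"
    unfolding holomorphic_form_on_def alt_forms_def complex_derivative_def
    by (auto intro!: exI[of _ "\<lambda>_. 0"])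
  show ?thesis
    unfolding subspace_def
  proof (intro conjI ballI allI)
    show "0 \<in> holomorphic_forms \<A> p"
      unfolding holomorphic_forms_def mem_Collect_eq
    proof (intro conjI allI impI)
      fix U :: "'x set" and \<phi> :: "'x \<Rightarrow> complex ^ 'v"
      show "holomorphic_form_on (\<phi> ` U) p (0 (U, \<phi>))"
        using zero unfolding zero_fun_def .
    next
      fix k :: "('x, 'v) chart"
      show "0 k = (\<lambda>_ _. 0)" unfolding zero_fun_def ..
    next
      fix U W :: "'x set" and \<phi> \<psi> :: "'x \<Rightarrow> complex ^ 'v" and y
      show "0 (U, \<phi>) (\<phi> y) = form_pullback (\<psi> \<circ> inv_into U \<phi>) (0 (W, \<psi>)) (\<phi> y)"
        unfolding form_pullback_def[abs_def] zero_fun_def ..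
    qed
    show "\<omega> + \<eta> \<in> holomorphic_forms \<A> p"
      if a: "\<omega> \<in> holomorphic_forms \<A> p" and b: "\<eta> \<in> holomorphic_forms \<A> p" for \<omega> \<eta>
    proof -
      note A = a[unfolded holomorphic_forms_def mem_Collect_eq]
        and B = b[unfolded holomorphic_forms_def mem_Collect_eq]
      show ?thesis
        unfolding holomorphic_forms_def mem_Collect_eq
      proof (intro conjI allI impI)
        fix k assume k: "k \<notin> \<A>"
        show "(\<omega> + \<eta>) k = (\<lambda>_ _. 0)"
          unfolding plus_fun_def A[THEN conjunct1, rule_format, OF k]
            B[THEN conjunct1, rule_format, OF k] by simp
      next
        fix U \<phi> assume k: "(U, \<phi>) \<in> \<A>"
        show "holomorphic_form_on (\<phi> ` U) p ((\<omega> + \<eta>) (U, \<phi>))"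
          using add[OF A[THEN conjunct2, THEN conjunct1, rule_format, OF k]
            B[THEN conjunct2, THEN conjunct1, rule_format, OF k]]
          unfolding plus_fun_def .
      next
        fix U \<phi> W \<psi> y assume k: "(U, \<phi>) \<in> \<A>" "(W, \<psi>) \<in> \<A>" "y \<in> U" "y \<in> W"
        show "(\<omega> + \<eta>) (U, \<phi>) (\<phi> y) =
            form_pullback (\<psi> \<circ> inv_into U \<phi>) ((\<omega> + \<eta>) (W, \<psi>)) (\<phi> y)"
          unfolding plus_fun_def A[THEN conjunct2, THEN conjunct2, rule_format, OF k]
            B[THEN conjunct2, THEN conjunct2, rule_format, OF k]
          unfolding form_pullback_def[abs_def] ..
      qed
    qed
    show "form_scale c \<omega> \<in> holomorphic_forms \<A> p" if a: "\<omega> \<in> holomorphic_forms \<A> p" for c \<omega>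
    proof -
      note A = a[unfolded holomorphic_forms_def mem_Collect_eq]
      show ?thesis
        unfolding holomorphic_forms_def mem_Collect_eq
      proof (intro conjI allI impI)
        fix k assume k: "k \<notin> \<A>"
        show "form_scale c \<omega> k = (\<lambda>_ _. 0)"
          unfolding form_scale_def A[THEN conjunct1, rule_format, OF k] by simp
      next
        fix U \<phi> assume k: "(U, \<phi>) \<in> \<A>"
        show "holomorphic_form_on (\<phi> ` U) p (form_scale c \<omega> (U, \<phi>))"
          using scale[OF A[THEN conjunct2, THEN conjunct1, rule_format, OF k]]
          unfolding form_scale_def .
      next
        fix U \<phi> W \<psi> y assume k: "(U, \<phi>) \<in> \<A>" "(W, \<psi>) \<in> \<A>" "y \<in> U" "y \<in> W"
        show "form_scale c \<omega> (U, \<phi>) (\<phi> y) =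
            form_pullback (\<psi> \<circ> inv_into U \<phi>) (form_scale c \<omega> (W, \<psi>)) (\<phi> y)"
          unfolding form_scale_def A[THEN conjunct2, THEN conjunct2, rule_format, OF k]
          unfolding form_pullback_def[abs_def] ..
      qed
    qed
  qed
qed

text \<open>\<open>H\<^sup>0(X, \<Omega>\<^sup>p) \<cong> \<Lambda>\<^sup>p W\<^sup>\<or>\<close> as complex vector spaces, for \<open>X\<close> with the given atlas.\<close>

definition H0_iso_alt_forms ::
    "('x, 'v::finite) chart set \<Rightarrow> nat \<Rightarrow>
     'a set \<Rightarrow> ('a \<Rightarrow> 'a \<Rightarrow> 'a) \<Rightarrow> (complex \<Rightarrow> 'a \<Rightarrow> 'a) \<Rightarrow> bool"
  where "H0_iso_alt_forms \<A> p W add scl \<longleftrightarrow>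
    (\<exists>\<Phi>. bij_betw \<Phi> (holomorphic_forms \<A> p) (alt_forms W add scl p) \<and>
      (\<forall>\<omega> \<in> holomorphic_forms \<A> p. \<forall>\<eta> \<in> holomorphic_forms \<A> p. \<Phi> (\<omega> + \<eta>) = \<Phi> \<omega> + \<Phi> \<eta>) \<and>
      (\<forall>c. \<forall>\<omega> \<in> holomorphic_forms \<A> p. \<Phi> (form_scale c \<omega>) = (\<lambda>xs. c * \<Phi> \<omega> xs)))"

text \<open>\<open>h\<^sup>p\<^sup>,\<^sup>0 = dim H\<^sup>0(X, \<Omega>\<^sup>p)\<close>; the library's dimension is only meaningful for a
  finite-dimensional space, which is therefore demanded separately.\<close>

definition has_hodge_p0 :: "('x, 'v::finite) chart set \<Rightarrow> nat \<Rightarrow> nat \<Rightarrow> bool"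
  where "has_hodge_p0 \<A> p h \<longleftrightarrow>
    (\<exists>b. finite b \<and> module.span form_scale b = holomorphic_forms \<A> p) \<and>
    vector_space.dim form_scale (holomorphic_forms \<A> p) = h"

end

(* A holomorphic p-form on the quotient pulls back to a p-form \<Omega> on the stable set S in \<complex>\<^sup>n which is
   invariant under \<complex>\<^sup>* \<times> \<complex>\<^sup>m and vanishes on orbit directions. Evaluating \<Omega> at z on vectors z v
   (coordinatewise products with fixed v) gives an invariant holomorphic function on S. As every orbit
   meets a compact set, its absolute value has a maximum, and it is constant by the maximum principle
   on complex lines. If one v is the coordinate vector of a visible label i, then the function vanishes
   where z_i = 0, hence identically. So \<Omega> is a constant alternating form in the logarithmic
   differentials of the m + 1 indispensable coordinates, vanishing on the orbit directions, which
   amounts to an alternating form on the cokernel of B. Conversely such a form descends to the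
   quotient. Its charts come from slices z_\<kappa> = const through the orbits, for m + 1 labels \<kappa> with
   independent vectors (1, \<Lambda>_\<kappa>). *)
theory Submission
  imports Defs "HOL-Complex_Analysis.Conformal_Mappings"
begin

section \<open>Holomorphic functions of several variables\<close>

text \<open>Scaling and the action of T are treated as one action of the additive group of dimension
  m + 1, with weights (1, \<Lambda>_i). On the orbit direction (\<tau>_0, T) the logarithmic
  differential at an indispensable label b takes the value \<tau>_0 + <\<Lambda>_b, T>. Subtracting
  the one at a0 removes \<tau>_0 and leaves the rows of B; this is why vanishing on orbit directions
  means vanishing on \<open>range B\<close>. One consequence of admissibility,
  \<open>Re_bilin_le_zero_imp\<close>, carries the geometry: it gives the compact set meeting all
  orbits, the independent vectors needed for slices, and the injectivity of small slices. Two
  obstacles shape the rest. The atlas is maximal and its charts are only known to give submersions,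
  so that transition maps are holomorphic, and that the derivative of a chart kills nothing but
  orbit directions, is proved by comparison with slice charts, whose inverses are explicit. And
  holomorphy is pointwise complex differentiability, while pulling back a form involves derivatives
  of charts; their holomorphy comes from Cauchy's integral formula.\<close>

definition holo :: "(complex ^ 'a \<Rightarrow> complex) \<Rightarrow> complex ^ 'a::finite \<Rightarrow> bool"
  where "holo f z \<longleftrightarrow> (\<exists>D. complex_derivative (*) f D z)"

definition vholo :: "(complex ^ 'a \<Rightarrow> complex ^ 'b) \<Rightarrow> complex ^ 'a::finite \<Rightarrow> bool"
  where "vholo f z \<longleftrightarrow> (\<exists>D. complex_derivative (*s) f D z)"

abbreviation vderiv :: "(complex ^ 'a \<Rightarrow> complex ^ 'b) \<Rightarrow> _ \<Rightarrow> complex ^ 'a::finite \<Rightarrow> bool"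
  where "vderiv \<equiv> complex_derivative (*s)"

lemma scaleR_eq_vector_scalar_mult: "r *\<^sub>R v = complex_of_real r *s v"
  by (simp only: vec_eq_iff vector_scaleR_component vector_smult_component) (simp add: scaleR_conv_of_real)

lemma linear_scalar_mult_left: "linear (\<lambda>c. c *s (v::complex^'a))"
  by (rule linearI) (auto simp: vec_eq_iff algebra_simps)

lemma complex_derivativeD:
  assumes "complex_derivative scl f D z"
  shows "(f has_derivative D) (at z)" "D (c *s v) = scl c (D v)"
  using assms by (auto simp: complex_derivative_def)

lemma complex_derivative_unique:
  fixes f :: "complex^'a \<Rightarrow> 'b::real_normed_vector"
  assumes "complex_derivative scl f D z" "complex_derivative scl f E z"
  shows "D = E"
  using assms has_derivative_unique unfolding complex_derivative_def by blast

lemma complex_derivative_chain: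
  assumes "vderiv f D z" "complex_derivative scl g E (f z)"
  shows "complex_derivative scl (\<lambda>x. g (f x)) (\<lambda>v. E (D v)) z"
  using assms has_derivative_compose[of f D z UNIV g E]
  unfolding complex_derivative_def by simp

lemma complex_derivative_vec_iff:
  fixes f :: "complex^'a \<Rightarrow> complex^'b::finite"
  shows "vderiv f D z \<longleftrightarrow> (\<forall>i. complex_derivative (*) (\<lambda>x. f x $ i) (\<lambda>v. D v $ i) z)"
proof -
  have *: "(f has_derivative D) (at z) \<longleftrightarrow> (\<forall>i. ((\<lambda>x. f x $ i) has_derivative (\<lambda>v. D v $ i)) (at z))"
    (is "?l = ?r")
  proof
    show ?l if ?r
    proof -
      have "((\<lambda>x. \<Sum>i\<in>UNIV. axis i (f x $ i)) has_derivative (\<lambda>v. \<Sum>i\<in>UNIV. axis i (D v $ i))) (at z)"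
      proof (rule has_derivative_sum)
        fix i :: 'b
        have "bounded_linear (axis i :: complex \<Rightarrow> _)"
          by (rule linear_conv_bounded_linear[THEN iffD1], rule linearI) (auto simp: vec_eq_iff axis_def)
        then show "((\<lambda>x. axis i (f x $ i)) has_derivative (\<lambda>v. axis i (D v $ i))) (at z)"
          using that bounded_linear.has_derivative by blast
      qed
      moreover have "(\<Sum>i\<in>UNIV. axis i (w $ i)) = w" for w :: "complex^'b"
        by (auto simp: vec_eq_iff axis_def if_distrib[where f="\<lambda>f. f _"] cong: if_cong)
      ultimately show ?thesis by simp
    qed
  qed (auto intro: bounded_linear.has_derivative[OF bounded_linear_vec_nth])
  show ?thesis
    unfolding complex_derivative_def * by (auto simp: vec_eq_iff)
qed

lemma vholo_iff: "vholo f z \<longleftrightarrow> (\<forall>i. holo (\<lambda>x. f x $ i) z)"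
proof
  assume "\<forall>i. holo (\<lambda>x. f x $ i) z"
  then obtain D where "\<And>i. complex_derivative (*) (\<lambda>x. f x $ i) (D i) z"
    unfolding holo_def by metis
  then have "vderiv f (\<lambda>v. \<chi> i. D i v) z"
    unfolding complex_derivative_vec_iff by simp
  then show "vholo f z" unfolding vholo_def by blast
qed (auto simp: vholo_def holo_def complex_derivative_vec_iff)

lemma has_derivative_frechet:
  "(f has_derivative D) (at z) \<Longrightarrow> frechet_derivative f (at z) = D"
  by (simp add: frechet_derivative_at[symmetric])

lemma holo_derivative:
  "holo f z \<Longrightarrow> complex_derivative (*) f (frechet_derivative f (at z)) z"
  unfolding holo_def using has_derivative_frechet by (auto simp: complex_derivative_def)

lemma vholo_derivative:
  "vholo f z \<Longrightarrow> vderiv f (frechet_derivative f (at z)) z"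
  unfolding vholo_def using has_derivative_frechet by (auto simp: complex_derivative_def)

lemma holo_isCont: "holo f z \<Longrightarrow> isCont f z"
  unfolding holo_def complex_derivative_def using has_derivative_continuous by blast

lemma vholo_isCont: "vholo f z \<Longrightarrow> isCont f z"
  unfolding vholo_def complex_derivative_def using has_derivative_continuous by blast

lemma holo_const: "holo (\<lambda>_. c) z"
  unfolding holo_def complex_derivative_def by (rule exI[of _ "\<lambda>_. 0"]) auto

lemma holo_nth: "holo (\<lambda>x. x $ i) z"
  unfolding holo_def complex_derivative_def
  by (rule exI[of _ "\<lambda>v. v $ i"]) (auto intro: bounded_linear_imp_has_derivative)

lemma holo_add: "holo f z \<Longrightarrow> holo g z \<Longrightarrow> holo (\<lambda>x. f x + g x) z"
  unfolding holo_def complex_derivative_def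
  apply (elim exE)
  subgoal for D E by (rule exI[of _ "\<lambda>v. D v + E v"]) (auto intro: has_derivative_add simp: algebra_simps)
  done

lemma holo_mult: "holo f z \<Longrightarrow> holo g z \<Longrightarrow> holo (\<lambda>x. f x * g x) z"
  unfolding holo_def complex_derivative_def
  apply (elim exE)
  subgoal for D E
    using has_derivative_mult[of f D z UNIV g E]
    by (intro exI[of _ "\<lambda>v. f z * E v + D v * g z"]) (simp add: distrib_left)
  done

lemma holo_sum: "(\<And>i. i \<in> I \<Longrightarrow> holo (f i) z) \<Longrightarrow> holo (\<lambda>x. \<Sum>i\<in>I. f i x) z"
  by (induction I rule: infinite_finite_induct) (auto intro: holo_add holo_const)

lemma holo_compose_field:
  assumes "holo f z" "g field_differentiable at (f z)"
  shows "holo (\<lambda>x. g (f x)) z"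
proof -
  obtain D where D: "complex_derivative (*) f D z" using assms(1) unfolding holo_def by blast
  obtain d where "(g has_field_derivative d) (at (f z))"
    using assms(2) unfolding field_differentiable_def by blast
  then have "(g has_derivative (\<lambda>h. d * h)) (at (f z))" unfolding has_field_derivative_def .
  then have "((\<lambda>x. g (f x)) has_derivative (\<lambda>v. d * D v)) (at z)"
    using has_derivative_compose D unfolding complex_derivative_def by blast
  then show ?thesis using D unfolding holo_def complex_derivative_def
    by (intro exI[of _ "\<lambda>v. d * D v"]) (auto simp: algebra_simps)
qed

lemma holo_exp: "holo f z \<Longrightarrow> holo (\<lambda>x. exp (f x)) z"
  by (rule holo_compose_field) (auto intro: field_differentiable_within_exp)

lemma holo_Ln: "holo f z \<Longrightarrow> f z \<notin> \<real>\<^sub>\<le>\<^sub>0 \<Longrightarrow> holo (\<lambda>x. Ln (f x)) z"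
  by (rule holo_compose_field) (auto intro: field_differentiable_at_Ln)

lemma holo_inverse: "holo f z \<Longrightarrow> f z \<noteq> 0 \<Longrightarrow> holo (\<lambda>x. inverse (f x)) z"
  by (rule holo_compose_field[where g=inverse]) (auto intro: field_differentiable_inverse)

lemma holo_divide: "holo f z \<Longrightarrow> holo g z \<Longrightarrow> g z \<noteq> 0 \<Longrightarrow> holo (\<lambda>x. f x / g x) z"
  unfolding divide_inverse by (intro holo_mult holo_inverse)

lemma holo_compose: "vholo f z \<Longrightarrow> holo g (f z) \<Longrightarrow> holo (\<lambda>x. g (f x)) z"
  unfolding vholo_def holo_def using complex_derivative_chain by blast

lemma vholo_compose: "vholo f z \<Longrightarrow> vholo g (f z) \<Longrightarrow> vholo (\<lambda>x. g (f x)) z"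
  unfolding vholo_def using complex_derivative_chain by blast

lemma vholo_nth: "vholo f z \<Longrightarrow> holo (\<lambda>x. f x $ i) z"
  by (simp add: vholo_iff)

lemma complex_derivative_transform:
  assumes "complex_derivative scl f D z" "eventually (\<lambda>x. f x = g x) (nhds z)"
  shows "complex_derivative scl g D z"
proof -
  have "f z = g z" using assms(2) by (rule eventually_nhds_x_imp_x)
  moreover have "eventually (\<lambda>x. f x = g x) (at z)"
    using assms(2) by (simp add: eventually_nhds_conv_at)
  ultimately show ?thesis
    using assms(1) has_derivative_transform_eventually[of f D z UNIV g]
    unfolding complex_derivative_def by auto
qed

lemma holo_transform:
  "holo f z \<Longrightarrow> eventually (\<lambda>x. f x = g x) (nhds z) \<Longrightarrow> holo g z"
  unfolding holo_def using complex_derivative_transform by blast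

lemma vholo_transform:
  "vholo f z \<Longrightarrow> eventually (\<lambda>x. f x = g x) (nhds z) \<Longrightarrow> vholo g z"
  unfolding vholo_def using complex_derivative_transform by blast

lemma complex_linear_sum:
  fixes D :: "complex^'a \<Rightarrow> 'b::real_vector"
  assumes "linear D"
  shows "D v = (\<Sum>i\<in>UNIV. D (v $ i *s axis i 1))"
proof -
  have "v = (\<Sum>i\<in>UNIV. v $ i *s axis i 1)"
    by (simp add: basis_expansion)
  then show ?thesis using linear_sum[OF assms] by metis
qed

section \<open>Cauchy's formula along complex lines and holomorphy of derivatives\<close>

lemma field_derivative_along_line:
  assumes "holo f (x + \<zeta> *s v)"
  shows "((\<lambda>\<zeta>. f (x + \<zeta> *s v)) has_field_derivative frechet_derivative f (at (x + \<zeta> *s v)) v) (at \<zeta>)"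
proof -
  let ?D = "frechet_derivative f (at (x + \<zeta> *s v))"
  have D: "complex_derivative (*) f ?D (x + \<zeta> *s v)"
    using assms by (rule holo_derivative)
  have "((\<lambda>\<zeta>. x + \<zeta> *s v) has_derivative (\<lambda>h. h *s v)) (at \<zeta>)"
    using bounded_linear_imp_has_derivative[OF linear_conv_bounded_linear[THEN iffD1, OF linear_scalar_mult_left]]
    by (auto intro!: derivative_eq_intros)
  then have "((\<lambda>\<zeta>. f (x + \<zeta> *s v)) has_derivative (\<lambda>h. ?D (h *s v))) (at \<zeta>)"
    using has_derivative_compose complex_derivativeD(1)[OF D] by blast
  then show ?thesis
    using complex_derivativeD(2)[OF D] by (simp add: has_field_derivative_def mult.commute[of _ "?D v"])
qed

text \<open>Cauchy's formula on the disc through \<open>x\<close> in direction \<open>v\<close>; the radius is uniform in \<open>x\<close>.\<close>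

lemma directional_derivative_integral:
  fixes f :: "complex^'a::finite \<Rightarrow> complex"
  assumes O: "open X" "x0 \<in> X" and f: "\<And>x. x \<in> X \<Longrightarrow> holo f x"
  obtains r s k where "r > 0" "s > 0" "\<And>x \<zeta>. x \<in> ball x0 r \<Longrightarrow> norm \<zeta> \<le> s \<Longrightarrow> x + \<zeta> *s v \<in> X"
    "continuous_on {0..1} k"
    "\<And>x. x \<in> ball x0 r \<Longrightarrow> frechet_derivative f (at x) v =
        integral (cbox 0 1) (\<lambda>t::real. f (x + circlepath 0 s t *s v) * k t)"
proof -
  obtain R where R: "R > 0" "ball x0 R \<subseteq> X" using O openE by blast
  \<comment> \<open>The summand 1 covers v = 0. For |\<zeta>| \<le> s the displacement has norm at
    most R/2, so a disc centred in the ball of radius R/2 stays in the ball of radius R.\<close>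
  define s where "s = R / 2 / (norm v + 1)"
  have s: "s > 0" using R by (simp add: s_def add_nonneg_pos)
  have nv: "norm (\<zeta> *s v) = norm \<zeta> * norm v" for \<zeta>
  proof -
    have "norm (\<zeta> *s v) = L2_set (\<lambda>i. norm \<zeta> * norm (v $ i)) UNIV"
      by (simp add: norm_vec_def norm_mult)
    then show ?thesis by (simp add: L2_set_right_distrib norm_vec_def)
  qed
  have inX: "x + \<zeta> *s v \<in> X" if "x \<in> ball x0 (R/2)" "norm \<zeta> \<le> s" for x \<zeta>
  proof -
    have "norm \<zeta> * norm v \<le> s * (norm v + 1)" using that s by (intro mult_mono) auto
    also have "\<dots> = R/2" 
      unfolding s_def using norm_ge_zero[of v]
      by (metis add_nonneg_pos less_numeral_extra(3) nonzero_mult_div_cancel_right times_divide_eq_left zero_less_one)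
    finally have "norm (\<zeta> *s v) \<le> R/2" by (simp add: nv)
    moreover have "norm (x0 - (x + \<zeta> *s v)) \<le> norm (x0 - x) + norm (\<zeta> *s v)"
      by (metis diff_diff_eq norm_triangle_ineq4)
    ultimately have "x + \<zeta> *s v \<in> ball x0 R" using that by (auto simp: dist_norm)
    then show ?thesis using R by blast
  qed
  define k where "k = (\<lambda>t::real. 1 / (2 * pi * \<i>) * (vector_derivative (circlepath 0 s) (at t) / (circlepath 0 s t)\<^sup>2))"
  have ck: "continuous_on {0..1} k"
    unfolding k_def vector_derivative_circlepath
    unfolding circlepath using s by (auto intro!: continuous_intros)
  show ?thesis
  proof
    show "R/2 > 0" "s > 0" "continuous_on {0..1} k" using R s ck by auto
    show "x + \<zeta> *s v \<in> X" if "x \<in> ball x0 (R/2)" "norm \<zeta> \<le> s" for x \<zeta> using inX that .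
    fix x assume x: "x \<in> ball x0 (R/2)"
    let ?h = "\<lambda>\<zeta>. f (x + \<zeta> *s v)"
    have d: "(?h has_field_derivative frechet_derivative f (at (x + \<zeta> *s v)) v) (at \<zeta>)"
      if "norm \<zeta> \<le> s" for \<zeta>
      using field_derivative_along_line f inX[OF x that] by blast
    have hol: "?h holomorphic_on ball 0 s"
      unfolding holomorphic_on_def field_differentiable_def
    proof
      fix \<zeta> :: complex assume "\<zeta> \<in> ball 0 s"
      then have "norm \<zeta> \<le> s" by simp
      from has_field_derivative_at_within[OF d[OF this]]
      show "\<exists>f'. (?h has_field_derivative f') (at \<zeta> within ball 0 s)" by (rule exI)
    qed
    have cont: "continuous_on (cball 0 s) ?h"
      using d by (auto intro!: continuous_at_imp_continuous_on DERIV_isCont)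
    have "(?h has_field_derivative (1 / (2 * of_real pi * \<i>) * contour_integral(circlepath 0 s) (\<lambda>u. ?h u / (u-0)^2))) (at 0)"
      by (rule Cauchy_derivative_integral_circlepath(2)[OF cont hol]) (use s in auto)
    moreover have "(?h has_field_derivative frechet_derivative f (at x) v) (at 0)"
      using d[of 0] s by simp
    ultimately have "frechet_derivative f (at x) v = 1 / (2 * of_real pi * \<i>) * contour_integral(circlepath 0 s) (\<lambda>u. ?h u / (u-0)^2)"
      using DERIV_unique by blast
    also have "\<dots> = integral (cbox 0 1) (\<lambda>t. f (x + circlepath 0 s t *s v) * k t)"
      unfolding contour_integral_integral k_def cbox_interval
      by (subst integral_mult_right[symmetric]) (simp_all add: field_simps)
    finally show "frechet_derivative f (at x) v =
        integral (cbox 0 1) (\<lambda>t. f (x + circlepath 0 s t *s v) * k t)" .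
  qed
qed

lemma norm_circlepath_0: "s > 0 \<Longrightarrow> norm (circlepath 0 s t) = s"
  by (simp add: circlepath norm_mult)

lemma continuous_scalar_mult_circle:
  "continuous_on X (\<lambda>(x,t). x + circlepath 0 s t *s (v::complex^'a))"
proof -
  have "continuous_on X (\<lambda>p. circlepath 0 s (snd p))"
    unfolding circlepath by (intro continuous_intros)
  moreover have "continuous_on UNIV (\<lambda>c. c *s v)"
    using linear_continuous_on linear_conv_bounded_linear linear_scalar_mult_left by blast
  ultimately have "continuous_on X (\<lambda>p. circlepath 0 s (snd p) *s v)"
    using continuous_on_compose2 by blast
  then show ?thesis unfolding split_beta by (intro continuous_intros)
qed

text \<open>The integral formula involves only values of f, and these depend continuously on the
  centre of the disc. The result feeds the continuity hypothesis of the Leibniz rule below.\<close>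

lemma continuous_directional_derivative:
  fixes f :: "complex^'a::finite \<Rightarrow> complex"
  assumes O: "open X" and f: "\<And>x. x \<in> X \<Longrightarrow> holo f x"
  shows "continuous_on X (\<lambda>x. frechet_derivative f (at x) v)"
proof (rule continuous_at_imp_continuous_on, rule ballI)
  fix x0 assume x0: "x0 \<in> X"
  obtain r s k where r: "r > 0" "s > 0" and inX: "\<And>x \<zeta>. x \<in> ball x0 r \<Longrightarrow> norm \<zeta> \<le> s \<Longrightarrow> x + \<zeta> *s v \<in> X"
    and k: "continuous_on {0..1} k"
    and e: "\<And>x. x \<in> ball x0 r \<Longrightarrow> frechet_derivative f (at x) v =
        integral (cbox 0 1) (\<lambda>t::real. f (x + circlepath 0 s t *s v) * k t)"
    by (rule directional_derivative_integral[OF O x0 f, of v], assumption, rule that)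
  have cf: "continuous_on X f" using f holo_isCont continuous_at_imp_continuous_on by blast
  have "continuous_on (ball x0 r \<times> cbox 0 1) (\<lambda>p::_\<times>real. f (case p of (x,t) \<Rightarrow> x + circlepath 0 s t *s v) * k (snd p))"
  proof (intro continuous_on_mult)
    show "continuous_on (ball x0 r \<times> cbox 0 1) (\<lambda>p::_\<times>real. f (case p of (x,t) \<Rightarrow> x + circlepath 0 s t *s v))"
      by (rule continuous_on_compose2[OF cf continuous_scalar_mult_circle])
        (use inX norm_circlepath_0[OF r(2)] in fastforce)
    show "continuous_on (ball x0 r \<times> cbox 0 1) (\<lambda>p::_\<times>real. k (snd p))"
      by (rule continuous_on_compose2[OF k]) (auto intro!: continuous_intros)
  qed
  then have "continuous_on (ball x0 r) (\<lambda>x. integral (cbox 0 1) (\<lambda>t. f (x + circlepath 0 s t *s v) * k t))"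
    by (intro integral_continuous_on_param) (simp add: split_beta)
  then have "continuous_on (ball x0 r) (\<lambda>x. frechet_derivative f (at x) v)"
    by (rule continuous_on_eq) (simp only: e)
  then show "isCont (\<lambda>x. frechet_derivative f (at x) v) x0"
    using r by (simp add: continuous_on_eq_continuous_at)
qed

text \<open>Cauchy's formula is differentiated under the integral sign: the derivative of the
  integrand in x is that of f on the circle times the kernel, and its complex linearity passes
  through the integral.\<close>

proposition holo_directional_derivative:
  fixes f :: "complex^'a::finite \<Rightarrow> complex"
  assumes O: "open X" and f: "\<And>x. x \<in> X \<Longrightarrow> holo f x" and x0: "x0 \<in> X"
  shows "holo (\<lambda>x. frechet_derivative f (at x) v) x0"
proof -
  let ?g = "\<lambda>i x. frechet_derivative f (at x) (axis i 1)"
  \<comment> \<open>The Leibniz rule asks for continuity in the operator norm, whereas continuity is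
    known one direction at a time; hence the derivative is assembled from its finitely many partial
    derivatives.\<close>
  define FD where "FD x = (\<Sum>i\<in>UNIV. blinfun_mult_right (?g i x) o\<^sub>L Blinfun (\<lambda>v. v $ i))" for x
  have FD: "blinfun_apply (FD x) w = (\<Sum>i\<in>UNIV. ?g i x * w $ i)" for x w
    by (simp add: FD_def blinfun.sum_left bounded_linear_Blinfun_apply bounded_linear_vec_nth)
  have FDe: "blinfun_apply (FD x) w = frechet_derivative f (at x) w" if "x \<in> X" for x w
  proof -
    have D: "complex_derivative (*) f (frechet_derivative f (at x)) x"
      using f[OF that] holo_derivative by blast
    have "linear (frechet_derivative f (at x))"
      using complex_derivativeD(1)[OF D] has_derivative_bounded_linear bounded_linear.linear by blast
    then have "frechet_derivative f (at x) w = (\<Sum>i\<in>UNIV. frechet_derivative f (at x) (w $ i *s axis i 1))"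
      by (rule complex_linear_sum)
    also have "\<dots> = (\<Sum>i\<in>UNIV. ?g i x * w $ i)"
      by (intro sum.cong refl) (simp only: complex_derivativeD(2)[OF D] mult.commute)
    finally show ?thesis unfolding FD ..
  qed
  have cFD: "continuous_on X FD"
    unfolding FD_def
    by (intro continuous_on_sum continuous_on_const continuous_directional_derivative[OF O f]
        bounded_bilinear.continuous_on[OF bounded_bilinear_blinfun_compose]
        bounded_linear.continuous_on[OF bounded_linear_blinfun_mult_right])
  obtain r s k where r: "r > 0" "s > 0" and inX: "\<And>x \<zeta>. x \<in> ball x0 r \<Longrightarrow> norm \<zeta> \<le> s \<Longrightarrow> x + \<zeta> *s v \<in> X"
    and k: "continuous_on {0..1} k"
    and e: "\<And>x. x \<in> ball x0 r \<Longrightarrow> frechet_derivative f (at x) v =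
        integral (cbox 0 1) (\<lambda>t::real. f (x + circlepath 0 s t *s v) * k t)"
    by (rule directional_derivative_integral[OF O x0 f, of v], assumption, rule that)
  have cf: "continuous_on X f" using f holo_isCont continuous_at_imp_continuous_on by blast
  have c1: "continuous_on {0..1} (\<lambda>t. x + circlepath 0 s t *s v)" for x
  proof -
    have "continuous_on {0..1} (\<lambda>t. case (x, t) of (x, t) \<Rightarrow> x + circlepath 0 s t *s v)"
      by (rule continuous_on_compose2[OF continuous_scalar_mult_circle[of UNIV]]) (auto intro!: continuous_intros)
    then show ?thesis by simp
  qed
  let ?I = "\<lambda>x. integral (cbox 0 1) (\<lambda>t. f (x + circlepath 0 s t *s v) * k t)"
  define fx where "fx x t = blinfun_mult_right (k t) o\<^sub>L FD (x + circlepath 0 s t *s v)" for x t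
  have x0b: "x0 \<in> ball x0 r" using r by simp
  have cfx: "continuous_on (ball x0 r \<times> cbox 0 1) (\<lambda>(x,t). fx x t)"
  proof -
    have 1: "continuous_on (ball x0 r \<times> cbox 0 1) (\<lambda>p::_\<times>real. FD (case p of (x,t) \<Rightarrow> x + circlepath 0 s t *s v))"
      by (rule continuous_on_compose2[OF cFD continuous_scalar_mult_circle])
        (use inX norm_circlepath_0[OF r(2)] in fastforce)
    have 2: "continuous_on (ball x0 r \<times> cbox 0 1) (\<lambda>p::_\<times>real. k (snd p))"
      by (rule continuous_on_compose2[OF k]) (auto intro!: continuous_intros)
    show ?thesis unfolding fx_def split_beta
      by (intro bounded_bilinear.continuous_on[OF bounded_bilinear_blinfun_compose]
        bounded_linear.continuous_on[OF bounded_linear_blinfun_mult_right] 2 1[unfolded split_beta])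
  qed
  have int: "(\<lambda>t. f (x + circlepath 0 s t *s v) * k t) integrable_on cbox 0 1" if "x \<in> ball x0 r" for x
    unfolding cbox_interval
    by (intro integrable_continuous_interval continuous_on_mult k continuous_on_compose2[OF cf c1])
      (use inX that norm_circlepath_0[OF r(2)] in fastforce)
  have "(?I has_derivative
      blinfun_apply (integral (cbox 0 1) (fx x0))) (at x0 within ball x0 r)"
  proof (rule leibniz_rule[OF _ int cfx x0b convex_ball])
    fix x t assume x: "x \<in> ball x0 r" and t: "t \<in> cbox 0 (1::real)"
    let ?y = "x + circlepath 0 s t *s v"
    have y: "?y \<in> X" using inX[OF x] norm_circlepath_0[OF r(2)] by simp
    have "(f has_derivative frechet_derivative f (at ?y)) (at ?y)"
      using holo_derivative[OF f[OF y]] complex_derivativeD(1) by blast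
    moreover have "blinfun_apply (FD ?y) = frechet_derivative f (at ?y)"
      using FDe[OF y] by (intro ext)
    ultimately have "(f has_derivative blinfun_apply (FD ?y)) (at ?y)" by simp
    then have "((\<lambda>x. f (x + circlepath 0 s t *s v)) has_derivative (\<lambda>w. blinfun_apply (FD ?y) w)) (at x)"
      by (rule has_derivative_compose[rotated]) (auto intro!: derivative_eq_intros)
    then have "((\<lambda>x. f (x + circlepath 0 s t *s v) * k t) has_derivative (\<lambda>w. blinfun_apply (FD ?y) w * k t)) (at x)"
      by (rule has_derivative_mult_left)
    then have "((\<lambda>x. f (x + circlepath 0 s t *s v) * k t) has_derivative blinfun_apply (fx x t)) (at x)"
      unfolding fx_def by (rule has_derivative_eq_rhs) (auto simp: fun_eq_iff mult.commute)
    then show "((\<lambda>x. f (x + circlepath 0 s t *s v) * k t) has_derivative blinfun_apply (fx x t)) (at x within ball x0 r)"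
      by (rule has_derivative_at_withinI)
  qed
  then have d: "(?I has_derivative
      blinfun_apply (integral (cbox 0 1) (fx x0))) (at x0)"
    using at_within_open[OF x0b open_ball] by metis
  have ifx: "fx x0 integrable_on cbox 0 1"
    by (intro integrable_continuous continuous_on_compose2[OF cfx, of _ "\<lambda>t. (x0,t)", simplified split])
      (use x0b in \<open>auto intro!: continuous_intros\<close>)
  have "blinfun_apply (integral (cbox 0 1) (fx x0)) (c *s w) = c * blinfun_apply (integral (cbox 0 1) (fx x0)) w" for c w
  proof -
    have "blinfun_apply (FD y) (c *s w) = c * blinfun_apply (FD y) w" for y
      unfolding FD by (simp add: sum_distrib_left mult_ac)
    then show ?thesis
      unfolding blinfun_apply_integral[OF ifx] fx_def
      by (simp add: mult_ac flip: integral_mult_right)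
  qed
  with d have "holo ?I x0"
    unfolding holo_def complex_derivative_def by blast
  moreover have "eventually (\<lambda>x. ?I x
     = frechet_derivative f (at x) v) (nhds x0)"
    unfolding eventually_nhds using x0b by (intro exI[of _ "ball x0 r"]) (simp add: e)
  ultimately show ?thesis by (rule holo_transform)
qed

lemma vholo_directional_derivative:
  fixes f :: "complex^'a::finite \<Rightarrow> complex^'b"
  assumes O: "open X" and f: "\<And>x. x \<in> X \<Longrightarrow> vholo f x" and x0: "x0 \<in> X"
  shows "vholo (\<lambda>x. frechet_derivative f (at x) v) x0"
  unfolding vholo_iff
proof
  fix i
  have h: "holo (\<lambda>x. f x $ i) x" if "x \<in> X" for x using f that vholo_iff by blast
  have "frechet_derivative (\<lambda>x. f x $ i) (at x) v = frechet_derivative f (at x) v $ i" if "x \<in> X" for x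
  proof -
    have "vderiv f (frechet_derivative f (at x)) x"
      using f[OF that] vholo_derivative by blast
    then show ?thesis
      using holo_derivative[OF h[OF that]] complex_derivative_unique
      unfolding complex_derivative_vec_iff by metis
  qed
  then have "eventually (\<lambda>x. frechet_derivative (\<lambda>x. f x $ i) (at x) v = frechet_derivative f (at x) v $ i) (nhds x0)"
    by (rule eventually_mono[OF eventually_nhds_in_open[OF O x0]])
  with holo_directional_derivative[OF O h x0]
  show "holo (\<lambda>x. frechet_derivative f (at x) v $ i) x0" by (rule holo_transform)
qed

section \<open>Alternating forms\<close>

abbreviation altf :: "nat \<Rightarrow> ((complex^'k) list \<Rightarrow> complex) set"
  where "altf p \<equiv> alt_forms UNIV (+) (*s) p"

lemma altf_add: "A \<in> altf p \<Longrightarrow> A (us @ (x + y) # vs) = A (us @ x # vs) + A (us @ y # vs)"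
proof (cases "length (us @ x # vs) = p")
  case True
  assume "A \<in> altf p"
  then have "A ((us @ x # vs)[length us := x + y]) =
      A ((us @ x # vs)[length us := x]) + A ((us @ x # vs)[length us := y])"
    using True unfolding alt_forms_def mem_Collect_eq
    by (metis (no_types, lifting) UNIV_I length_append length_Cons less_add_Suc1 subset_UNIV add_Suc_right)
  then show ?thesis by simp
qed (auto simp: alt_forms_def)

lemma altf_scale: "A \<in> altf p \<Longrightarrow> A (us @ (c *s x) # vs) = c * A (us @ x # vs)"
proof (cases "length (us @ x # vs) = p")
  case True
  assume "A \<in> altf p"
  then have "A ((us @ x # vs)[length us := c *s x]) = c * A ((us @ x # vs)[length us := x])"
    using True unfolding alt_forms_def mem_Collect_eq
    by (metis (no_types, lifting) UNIV_I length_append length_Cons less_add_Suc1 subset_UNIV add_Suc_right)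
  then show ?thesis by simp
qed (auto simp: alt_forms_def)

lemma altf_not_distinct: "A \<in> altf p \<Longrightarrow> \<not> distinct xs \<Longrightarrow> A xs = 0"
  unfolding alt_forms_def by (cases "length xs = p") auto

lemma altf_length: "A \<in> altf p \<Longrightarrow> length xs \<noteq> p \<Longrightarrow> A xs = 0"
  unfolding alt_forms_def by auto

lemma altfI:
  assumes "\<And>us x y vs. length us + length vs + 1 = p \<Longrightarrow> A (us @ (x + y) # vs) = A (us @ x # vs) + A (us @ y # vs)"
    and "\<And>us c x vs. length us + length vs + 1 = p \<Longrightarrow> A (us @ (c *s x) # vs) = c * A (us @ x # vs)"
    and "\<And>xs. length xs = p \<Longrightarrow> \<not> distinct xs \<Longrightarrow> A xs = 0"
    and "\<And>xs. length xs \<noteq> p \<Longrightarrow> A xs = 0"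
  shows "A \<in> altf p"
  unfolding alt_forms_def mem_Collect_eq
  using assms(1,2)[of "take i _" "drop (Suc i) _" for i] assms(3,4)
  by (auto simp: upd_conv_take_nth_drop)

lemma altf_zero: "A \<in> altf p \<Longrightarrow> A (us @ 0 # vs) = 0"
  using altf_scale[of A p us 0 0 vs] by simp

lemma altf_diff: "A \<in> altf p \<Longrightarrow> A (us @ (x - y) # vs) = A (us @ x # vs) - A (us @ y # vs)"
  using altf_add[of A p us "x - y" y vs] by simp

lemma altf_sum: "A \<in> altf p \<Longrightarrow> A (us @ (\<Sum>i\<in>I. f i) # vs) = (\<Sum>i\<in>I. A (us @ f i # vs))"
  by (induction I rule: infinite_finite_induct) (simp_all add: altf_zero altf_add)

lemma altf_swap:
  assumes "A \<in> altf p"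
  shows "A (us @ x # y # vs) = - A (us @ y # x # vs)"
proof -
  have "A (us @ (x + y) # (x + y) # vs) = 0"
    by (rule altf_not_distinct[OF assms]) simp
  moreover have "A (us @ (x + y) # (x + y) # vs) =
      A (us @ x # (x + y) # vs) + A (us @ y # (x + y) # vs)"
    by (rule altf_add[OF assms])
  moreover have "A ((us @ [w]) @ (x + y) # vs) = A ((us @ [w]) @ x # vs) + A ((us @ [w]) @ y # vs)" for w
    by (rule altf_add[OF assms])
  moreover have "A (us @ w # w # vs) = 0" for w
    by (rule altf_not_distinct[OF assms]) simp
  ultimately show ?thesis by (simp add: eq_neg_iff_add_eq_0)
qed

lemma altf_linear_sub:
  assumes "A \<in> altf p" "\<And>x y. f (x + y) = f x + f y" "\<And>c x. f (c *s x) = c *s f x"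
  shows "(\<lambda>xs. A (map f xs)) \<in> altf p"
proof (rule altfI)
  fix xs :: "(complex^'b) list" assume "\<not> distinct xs"
  then have "\<not> distinct (map f xs)" using distinct_map by blast
  then show "A (map f xs) = 0" by (rule altf_not_distinct[OF assms(1)])
qed (simp_all add: assms altf_add[OF assms(1)] altf_scale[OF assms(1)] altf_length[OF assms(1)])

text \<open>A moving argument is expanded in the standard basis, which leaves constant arguments
  with holomorphic coefficients. The induction takes the moving arguments from the right, so that
  each one joins the constant suffix \<open>vs\<close>.\<close>

lemma holo_altf:
  fixes \<alpha> :: "complex^'a::finite \<Rightarrow> (complex^'k::finite) list \<Rightarrow> complex"
  assumes X: "open X" "x0 \<in> X" and \<alpha>: "\<And>x. x \<in> X \<Longrightarrow> \<alpha> x \<in> altf p"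
    and h: "\<And>vs. length vs = p \<Longrightarrow> holo (\<lambda>x. \<alpha> x vs) x0"
    and f: "\<And>f. f \<in> set fs \<Longrightarrow> vholo f x0"
  shows "holo (\<lambda>x. \<alpha> x (map (\<lambda>f. f x) fs @ vs)) x0"
  using f
proof (induction fs arbitrary: vs rule: rev_induct)
  case Nil
  show ?case
  proof (cases "length vs = p")
    case True
    then show ?thesis using h by simp
  next
    case False
    have "eventually (\<lambda>x. 0 = \<alpha> x vs) (nhds x0)"
      by (rule eventually_mono[OF eventually_nhds_in_open[OF X]]) (simp add: altf_length[OF \<alpha> False])
    with holo_const show ?thesis unfolding list.map append_Nil by (rule holo_transform)
  qed
next
  case (snoc f fs)
  have "holo (\<lambda>x. \<Sum>j\<in>UNIV. f x $ j * \<alpha> x (map (\<lambda>f. f x) fs @ axis j 1 # vs)) x0"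
  proof (intro holo_sum holo_mult)
    show "holo (\<lambda>x. f x $ j) x0" for j using snoc.prems by (intro vholo_nth) auto
    show "holo (\<lambda>x. \<alpha> x (map (\<lambda>f. f x) fs @ axis j 1 # vs)) x0" for j
      using snoc.prems by (intro snoc.IH) auto
  qed
  moreover have "(\<Sum>j\<in>UNIV. f x $ j * \<alpha> x (map (\<lambda>f. f x) fs @ axis j 1 # vs)) =
      \<alpha> x (map (\<lambda>f. f x) (fs @ [f]) @ vs)" if "x \<in> X" for x
  proof -
    have "\<alpha> x (map (\<lambda>f. f x) fs @ f x # vs) =
        \<alpha> x (map (\<lambda>f. f x) fs @ (\<Sum>j\<in>UNIV. f x $ j *s axis j 1) # vs)"
      by (simp add: basis_expansion)
    also have "\<dots> = (\<Sum>j\<in>UNIV. f x $ j * \<alpha> x (map (\<lambda>f. f x) fs @ axis j 1 # vs))"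
      unfolding altf_sum[OF \<alpha>[OF that]] altf_scale[OF \<alpha>[OF that]] ..
    finally show ?thesis by simp
  qed
  then have "eventually (\<lambda>x. (\<Sum>j\<in>UNIV. f x $ j * \<alpha> x (map (\<lambda>f. f x) fs @ axis j 1 # vs)) =
      \<alpha> x (map (\<lambda>f. f x) (fs @ [f]) @ vs)) (nhds x0)"
    by (rule eventually_mono[OF eventually_nhds_in_open[OF X]])
  ultimately show ?case by (rule holo_transform)
qed

text \<open>These are the alternating forms on the quotient by R, pulled back to the whole space.
  Cosets are thereby avoided until the final comparison with \<open>coker B\<close>.\<close>

definition basic_forms :: "(complex^'k) set \<Rightarrow> nat \<Rightarrow> ((complex^'k) list \<Rightarrow> complex) set"
  where "basic_forms R p = {A \<in> altf p. \<forall>xs. set xs \<inter> R \<noteq> {} \<longrightarrow> A xs = 0}"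

lemma basic_formsD:
  assumes "A \<in> basic_forms R p"
  shows "A \<in> altf p" "x \<in> R \<Longrightarrow> A (us @ x # vs) = 0"
  using assms unfolding basic_forms_def by auto

lemma basic_formsI:
  "A \<in> altf p \<Longrightarrow> (\<And>us x vs. x \<in> R \<Longrightarrow> A (us @ x # vs) = 0) \<Longrightarrow> A \<in> basic_forms R p"
  unfolding basic_forms_def by (auto dest: split_list)

text \<open>This is what makes the choice of representatives modulo R harmless. The prefix
  \<open>us\<close> lets the induction hypothesis act on the tail of the list.\<close>

lemma basic_forms_cong:
  assumes A: "A \<in> basic_forms R p" and "list_all2 (\<lambda>x y. x - y \<in> R) xs ys"
  shows "A (us @ xs) = A (us @ ys)"
  using assms(2)
proof (induction xs ys arbitrary: us rule: list_all2_induct)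
  case (Cons x xs y ys)
  have "A (us @ x # xs) = A ((us @ [x]) @ ys)" using Cons.IH[of "us @ [x]"] by simp
  also have "\<dots> = A (us @ y # ys)"
    using altf_diff[OF basic_formsD(1)[OF A], of us x y ys] basic_formsD(2)[OF A Cons.hyps(1), of us ys] by simp
  finally show ?case .
qed simp

lemma alt_forms_add: "A \<in> alt_forms W add scl p \<Longrightarrow> A' \<in> alt_forms W add scl p \<Longrightarrow> A + A' \<in> alt_forms W add scl p"
  unfolding alt_forms_def plus_fun_def by (simp add: algebra_simps)

lemma alt_forms_scale: "A \<in> alt_forms W add scl p \<Longrightarrow> (\<lambda>xs. c * A xs) \<in> alt_forms W add scl p"
  unfolding alt_forms_def by (simp add: algebra_simps)

lemma basic_forms_zero: "(\<lambda>_. 0) \<in> basic_forms R p"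
  by (intro basic_formsI altfI) auto

lemma basic_forms_add: "C \<in> basic_forms R p \<Longrightarrow> C' \<in> basic_forms R p \<Longrightarrow> C + C' \<in> basic_forms R p"
  unfolding basic_forms_def using alt_forms_add[of C _ _ _ p C'] by auto

lemma basic_forms_scale: "C \<in> basic_forms R p \<Longrightarrow> (\<lambda>xs. c * C xs) \<in> basic_forms R p"
  unfolding basic_forms_def using alt_forms_scale[of C _ _ _ p c] by auto

lemma basic_forms_sum:
  assumes "\<And>i. i \<in> I \<Longrightarrow> C i \<in> basic_forms R p"
  shows "(\<lambda>xs. \<Sum>i\<in>I. c i * C i xs) \<in> basic_forms R p"
  using assms
proof (induction I rule: infinite_finite_induct)
  case (insert i I)
  have "(\<lambda>xs. c i * C i xs) + (\<lambda>xs. \<Sum>i\<in>I. c i * C i xs) \<in> basic_forms R p"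
    using insert by (intro basic_forms_add basic_forms_scale) auto
  then show ?case using insert by (simp add: plus_fun_def)
qed (simp_all add: basic_forms_zero)

section \<open>Dimension of the space of basic forms\<close>

text \<open>Insertion sort uses only adjacent transpositions, each of which changes the sign; so the
  sign of the sorting permutation never has to be computed.\<close>

lemma altf_zero_on_permutation:
  assumes A: "A \<in> altf p" and "A (map e (us @ sort js)) = 0"
  shows "A (map e (us @ js :: nat list)) = 0"
  using assms(2)
proof (induction js arbitrary: us)
  case (Cons j js)
  have ins: "A (map e us @ map e (insort j ks)) = 0 \<Longrightarrow> A (map e us @ e j # map e ks) = 0" for us ks
  proof (induction ks arbitrary: us)
    case (Cons k ks)
    show ?case
    proof (cases "j \<le> k")
      case False
      then have "A (map e (us @ [k]) @ e j # map e ks) = 0"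
        using Cons.prems by (intro Cons.IH) simp
      then show ?thesis using altf_swap[OF A, of "map e us" "e j" "e k"] by simp
    qed (use Cons.prems in simp)
  qed simp
  have "A (map e us @ e j # map e (sort js)) = 0" by (rule ins) (use Cons.prems in simp)
  then show ?case using Cons.IH[of "us @ [j]"] by simp
qed simp

text \<open>Multilinearity expands one argument after the other; the prefix \<open>us\<close> holds
  those already replaced by basis vectors.\<close>

lemma altf_zero_on_basis:
  assumes A: "A \<in> altf p" and bas: "finite bas" "\<And>x. x = (\<Sum>b\<in>bas. c x b *s b)"
    and z: "\<And>xs. set xs \<subseteq> bas \<Longrightarrow> A xs = 0"
  shows "set us \<subseteq> bas \<Longrightarrow> A (us @ xs) = 0"
proof (induction xs arbitrary: us)
  case Nil then show ?case using z by simp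
next
  case (Cons x xs)
  have "A (us @ x # xs) = A (us @ (\<Sum>b\<in>bas. c x b *s b) # xs)" using bas(2)[of x] by simp
  also have "\<dots> = (\<Sum>b\<in>bas. c x b * A ((us @ [b]) @ xs))"
    by (simp add: altf_sum[OF A] altf_scale[OF A])
  also have "\<dots> = 0"
  proof (rule sum.neutral, rule ballI)
    fix b assume "b \<in> bas"
    then have "A ((us @ [b]) @ xs) = 0" using Cons.prems by (intro Cons.IH) simp
    then show "c x b * A ((us @ [b]) @ xs) = 0" by simp
  qed
  finally show ?case .
qed

text \<open>The wedge product of the functionals \<open>\<xi> 0\<close>, ...,
  \<open>\<xi> (p - 1)\<close>, as the Leibniz expansion of the determinant of their values.\<close>

definition det_form :: "(nat \<Rightarrow> complex^'k \<Rightarrow> complex) \<Rightarrow> nat \<Rightarrow> (complex^'k) list \<Rightarrow> complex"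
  where "det_form \<xi> p xs = (if length xs = p then
    \<Sum>\<pi> | \<pi> permutes {..<p}. of_int (sign \<pi>) * (\<Prod>i<p. \<xi> (\<pi> i) (xs ! i)) else 0)"

lemma det_form_alt:
  assumes add: "\<And>i x y. \<xi> i (x + y) = \<xi> i x + \<xi> i y" and scl: "\<And>i c x. \<xi> i (c *s x) = c * \<xi> i x"
  shows "det_form \<xi> p \<in> altf p"
proof (rule altfI)
  \<comment> \<open>The factor of the changed slot is split off. The placeholder 0 in that slot
    makes the remaining product visibly independent of w.\<close>
  have pr: "(\<Prod>i<p. \<xi> (\<pi> i) ((us @ w # vs) ! i)) =
      \<xi> (\<pi> (length us)) w * (\<Prod>i\<in>{..<p} - {length us}. \<xi> (\<pi> i) ((us @ 0 # vs) ! i))"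
    if "length us + length vs + 1 = p" for us vs w \<pi>
  proof -
    have "(\<Prod>i<p. \<xi> (\<pi> i) ((us @ w # vs) ! i)) = \<xi> (\<pi> (length us)) ((us @ w # vs) ! length us) *
        (\<Prod>i\<in>{..<p} - {length us}. \<xi> (\<pi> i) ((us @ w # vs) ! i))"
      using that by (intro prod.remove) auto
    also have "(\<Prod>i\<in>{..<p} - {length us}. \<xi> (\<pi> i) ((us @ w # vs) ! i)) =
        (\<Prod>i\<in>{..<p} - {length us}. \<xi> (\<pi> i) ((us @ 0 # vs) ! i))"
      by (intro prod.cong refl) (auto simp: nth_append nth_Cons')
    finally show ?thesis by simp
  qed
  show "det_form \<xi> p (us @ (x + y) # vs) = det_form \<xi> p (us @ x # vs) + det_form \<xi> p (us @ y # vs)"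
    if "length us + length vs + 1 = p" for us x y vs
    using that unfolding det_form_def pr[OF that] by (simp add: add ring_distribs flip: sum.distrib)
  show "det_form \<xi> p (us @ (c *s x) # vs) = c * det_form \<xi> p (us @ x # vs)"
    if "length us + length vs + 1 = p" for us x c vs
    using that unfolding det_form_def pr[OF that] by (simp add: scl sum_distrib_left mult_ac)
  show "det_form \<xi> p xs = 0" if len: "length xs = p" and nd: "\<not> distinct xs" for xs
  proof -
    obtain i j where ij: "i < p" "j < p" "i \<noteq> j" "xs ! i = xs ! j"
      using nd len by (auto simp: distinct_conv_nth)
    define t where "t = Transposition.transpose i j"
    let ?f = "\<lambda>\<pi>. complex_of_int (sign \<pi>) * (\<Prod>i<p. \<xi> (\<pi> i) (xs ! i))"
    have t: "t permutes {..<p}" unfolding t_def using ij by (intro permutes_swap_id) auto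
    have tt: "t (t k) = k" for k by (simp add: t_def)
    have xt: "xs ! t k = xs ! k" for k 
      using ij(4) by (cases "k = i"; cases "k = j") (simp_all add: t_def)
    \<comment> \<open>Composing with the transposition of two positions with equal entries keeps
      every product and flips every sign, so the sum equals its own negative.\<close>
    have "sum ?f {\<pi>. \<pi> permutes {..<p}} = (\<Sum>\<pi> | \<pi> permutes {..<p}. ?f (\<pi> \<circ> t))"
      by (rule sum_permutations_compose_right[OF t])
    also have "\<dots> = (\<Sum>\<pi> | \<pi> permutes {..<p}. - ?f \<pi>)"
    proof (rule sum.cong[OF refl])
      fix \<pi> assume "\<pi> \<in> {\<pi>. \<pi> permutes {..<p}}"
      then have "permutation \<pi>" "permutation t" using t permutation_permutes by blast+
      then have "sign (\<pi> \<circ> t) = - sign \<pi>"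
        using ij(3) by (simp add: sign_compose t_def sign_swap_id)
      moreover have "(\<Prod>i<p. \<xi> ((\<pi> \<circ> t) i) (xs ! i)) = (\<Prod>i<p. \<xi> (\<pi> i) (xs ! i))"
        by (rule prod.reindex_bij_witness[of _ t t])
          (use permutes_in_image[OF t] in \<open>auto simp: tt xt\<close>)
      ultimately show "?f (\<pi> \<circ> t) = - ?f \<pi>" by simp
    qed
    finally have "sum ?f {\<pi>. \<pi> permutes {..<p}} = 0" by (simp add: sum_negf)
    then show ?thesis using len by (simp add: det_form_def)
  qed
qed (simp add: det_form_def)

lemma det_form_zero:
  assumes "\<And>i. i < p \<Longrightarrow> \<xi> i x = 0"
  shows "det_form \<xi> p (us @ x # vs) = 0"
proof -
  have pr: "(\<Prod>i<p. \<xi> (\<pi> i) ((us @ x # vs) ! i)) = 0" if "\<pi> permutes {..<p}" "length (us @ x # vs) = p" for \<pi>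
  proof (rule prod_zero)
    have "\<pi> (length us) < p" using permutes_in_image[OF that(1), of "length us"] that(2) by simp
    then show "\<exists>i\<in>{..<p}. \<xi> (\<pi> i) ((us @ x # vs) ! i) = 0"
      using that(2) assms by (intro bexI[of _ "length us"]) auto
  qed simp
  show ?thesis
  proof (cases "length (us @ x # vs) = p")
    case True
    show ?thesis unfolding det_form_def if_P[OF True]
      by (intro sum.neutral ballI) (simp only: mem_Collect_eq pr[OF _ True] mult_zero_right)
  qed (simp add: det_form_def)
qed

text \<open>A nonzero product forces \<open>ks ! \<pi> i = js ! i\<close> throughout. The lists then
  have the same entries, hence coincide as both are sorted and distinct, and \<pi> is the
  identity.\<close>

lemma det_form_delta:
  assumes ks: "sorted ks" "distinct ks" "length ks = p" and js: "sorted js" "distinct js" "length js = p"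
    and \<xi>: "\<And>k j. k \<in> set ks \<Longrightarrow> j \<in> set js \<Longrightarrow> \<xi> k (e j) = (if k = j then 1 else 0)"
  shows "det_form (\<lambda>i. \<xi> (ks ! i)) p (map e js) = (if ks = js then 1 else 0)"
proof -
  have pr: "(\<Prod>i<p. \<xi> (ks ! \<pi> i) (map e js ! i)) = (if ks = js \<and> \<pi> = id then 1 else 0)"
    if \<pi>: "\<pi> permutes {..<p}" for \<pi>
  proof (cases "\<forall>i<p. ks ! \<pi> i = js ! i")
    case True
    have im: "\<pi> ` {..<p} = {..<p}" using \<pi> by (rule permutes_image)
    have "set js = (\<lambda>i. js ! i) ` {..<p}" using js(3) by (auto simp: set_conv_nth)
    also have "\<dots> = (\<lambda>i. ks ! i) ` \<pi> ` {..<p}" unfolding image_image using True by (intro image_cong) auto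
    also have "\<dots> = set ks" unfolding im using ks(3) by (auto simp: set_conv_nth)
    finally have "set js = set ks" .
    then have eq: "ks = js" using sorted_distinct_set_unique ks js by metis
    have "\<pi> i = i" for i
    proof (cases "i < p")
      case i: True
      then have "\<pi> i < p" using im by auto
      moreover have "ks ! \<pi> i = ks ! i" using True i eq by simp
      ultimately show ?thesis using i ks nth_eq_iff_index_eq by metis
    next
      case False
      then show ?thesis using permutes_not_in[OF \<pi>, of i] by simp
    qed
    then have "\<pi> = id" by auto
    moreover have "(\<Prod>i<p. \<xi> (ks ! \<pi> i) (map e js ! i)) = 1"
    proof (rule prod.neutral, rule ballI)
      fix i assume i: "i \<in> {..<p}"
      have m: "js ! i \<in> set js" "i < length js" using i js(3) by simp_all
      have k: "ks ! \<pi> i = js ! i" using i True by simp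
      have "\<xi> (js ! i) (e (js ! i)) = 1" using m(1) \<xi> eq by simp
      then show "\<xi> (ks ! \<pi> i) (map e js ! i) = 1" unfolding k nth_map[OF m(2)] .
    qed
    ultimately show ?thesis using eq by simp
  next
    case False
    then obtain i where i: "i < p" "ks ! \<pi> i \<noteq> js ! i" by blast
    have "\<pi> i < p" using permutes_in_image[OF \<pi>, of i] i by simp
    then have "\<xi> (ks ! \<pi> i) (map e js ! i) = 0"
      using i ks(3) js(3) \<xi>[of "ks ! \<pi> i" "js ! i"] by simp
    then have z: "(\<Prod>i<p. \<xi> (ks ! \<pi> i) (map e js ! i)) = 0" using i by (intro prod_zero) auto
    have "\<not> (ks = js \<and> \<pi> = id)" using i by auto
    then show ?thesis unfolding z by (simp only: if_False)
  qed
  have "det_form (\<lambda>i. \<xi> (ks ! i)) p (map e js) =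
      (\<Sum>\<pi> | \<pi> permutes {..<p}. of_int (sign \<pi>) * (if ks = js \<and> \<pi> = id then 1 else 0))"
    unfolding det_form_def using js(3) pr by (auto intro!: sum.cong)
  also have "\<dots> = (\<Sum>\<pi> | \<pi> permutes {..<p}. if \<pi> = id then (if ks = js then 1 else 0) else 0)"
    by (intro sum.cong refl) (auto simp: sign_id)
  also have "\<dots> = (if ks = js then 1 else 0)"
    by (subst sum.delta) (auto simp: finite_permutations permutes_id)
  finally show ?thesis .
qed

text \<open>A basis of R is extended to the whole space. The \<delta> coordinates along the added
  vectors vanish on R, and their p-fold wedges, one for each p-subset of the indices, form the
  basis. It is expressed through coefficients so that \<open>form_of\<close> can carry it over to
  families of forms.\<close>

proposition basic_forms_basis:
  fixes R :: "(complex^'k::finite) set"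
  assumes R: "vec.subspace R" and \<delta>: "\<delta> = CARD('k) - vec.dim R"
  obtains A :: "nat set \<Rightarrow> (complex^'k) list \<Rightarrow> complex"
  where "\<And>K. K \<subseteq> {..<\<delta>} \<Longrightarrow> card K = p \<Longrightarrow> A K \<in> basic_forms R p"
    "\<And>C. C \<in> basic_forms R p \<Longrightarrow> \<exists>c. \<forall>xs. C xs = (\<Sum>K | K \<subseteq> {..<\<delta>} \<and> card K = p. c K * A K xs)"
    "\<And>c K. \<forall>xs. (\<Sum>K | K \<subseteq> {..<\<delta>} \<and> card K = p. c K * A K xs) = 0 \<Longrightarrow>
       K \<subseteq> {..<\<delta>} \<Longrightarrow> card K = p \<Longrightarrow> c K = 0"
proof -
  obtain b1 where b1: "b1 \<subseteq> R" "vec.independent b1" "vec.span b1 = R" "card b1 = vec.dim R"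
    using vec.basis_exists[of R] R vec.span_subspace by metis
  define bas where "bas = vec.extend_basis b1"
  have bas: "b1 \<subseteq> bas" "vec.independent bas" "vec.span bas = UNIV"
    unfolding bas_def using vec.extend_basis_superset vec.independent_extend_basis
      vec.span_extend_basis b1(2) by auto
  have fin: "finite bas" using bas(2) vec.finiteI_independent by blast
  have cb: "card bas = CARD('k)"
    using vec.dim_eq_card[of bas UNIV] bas vec.dim_UNIV card_cart_basis
    by (metis vec.dim_span_eq_card_independent vec_dim_card)
  have cd: "card (bas - b1) = \<delta>"
    using card_Diff_subset[of b1 bas] bas(1) fin cb b1(4) \<delta> finite_subset by metis
  obtain e where e: "bij_betw e {..<\<delta>} (bas - b1)"
    using ex_bij_betw_nat_finite[of "bas - b1"] fin cd by (auto simp: atLeast0LessThan)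
  define \<xi> where "\<xi> j x = vec.representation bas x (e j)" for j :: nat and x
  have \<xi>add: "\<xi> j (x + y) = \<xi> j x + \<xi> j y" and \<xi>scl: "\<xi> j (c *s x) = c * \<xi> j x" for j x y c
    unfolding \<xi>_def using bas by (simp_all add: vec.representation_add vec.representation_scale)
  have \<xi>e: "\<xi> k (e j) = (if k = j then 1 else 0)" if "k < \<delta>" "j < \<delta>" for k j
  proof -
    have "e j \<in> bas" using e that bij_betwE by blast
    then have "vec.representation bas (e j) (e k) = (if e k = e j then 1 else 0)"
      using vec.representation_basis[OF bas(2)] by simp
    moreover have "e k = e j \<longleftrightarrow> k = j" using e that by (auto simp: bij_betw_def inj_on_def)
    ultimately show ?thesis by (simp add: \<xi>_def)
  qed
  have \<xi>R: "\<xi> k x = 0" if "k < \<delta>" "x \<in> R" for k x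
  proof -
    have "vec.representation bas x = vec.representation b1 x"
      using vec.representation_extend[of bas x b1] bas b1 that by simp
    moreover have "e k \<notin> b1" using e that bij_betwE by blast
    ultimately show ?thesis using vec.representation_ne_zero \<xi>_def by metis
  qed
  have expand: "x = (\<Sum>b\<in>bas. vec.representation bas x b *s b)" for x
    using vec.sum_representation_eq[OF bas(2) _ fin, of x] bas(3) by simp
  define A where "A K = det_form (\<lambda>i. \<xi> (sorted_list_of_set K ! i)) p" for K
  have slK: "sorted (sorted_list_of_set K)" "distinct (sorted_list_of_set K)"
     "length (sorted_list_of_set K) = p" "set (sorted_list_of_set K) = K"
    if "K \<subseteq> {..<\<delta>}" "card K = p" for K
    using that finite_subset[of K "{..<\<delta>}"] by simp_all
  have Ab: "A K \<in> basic_forms R p" if K: "K \<subseteq> {..<\<delta>}" "card K = p" for K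
    unfolding A_def
  proof (rule basic_formsI)
    fix us x vs assume x: "x \<in> R"
    show "det_form (\<lambda>i. \<xi> (sorted_list_of_set K ! i)) p (us @ x # vs) = 0"
    proof (rule det_form_zero)
      fix i assume "i < p"
      then have "sorted_list_of_set K ! i \<in> K" using slK[OF K] nth_mem by metis
      then show "\<xi> (sorted_list_of_set K ! i) x = 0" using \<xi>R x K by blast
    qed
  qed (intro det_form_alt \<xi>add \<xi>scl)
  have AK: "A K (map e (sorted_list_of_set J)) = (if K = J then 1 else 0)"
    if "K \<subseteq> {..<\<delta>}" "card K = p" "J \<subseteq> {..<\<delta>}" "card J = p" for K J
  proof -
    have "A K (map e (sorted_list_of_set J)) = (if sorted_list_of_set K = sorted_list_of_set J then 1 else 0)"
      unfolding A_def
      using slK[OF that(1,2)] slK[OF that(3,4)] that by (intro det_form_delta \<xi>e) auto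
    then show ?thesis using slK(4)[OF that(1,2)] slK(4)[OF that(3,4)] by metis
  qed
  let ?Ks = "{K. K \<subseteq> {..<\<delta>} \<and> card K = p}"
  have finK: "finite ?Ks" by (rule finite_subset[of _ "Pow {..<\<delta>}"]) auto
  have val: "(\<Sum>K\<in>?Ks. c K * A K (map e (sorted_list_of_set J))) = c J"
    if "J \<subseteq> {..<\<delta>}" "card J = p" for c J
  proof -
    have "(\<Sum>K\<in>?Ks. c K * A K (map e (sorted_list_of_set J))) = (\<Sum>K\<in>?Ks. if K = J then c K else 0)"
      using that by (intro sum.cong refl) (auto simp: AK)
    also have "\<dots> = c J" using that finK by (subst sum.delta) auto
    finally show ?thesis .
  qed
  show ?thesis
  proof (rule that[of A])
    show "A K \<in> basic_forms R p" if "K \<subseteq> {..<\<delta>}" "card K = p" for K using Ab that .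
    show "c K = 0" if "\<forall>xs. (\<Sum>K\<in>?Ks. c K * A K xs) = 0" "K \<subseteq> {..<\<delta>}" "card K = p" for c K
      using that val[of K c] by simp
    show "\<exists>c. \<forall>xs. C xs = (\<Sum>K\<in>?Ks. c K * A K xs)" if C: "C \<in> basic_forms R p" for C
    proof -
      \<comment> \<open>The coefficients are the values of C on increasing tuples of added vectors.
        The difference E then vanishes on all tuples of basis vectors: on those meeting
        \<open>b1\<close> since E is basic, on those with repetitions since it is alternating, and
        on the others by the choice of c.\<close>
      define c where "c K = C (map e (sorted_list_of_set K))" for K
      define E where "E = C + (\<lambda>xs. \<Sum>K\<in>?Ks. (- c K) * A K xs)"
      have E: "E xs = C xs - (\<Sum>K\<in>?Ks. c K * A K xs)" for xs
        by (simp add: E_def plus_fun_def sum_negf)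
      have EB: "E \<in> basic_forms R p"
        unfolding E_def using Ab by (intro basic_forms_add C basic_forms_sum) blast
      note EA = basic_formsD(1)[OF EB]
      have "E ([] @ xs) = 0" for xs
      proof (rule altf_zero_on_basis[OF EA fin expand])
        fix ys assume ys: "set ys \<subseteq> bas"
        show "E ys = 0"
        proof (cases "set ys \<inter> b1 = {}")
          case False
          then obtain x where x: "x \<in> set ys" "x \<in> R" using b1(1) by blast
          then obtain us vs where s: "ys = us @ x # vs" using split_list[OF x(1)] by blast
          show ?thesis unfolding s by (rule basic_formsD(2)[OF EB x(2)])
        next
          case True
          define js where "js = map (inv_into {..<\<delta>} e) ys"
          have sub: "set ys \<subseteq> e ` {..<\<delta>}" using e True ys by (auto simp: bij_betw_def)
          have yj: "ys = map e js"
            unfolding js_def map_map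
          proof (rule map_idI[symmetric])
            fix y assume "y \<in> set ys"
            then have "y \<in> e ` {..<\<delta>}" using sub by blast
            then show "(e \<circ> inv_into {..<\<delta>} e) y = y" unfolding o_apply by (rule f_inv_into_f)
          qed
          have js: "set js \<subseteq> {..<\<delta>}" unfolding js_def set_map
          proof (rule image_subsetI)
            fix y assume "y \<in> set ys"
            then have "y \<in> e ` {..<\<delta>}" using sub by blast
            then show "inv_into {..<\<delta>} e y \<in> {..<\<delta>}" by (rule inv_into_into)
          qed
          show ?thesis
          proof (cases "distinct ys \<and> length ys = p")
            case True
            have dj: "distinct js" "length js = p"
              using True distinct_map[of e js] length_map[of e js] unfolding yj[symmetric] by simp_all
            have sj: "sort js = sorted_list_of_set (set js)"
              using dj(1) by (simp add: sorted_list_of_set_sort_remdups distinct_remdups_id)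
            have "card (set js) = p" using dj distinct_card by metis
            from val[OF js this, of c] have "E (map e (sort js)) = 0"
              unfolding sj E c_def by simp
            then have "E (map e ([] @ sort js)) = 0" by simp
            then have "E (map e ([] @ js)) = 0" by (rule altf_zero_on_permutation[OF EA])
            then show ?thesis unfolding append_Nil yj[symmetric] .
          next
            case False
            then show ?thesis using altf_not_distinct[OF EA] altf_length[OF EA] by blast
          qed
        qed
      qed simp
      then show ?thesis by (intro exI[of _ c]) (simp add: E)
    qed
  qed
qed

section \<open>Row rank and column rank\<close>

text \<open>Expanding the rows in a basis b of the row space exhibits every column as a combination
  of the coefficient vectors \<open>c w\<close>, one for each w in b. The section is there because
  \<open>rank\<close> is the dimension of the row space, while basic forms see the dimension of
  \<open>range B\<close>.\<close>

lemma dim_columns_le_dim_rows: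
  fixes M :: "complex^'a::finite^'b::finite"
  shows "vec.dim (columns M) \<le> vec.dim (rows M)"
proof -
  obtain b where b: "b \<subseteq> rows M" "vec.independent b" "rows M \<subseteq> vec.span b" "card b = vec.dim (rows M)"
    using vec.basis_exists by metis
  have fin: "finite b" using b(2) vec.finiteI_independent by blast
  define c where "c w = (\<chi> i. vec.representation b (row i M) w)" for w
  have "columns M \<subseteq> vec.span (c ` b)"
  proof
    fix x assume "x \<in> columns M"
    then obtain j where j: "x = column j M" by (auto simp: columns_def)
    have "row i M \<in> vec.span b" for i using b(3) by (auto simp: rows_def)
    then have "row i M = (\<Sum>w\<in>b. vec.representation b (row i M) w *s w)" for i
      using vec.sum_representation_eq[OF b(2) _ fin order_refl] by metis
    then have "row i M $ j = (\<Sum>w\<in>b. vec.representation b (row i M) w *s w) $ j" for i by metis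
    then have "x $ i = (\<Sum>w\<in>b. w $ j *s c w) $ i" for i
      by (simp add: j column_def row_def c_def mult.commute sum_component)
    then have "x = (\<Sum>w\<in>b. w $ j *s c w)" by (simp add: vec_eq_iff)
    also have "\<dots> \<in> vec.span (c ` b)"
      by (intro vec.span_sum vec.span_scale vec.span_base) auto
    finally show "x \<in> vec.span (c ` b)" .
  qed
  then have "vec.dim (columns M) \<le> card (c ` b)"
    by (rule vec.dim_le_card) (use fin in simp)
  also have "\<dots> \<le> card b" using fin by (rule card_image_le)
  finally show ?thesis using b(4) by simp
qed

lemma rank_eq_dim_columns:
  fixes M :: "complex^'a::finite^'b::finite"
  shows "rank M = vec.dim (columns M)"
  using dim_columns_le_dim_rows[of M] dim_columns_le_dim_rows[of "transpose M"]
  by (simp add: row_rank_def_gen columns_transpose rows_transpose)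

lemma rank_eq_dim_range:
  fixes M :: "complex^'a::finite^'b::finite"
  shows "rank M = vec.dim (range ((*v) M))"
proof -
  have "range ((*v) M) \<subseteq> vec.span (columns M)"
    using matrix_vector_mult_in_columnspace_gen by blast
  then have "vec.dim (range ((*v) M)) \<le> vec.dim (vec.span (columns M))"
    by (rule vec.dim_subset)
  moreover have "columns M \<subseteq> range ((*v) M)"
  proof -
    have "column i M = M *v axis i 1" for i
      by (simp add: vec_eq_iff column_def matrix_vector_mult_def axis_def mult_delta_right)
    then show ?thesis by (auto simp: columns_def)
  qed
  then have "vec.dim (columns M) \<le> vec.dim (range ((*v) M))"
    by (rule vec.dim_subset)
  ultimately show ?thesis
    unfolding rank_eq_dim_columns vec.dim_span by linarith
qed

section \<open>The group action and the quotient topology\<close>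

text \<open>The component \<open>None\<close> has weight 1 and acts as the logarithm of the scaling
  divided out in projective space, so that one group of dimension m + 1 performs both
  quotients.\<close>

definition aug :: "('n \<Rightarrow> complex^'m) \<Rightarrow> 'n \<Rightarrow> complex^('m option)"
  where "aug \<Lambda> i = (\<chi> k. case k of None \<Rightarrow> 1 | Some j \<Rightarrow> \<Lambda> i $ j)"

definition wt :: "('n \<Rightarrow> complex^'m::finite) \<Rightarrow> 'n \<Rightarrow> complex^('m option) \<Rightarrow> complex"
  where "wt \<Lambda> i \<tau> = bilin (aug \<Lambda> i) \<tau>"

definition gact :: "('n \<Rightarrow> complex^'m::finite) \<Rightarrow> complex^('m option) \<Rightarrow> complex^'n::finite \<Rightarrow> complex^'n"
  where "gact \<Lambda> \<tau> z = (\<chi> i. exp (wt \<Lambda> i \<tau>) * z $ i)"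

text \<open>The punctured cone over \<open>lvm_V \<Lambda>\<close>: the origin is excluded because
  the convex hull of the empty set is empty.\<close>

definition stab :: "('n \<Rightarrow> complex^'m) \<Rightarrow> (complex^'n::finite) set"
  where "stab \<Lambda> = {z. 0 \<in> convex hull (\<Lambda> ` {i. z $ i \<noteq> 0})}"

definition lproj :: "('n \<Rightarrow> complex^'m) \<Rightarrow> complex^'n::finite \<Rightarrow> 'n ppoint set"
  where "lproj \<Lambda> z = lvm_orbit \<Lambda> (proj_pt z)"

lemma bilin_add: "bilin x (y + z) = bilin x y + bilin x z"
  and bilin_scale: "bilin x (c *s y) = c * bilin x y"
  and bilin_add_left: "bilin (x + w) y = bilin x y + bilin w y"
  and bilin_scale_left: "bilin (c *s x) y = c * bilin x y"
  by (simp_all add: bilin_def sum.distrib sum_distrib_left algebra_simps)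

lemma bilin_scaleR: "bilin x (r *\<^sub>R y) = of_real r * bilin x y"
  and bilin_scaleR_left: "bilin (r *\<^sub>R x) y = of_real r * bilin x y"
  by (simp_all add: scaleR_eq_vector_scalar_mult bilin_scale bilin_scale_left)

lemma bilin_zero [simp]: "bilin x 0 = 0" "bilin 0 x = 0"
  by (simp_all add: bilin_def)

lemma bilin_minus: "bilin x (- y) = - bilin x y"
  by (simp add: bilin_def sum_negf)

lemma bilin_diff_left: "bilin (x - w) y = bilin x y - bilin w y"
  by (simp add: bilin_def sum_subtractf algebra_simps)

lemma bilin_sum_left: "bilin (sum f I) y = (\<Sum>i\<in>I. bilin (f i) y)"
  by (induction I rule: infinite_finite_induct) (simp_all add: bilin_add_left)

lemma Re_bilin: "Re (bilin x y) = inner x (\<chi> j. cnj (y $ j))"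
  by (simp add: bilin_def inner_vec_def inner_complex_def)

lemma continuous_bilin: "continuous_on X (bilin x)"
  unfolding bilin_def by (intro continuous_intros)

lemma wt_eq: "wt \<Lambda> i \<tau> = \<tau> $ None + bilin (\<Lambda> i) (\<chi> j. \<tau> $ Some j)"
  by (simp add: wt_def bilin_def aug_def UNIV_option_conv sum.reindex)

lemma wt_add: "wt \<Lambda> i (\<sigma> + \<tau>) = wt \<Lambda> i \<sigma> + wt \<Lambda> i \<tau>"
  and wt_scale: "wt \<Lambda> i (c *s \<tau>) = c * wt \<Lambda> i \<tau>"
  and wt_zero [simp]: "wt \<Lambda> i 0 = 0"
  by (simp_all add: wt_def bilin_add bilin_scale)

lemma gact_nth [simp]: "gact \<Lambda> \<tau> z $ i = exp (wt \<Lambda> i \<tau>) * z $ i"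
  by (simp add: gact_def)

lemma gact_gact: "gact \<Lambda> \<sigma> (gact \<Lambda> \<tau> z) = gact \<Lambda> (\<sigma> + \<tau>) z"
  by (simp add: vec_eq_iff wt_add exp_add)

lemma gact_zero [simp]: "gact \<Lambda> 0 z = z"
  by (simp add: vec_eq_iff)

lemma gact_inverse [simp]: "gact \<Lambda> \<tau> (gact \<Lambda> (- \<tau>) z) = z" "gact \<Lambda> (- \<tau>) (gact \<Lambda> \<tau> z) = z"
  by (simp_all add: gact_gact)

lemma stab_gact [simp]: "gact \<Lambda> \<tau> z \<in> stab \<Lambda> \<longleftrightarrow> z \<in> stab \<Lambda>"
  by (simp add: stab_def)

lemma stab_mono:
  "z \<in> stab \<Lambda> \<Longrightarrow> (\<And>i. z $ i \<noteq> 0 \<Longrightarrow> w $ i \<noteq> 0) \<Longrightarrow> w \<in> stab \<Lambda>"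
  unfolding stab_def mem_Collect_eq
  by (erule rev_subsetD, rule hull_mono) auto

lemma stab_nonzero: "z \<in> stab \<Lambda> \<Longrightarrow> z \<noteq> 0"
  by (auto simp: stab_def)

text \<open>Stability depends only on the support, which can only grow near a point, and growing it
  preserves stability.\<close>

lemma open_stab:
  fixes \<Lambda> :: "'n::finite \<Rightarrow> complex^'m"
  shows "open (stab \<Lambda>)"
  unfolding open_subopen[of "stab \<Lambda>"]
proof
  fix z assume z: "z \<in> stab \<Lambda>"
  let ?T = "\<Inter>i\<in>{i. z $ i \<noteq> 0}. {w::complex^'n. w $ i \<noteq> 0}"
  have "open ?T"
  proof (rule open_INT)
    show "\<forall>i\<in>{i. z $ i \<noteq> 0}. open {w::complex^'n. w $ i \<noteq> 0}"
    proof
      fix i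
      show "open {w::complex^'n. w $ i \<noteq> 0}"
        by (intro open_Collect_neq bounded_linear.continuous_on[OF bounded_linear_vec_nth]
            continuous_on_id continuous_on_const)
    qed
  qed simp
  moreover have "z \<in> ?T" "?T \<subseteq> stab \<Lambda>" using stab_mono[OF z] by auto
  ultimately show "\<exists>T. open T \<and> z \<in> T \<and> T \<subseteq> stab \<Lambda>" by blast
qed

lemma proj_pt_eq_iff:
  "proj_pt z = proj_pt w \<longleftrightarrow> (\<exists>c. c \<noteq> 0 \<and> w = c *s z)"
proof
  assume "proj_pt z = proj_pt w"
  moreover have "w \<in> proj_pt w" by (auto simp: proj_pt_def intro!: exI[of _ 1])
  ultimately show "\<exists>c. c \<noteq> 0 \<and> w = c *s z" by (auto simp: proj_pt_def)
next
  assume "\<exists>c. c \<noteq> 0 \<and> w = c *s z"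
  then obtain c where c: "c \<noteq> 0" "w = c *s z" by blast
  have "\<exists>k'. k *s z = k' *s w \<and> k' \<noteq> 0" if "k \<noteq> 0" for k
    using that c by (intro exI[of _ "k / c"]) (simp add: vector_smult_assoc)
  then show "proj_pt z = proj_pt w"
    using c by (auto simp: proj_pt_def vector_smult_assoc)
qed

lemma lvm_act_proj_pt: "lvm_act \<Lambda> T (proj_pt z) = proj_pt (\<chi> i. exp (bilin (\<Lambda> i) T) * z $ i)"
proof -
  have "(\<chi> i. exp (bilin (\<Lambda> i) T) * (c *s z) $ i) = c *s (\<chi> i. exp (bilin (\<Lambda> i) T) * z $ i)" for c
    by (simp add: vec_eq_iff)
  then show ?thesis unfolding lvm_act_def proj_pt_def by (auto simp: image_def)
qed

text \<open>Nonzero scalars are exponentials: scaling by c followed or preceded by T is the group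
  element with component \<open>Ln c\<close> at \<open>None\<close> and T elsewhere.\<close>

lemma lproj_eq_iff: "lproj \<Lambda> z = lproj \<Lambda> w \<longleftrightarrow> (\<exists>\<tau>. w = gact \<Lambda> \<tau> z)"
proof -
  define E where "E T z = (\<chi> i. exp (bilin (\<Lambda> i) T) * z $ i)" for T :: "complex^'b" and z :: "complex^'a"
  have l: "lproj \<Lambda> z = range (\<lambda>T. proj_pt (E T z))" for z
    by (simp add: lproj_def lvm_orbit_def lvm_act_proj_pt E_def)
  have E: "c *s E T z = gact \<Lambda> (\<chi> k. case k of None \<Rightarrow> Ln c | Some j \<Rightarrow> T $ j) z" if "c \<noteq> 0" for c T z
    using that by (simp add: vec_eq_iff E_def wt_eq exp_add)
  have E': "gact \<Lambda> \<tau> z = exp (\<tau> $ None) *s E (\<chi> j. \<tau> $ Some j) z" for \<tau> z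
    by (simp add: vec_eq_iff E_def wt_eq exp_add)
  have EE: "E T (E S z) = E (T + S) z" for T S z
    by (simp add: vec_eq_iff E_def bilin_add exp_add)
  show ?thesis
  proof
    assume "lproj \<Lambda> z = lproj \<Lambda> w"
    moreover have "proj_pt w \<in> lproj \<Lambda> w"
      unfolding l by (rule range_eqI[of _ _ 0]) (simp add: E_def)
    ultimately have "proj_pt w \<in> range (\<lambda>T. proj_pt (E T z))" unfolding l by simp
    then obtain T where "proj_pt w = proj_pt (E T z)" by (rule rangeE)
    then have "proj_pt (E T z) = proj_pt w" ..
    then obtain c where "c \<noteq> 0" "w = c *s E T z" unfolding proj_pt_eq_iff by blast
    then show "\<exists>\<tau>. w = gact \<Lambda> \<tau> z" using E by metis
  next
    assume "\<exists>\<tau>. w = gact \<Lambda> \<tau> z"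
    then obtain \<tau> where w: "w = gact \<Lambda> \<tau> z" by blast
    define S where "S = (\<chi> j. \<tau> $ Some j)"
    have ET: "E T w = exp (\<tau> $ None) *s E (T + S) z" for T
      unfolding w E' EE[symmetric] S_def by (simp add: vec_eq_iff E_def)
    have p: "proj_pt (E T w) = proj_pt (E (T + S) z)" for T
    proof -
      have "proj_pt (E (T + S) z) = proj_pt (E T w)"
        unfolding proj_pt_eq_iff
        by (intro exI[of _ "exp (\<tau> $ None)"] conjI exp_not_eq_zero ET)
      then show ?thesis ..
    qed
    have "range (\<lambda>T. proj_pt (E (T + S) z)) = (\<lambda>T. proj_pt (E T z)) ` range (\<lambda>T. T + S)"
      unfolding image_image ..
    also have "range (\<lambda>T. T + S) = UNIV"
      by (rule surjI[where f="\<lambda>T. T - S"]) simp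
    finally show "lproj \<Lambda> z = lproj \<Lambda> w" unfolding l p ..
  qed
qed

lemma lproj_gact [simp]: "lproj \<Lambda> (gact \<Lambda> \<tau> z) = lproj \<Lambda> z"
  using lproj_eq_iff by metis

lemma proj_pt_in_lvm_V: "z \<noteq> 0 \<and> proj_pt z \<in> lvm_V \<Lambda> \<longleftrightarrow> z \<in> stab \<Lambda>"
proof
  assume "z \<in> stab \<Lambda>"
  then show "z \<noteq> 0 \<and> proj_pt z \<in> lvm_V \<Lambda>"
    using stab_nonzero unfolding lvm_V_def stab_def by blast
next
  assume "z \<noteq> 0 \<and> proj_pt z \<in> lvm_V \<Lambda>"
  then obtain w where w: "proj_pt w = proj_pt z" "w \<in> stab \<Lambda>"
    unfolding lvm_V_def stab_def by auto
  then obtain c where "c \<noteq> 0" "z = c *s w" unfolding proj_pt_eq_iff by blast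
  then show "z \<in> stab \<Lambda>" using w(2) by (auto intro: stab_mono)
qed

lemma topspace_quotient_topology: "topspace (quotient_topology X f) = f ` topspace X"
proof -
  have "{x \<in> topspace X. f x \<in> f ` topspace X} = topspace X" by auto
  then have "openin (quotient_topology X f) (f ` topspace X)"
    unfolding openin_quotient_topology by simp
  moreover have "topspace (quotient_topology X f) \<subseteq> f ` topspace X"
    using openin_topspace[of "quotient_topology X f"] unfolding openin_quotient_topology by simp
  ultimately show ?thesis using openin_subset by blast
qed

text \<open>A quotient of a subspace of a quotient becomes a single quotient of an open subset of
  the vector space. This works because \<open>stab \<Lambda>\<close> is open and is the full
  preimage of \<open>lvm_V \<Lambda>\<close>.\<close>

lemma openin_lvm_space:
  "openin (lvm_space \<Lambda>) U \<longleftrightarrow> U \<subseteq> lproj \<Lambda> ` stab \<Lambda> \<and> open {z \<in> stab \<Lambda>. lproj \<Lambda> z \<in> U}"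
proof -
  have top: "topspace proj_topology = proj_pt ` (- {0})"
    unfolding proj_topology_def topspace_quotient_topology by simp
  have V: "lvm_V \<Lambda> = proj_pt ` stab \<Lambda>"
    unfolding lvm_V_def stab_def using stab_nonzero[unfolded stab_def] by fastforce
  have VP: "topspace (subtopology proj_topology (lvm_V \<Lambda>)) = lvm_V \<Lambda>"
    unfolding topspace_subtopology top V using stab_nonzero by fastforce
  have "openin (lvm_space \<Lambda>) U \<longleftrightarrow> U \<subseteq> lproj \<Lambda> ` stab \<Lambda> \<and>
      openin (subtopology proj_topology (lvm_V \<Lambda>)) {P \<in> lvm_V \<Lambda>. lvm_orbit \<Lambda> P \<in> U}"
    unfolding lvm_space_def openin_quotient_topology VP by (simp add: V image_image lproj_def)
  moreover have "openin (subtopology proj_topology (lvm_V \<Lambda>)) {P \<in> lvm_V \<Lambda>. lvm_orbit \<Lambda> P \<in> U}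
     \<longleftrightarrow> open {z \<in> stab \<Lambda>. lproj \<Lambda> z \<in> U}" (is "?l \<longleftrightarrow> ?r")
  proof
    assume ?l
    then obtain T where T: "openin proj_topology T" "{P \<in> lvm_V \<Lambda>. lvm_orbit \<Lambda> P \<in> U} = T \<inter> lvm_V \<Lambda>"
      unfolding openin_subtopology by blast
    have "open {z \<in> - {0}. proj_pt z \<in> T}"
      using T(1) unfolding proj_topology_def openin_quotient_topology
      by (simp add: openin_open_eq open_Compl)
    then have "open ({z \<in> - {0}. proj_pt z \<in> T} \<inter> stab \<Lambda>)" using open_stab by blast
    moreover have "{z \<in> - {0}. proj_pt z \<in> T} \<inter> stab \<Lambda> = {z \<in> stab \<Lambda>. lproj \<Lambda> z \<in> U}"
    proof -
      have "proj_pt z \<in> T \<longleftrightarrow> lproj \<Lambda> z \<in> U" if "z \<in> stab \<Lambda>" for z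
        using T(2) that V unfolding lproj_def by blast
      then show ?thesis using stab_nonzero by blast
    qed
    ultimately show ?r by simp
  next
    assume r: ?r
    let ?W = "{P \<in> lvm_V \<Lambda>. lvm_orbit \<Lambda> P \<in> U}"
    have "{z \<in> - {0}. proj_pt z \<in> ?W} = {z \<in> stab \<Lambda>. lproj \<Lambda> z \<in> U}"
      using proj_pt_in_lvm_V[of _ \<Lambda>] by (auto simp: lproj_def)
    then have "openin proj_topology ?W"
      unfolding proj_topology_def openin_quotient_topology
      using r VP top by (auto simp: openin_open_eq open_Compl)
    then show ?l unfolding openin_subtopology by blast
  qed
  ultimately show ?thesis by simp
qed

lemma topspace_lvm_space: "topspace (lvm_space \<Lambda>) = lproj \<Lambda> ` stab \<Lambda>"
proof -
  have "openin (lvm_space \<Lambda>) (lproj \<Lambda> ` stab \<Lambda>)"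
    unfolding openin_lvm_space using open_stab by (simp add: Collect_mem_eq cong: conj_cong)
  then show ?thesis
    using openin_lvm_space[of \<Lambda> "topspace (lvm_space \<Lambda>)"] openin_subset by blast
qed

section \<open>Consequences of admissibility\<close>

text \<open>Otherwise the hull would lie in an open half space with 0 on its boundary; its normal is
  the conjugate of T.\<close>

lemma hull_zero_Re_ge:
  assumes "0 \<in> convex hull (\<Lambda> ` J)"
  shows "\<exists>j\<in>J. Re (bilin (\<Lambda> j) T) \<ge> 0"
proof (rule ccontr)
  assume a: "\<not> ?thesis"
  let ?c = "\<chi> j. cnj (T $ j)"
  have "convex hull (\<Lambda> ` J) \<subseteq> {x. inner ?c x < 0}"
    using a by (intro hull_minimal convex_halfspace_lt) (auto simp: Re_bilin inner_commute not_le)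
  then show False using assms by auto
qed

locale lvm =
  fixes \<Lambda> :: "'n::finite \<Rightarrow> complex ^ 'm::finite"
  assumes admissible: "admissible \<Lambda>"
begin

abbreviation S where "S \<equiv> stab \<Lambda>"
abbreviation q where "q \<equiv> lproj \<Lambda>"
abbreviation g where "g \<equiv> gact \<Lambda>"

text \<open>In a convex combination of 0 by points with nonpositive real part, only points with real
  part exactly 0 carry weight. If T were nonzero they would lie in a real hyperplane of dimension 2m
  - 1, and Caratheodory's theorem would leave at most 2m of them with 0 in their hull, against
  admissibility.\<close>

lemma Re_bilin_le_zero_imp:
  assumes J: "0 \<in> convex hull (\<Lambda> ` J)" and T: "\<And>j. j \<in> J \<Longrightarrow> Re (bilin (\<Lambda> j) T) \<le> 0"
  shows "T = 0"
proof (rule ccontr)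
  assume T0: "T \<noteq> 0"
  define c where "c = (\<chi> j. cnj (T $ j))"
  have c0: "c \<noteq> 0" using T0 by (auto simp: c_def vec_eq_iff)
  have le: "inner c x \<le> 0" if "x \<in> \<Lambda> ` J" for x
    using T that by (auto simp: Re_bilin c_def inner_commute)
  obtain u where u: "\<And>x. x \<in> \<Lambda> ` J \<Longrightarrow> 0 \<le> u x" "sum u (\<Lambda> ` J) = 1" "(\<Sum>x\<in>\<Lambda> ` J. u x *\<^sub>R x) = 0"
    using J by (auto simp: convex_hull_finite)
  have "(\<Sum>x\<in>\<Lambda> ` J. - (u x * inner c x)) = 0"
  proof -
    have "inner c (\<Sum>x\<in>\<Lambda> ` J. u x *\<^sub>R x) = 0" unfolding u(3) by simp
    then show ?thesis by (simp add: inner_sum_right sum_negf)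
  qed
  moreover have "0 \<le> - (u x * inner c x)" if "x \<in> \<Lambda> ` J" for x
    using u(1)[OF that] le[OF that] by (simp add: mult_nonneg_nonpos)
  ultimately have z: "u x * inner c x = 0" if "x \<in> \<Lambda> ` J" for x
    using that by (subst (asm) sum_nonneg_eq_0_iff) auto
  define X where "X = {x \<in> \<Lambda> ` J. u x \<noteq> 0}"
  have X: "sum u X = 1" "(\<Sum>x\<in>X. u x *\<^sub>R x) = 0"
  proof -
    have "sum u X = sum u (\<Lambda> ` J)"
      unfolding X_def by (rule sum.mono_neutral_left) auto
    then show "sum u X = 1" using u(2) by simp
    have "(\<Sum>x\<in>X. u x *\<^sub>R x) = (\<Sum>x\<in>\<Lambda> ` J. u x *\<^sub>R x)"
      unfolding X_def by (rule sum.mono_neutral_left) auto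
    then show "(\<Sum>x\<in>X. u x *\<^sub>R x) = 0" using u(3) by simp
  qed
  have "finite X" unfolding X_def by simp
  then have "0 \<in> convex hull X"
    unfolding convex_hull_finite[OF \<open>finite X\<close>] using X u(1) by (auto simp: X_def intro!: exI[of _ u])
  then obtain Y where Y: "finite Y" "Y \<subseteq> X" "card Y \<le> aff_dim X + 1" "0 \<in> convex hull Y"
    unfolding caratheodory_aff_dim[of X] by blast
  have "X \<subseteq> {x. inner c x = 0}" using z by (auto simp: X_def)
  then have "aff_dim X \<le> aff_dim {x. inner c x = 0}" by (rule aff_dim_subset)
  also have "\<dots> = 2 * int CARD('m) - 1" using aff_dim_hyperplane[OF c0, of 0] by simp
  finally have "card Y \<le> 2 * CARD('m)" using Y(3) by linarith
  moreover have "Y \<subseteq> \<Lambda> ` J" using Y(2) by (auto simp: X_def)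
  \<comment> \<open>Admissibility counts labels, not points, so each point of Y is represented by
    exactly one label.\<close>
  then obtain I where I: "inj_on \<Lambda> I" "Y = \<Lambda> ` I" unfolding subset_image_inj by blast
  ultimately have "card I \<le> 2 * CARD('m)" using card_image by metis
  moreover have "I \<noteq> {}" using Y(4) I(2) by auto
  then have "1 \<le> card I" using card_gt_0_iff[of I] by simp
  ultimately show False using admissible Y(4) I(2) unfolding admissible_def by blast
qed

text \<open>On the support, Re <\<Lambda>_i, T> has the constant value - Re \<tau>_0. The half space
  argument for T and for - T makes it 0, whence T = 0. The imaginary part of \<tau>_0 stays free, as
  scalars of modulus 1 do not change moduli.\<close>

lemma Re_wt_eq_zero_imp:
  assumes z: "z \<in> S" and w: "\<And>i. z $ i \<noteq> 0 \<Longrightarrow> Re (wt \<Lambda> i \<tau>) = 0"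
  shows "\<tau> $ Some j = 0" "Re (\<tau> $ None) = 0"
proof -
  let ?T = "\<chi> j. \<tau> $ Some j"
  have e: "Re (bilin (\<Lambda> i) ?T) = - Re (\<tau> $ None)" if "z $ i \<noteq> 0" for i
    using w[OF that] by (simp add: wt_eq)
  have h: "0 \<in> convex hull (\<Lambda> ` {i. z $ i \<noteq> 0})" using z by (simp add: stab_def)
  from hull_zero_Re_ge[OF h, of ?T] hull_zero_Re_ge[OF h, of "- ?T"]
  show r: "Re (\<tau> $ None) = 0" using e by (auto simp: bilin_minus)
  have "?T = 0" by (rule Re_bilin_le_zero_imp[OF h]) (simp add: e r)
  then show "\<tau> $ Some j = 0" by (simp add: vec_eq_iff)
qed

text \<open>Infinitesimally the action is free on \<open>S\<close>; dually, the vectors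
  \<open>aug \<Lambda> i\<close> with i in the support of z span.\<close>

lemma wt_eq_zero_imp:
  assumes z: "z \<in> S" and w: "\<And>i. z $ i \<noteq> 0 \<Longrightarrow> wt \<Lambda> i \<tau> = 0"
  shows "\<tau> = 0"
proof -
  have T: "\<tau> $ Some j = 0" for j by (rule Re_wt_eq_zero_imp[OF z]) (simp add: w)
  obtain i where "z $ i \<noteq> 0" using stab_nonzero[OF z] by (auto simp: vec_eq_iff)
  from w[OF this] have "\<tau> $ None = 0" using T by (simp add: wt_eq bilin_def)
  then show ?thesis using T by (simp add: vec_eq_iff split: option.splits) (metis not_None_eq)
qed

lemma one_in_stab: "1 \<in> S"
  using admissible by (simp add: stab_def admissible_def)

section \<open>A compact set meeting all orbits\<close>

text \<open>Unit vectors at which the norm is critical along the orbit of T: the derivative of the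
  squared norm in direction V is 2 Re <w, V> for w the sum of |z_i|^2 \<Lambda>_i, as in the theorem
  of Kempf and Ness.\<close>

definition moment_set :: "(complex^'n) set"
  where "moment_set = {z. norm z = 1 \<and> (\<Sum>i\<in>UNIV. (norm (z $ i))\<^sup>2 *\<^sub>R \<Lambda> i) = 0}"

lemma norm_vec_square: "(norm z)\<^sup>2 = (\<Sum>i\<in>UNIV. (norm (z $ i))\<^sup>2)" for z :: "complex^'n"
  by (simp add: norm_vec_def L2_set_def sum_nonneg)

lemma compact_moment_set: "compact moment_set"
proof -
  have "closed moment_set"
    unfolding moment_set_def by (intro closed_Collect_conj closed_Collect_eq continuous_intros)
  moreover have "bounded moment_set"
    unfolding moment_set_def bounded_iff by (intro exI[of _ 1]) auto
  ultimately show ?thesis by (simp add: compact_eq_bounded_closed)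
qed

lemma moment_set_subset: "moment_set \<subseteq> S"
proof
  fix z assume z: "z \<in> moment_set"
  let ?J = "{i. z $ i \<noteq> 0}"
  have s: "(\<Sum>i\<in>?J. (norm (z $ i))\<^sup>2) = 1"
  proof -
    have "(\<Sum>i\<in>?J. (norm (z $ i))\<^sup>2) = (\<Sum>i\<in>UNIV. (norm (z $ i))\<^sup>2)"
      by (intro sum.mono_neutral_left) auto
    then show ?thesis using z by (simp add: moment_set_def flip: norm_vec_square)
  qed
  have "(\<Sum>i\<in>?J. (norm (z $ i))\<^sup>2 *\<^sub>R \<Lambda> i) = (\<Sum>i\<in>UNIV. (norm (z $ i))\<^sup>2 *\<^sub>R \<Lambda> i)"
    by (intro sum.mono_neutral_left) auto
  also have "\<dots> = 0" using z by (simp add: moment_set_def)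
  finally have "(\<Sum>i\<in>?J. (norm (z $ i))\<^sup>2 *\<^sub>R \<Lambda> i) = 0" .
  moreover have "(\<Sum>i\<in>?J. (norm (z $ i))\<^sup>2 *\<^sub>R \<Lambda> i) \<in> convex hull (\<Lambda> ` ?J)"
    by (rule convex_sum) (use s in \<open>auto intro: hull_inc\<close>)
  ultimately show "z \<in> S" by (simp add: stab_def)
qed

text \<open>The left-hand sum is continuous and positively homogeneous in T, and by
  \<open>Re_bilin_le_zero_imp\<close> it is positive on the unit sphere; c is its minimum
  there.\<close>

lemma Re_bilin_coercive:
  assumes "0 \<in> convex hull (\<Lambda> ` J)"
  obtains c where "c > 0" "\<And>T. (\<Sum>j\<in>J. max 0 (Re (bilin (\<Lambda> j) T))) \<ge> c * norm T"
proof -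
  define h where "h T = (\<Sum>j\<in>J. max 0 (Re (bilin (\<Lambda> j) T)))" for T
  have "continuous_on (sphere 0 1) h"
    unfolding h_def by (intro continuous_intros continuous_bilin)
  moreover have "sphere (0::complex^'m) 1 \<noteq> {}" by (simp add: sphere_eq_empty)
  ultimately obtain u where u: "u \<in> sphere 0 1" "\<And>T. T \<in> sphere 0 1 \<Longrightarrow> h u \<le> h T"
    using continuous_attains_inf[of "sphere 0 1" h] by auto
  have h0: "h T \<ge> 0" for T unfolding h_def by (intro sum_nonneg) simp
  have "h u > 0"
  proof (rule ccontr)
    assume "\<not> h u > 0"
    then have "h u = 0" using h0[of u] by simp
    then have "max 0 (Re (bilin (\<Lambda> j) u)) = 0" if "j \<in> J" for j
      unfolding h_def using that by (subst (asm) sum_nonneg_eq_0_iff) auto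
    then have "Re (bilin (\<Lambda> j) u) \<le> 0" if "j \<in> J" for j
      using that by (metis max.cobounded2)
    then have "u = 0" by (rule Re_bilin_le_zero_imp[OF assms])
    then show False using u(1) by simp
  qed
  moreover have "h T \<ge> h u * norm T" for T
  proof (cases "T = 0")
    case False
    define v where "v = T /\<^sub>R norm T"
    have v: "v \<in> sphere 0 1" "T = norm T *\<^sub>R v" using False by (simp_all add: v_def)
    have "h (norm T *\<^sub>R v) = norm T * h v"
      unfolding h_def sum_distrib_left by (simp add: bilin_scaleR max_mult_distrib_left)
    then have "h T = norm T * h v" using v(2) by simp
    then show ?thesis using u(2)[OF v(1)] by (simp add: mult.commute mult_left_mono)
  qed (simp add: h0)
  ultimately show ?thesis using that unfolding h_def by blast
qed

text \<open>The orbit of \<open>z\<close> meets \<open>moment_set\<close> where \<open>\<Sum>\<^sub>i |z\<^sub>i|\<^sup>2 exp (2 Re \<langle>\<Lambda>\<^sub>i,T\<rangle>)\<close> is minimal.\<close>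

lemma orbit_meets_moment_set:
  assumes z: "z \<in> S"
  obtains \<tau> where "g \<tau> z \<in> moment_set"
proof -
  let ?J = "{i. z $ i \<noteq> 0}"
  have hull: "0 \<in> convex hull (\<Lambda> ` ?J)" using z by (simp add: stab_def)
  define f where "f T = (\<Sum>i\<in>UNIV. (norm (z $ i))\<^sup>2 * exp (2 * Re (bilin (\<Lambda> i) T)))" for T
  have cf: "continuous_on X f" for X
    unfolding f_def by (intro continuous_intros continuous_bilin)
  obtain c where c: "c > 0" "\<And>T. (\<Sum>j\<in>?J. max 0 (Re (bilin (\<Lambda> j) T))) \<ge> c * norm T"
    using Re_bilin_coercive[OF hull] by blast
  \<comment> \<open>With b the least |z_i|^2 on the support, coercivity and
    \<open>max 0 x \<le> exp (2 * x)\<close> give the linear lower bound b c |T| for f.\<close>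
  define b where "b = Min ((\<lambda>i. (norm (z $ i))\<^sup>2) ` ?J)"
  have ne: "?J \<noteq> {}" using stab_nonzero[OF z] by (auto simp: vec_eq_iff)
  have b: "b > 0" unfolding b_def using ne by (subst Min_gr_iff) auto
  have bl: "b \<le> (norm (z $ i))\<^sup>2" if "i \<in> ?J" for i unfolding b_def using that by (intro Min_le) auto
  have lower: "b * (c * norm T) \<le> f T" for T
  proof -
    have ex: "max 0 x \<le> exp (2 * x)" for x :: real
      using exp_ge_add_one_self[of "2 * x"] exp_ge_zero[of "2 * x"] by (smt (verit))
    have "b * (c * norm T) \<le> b * (\<Sum>j\<in>?J. max 0 (Re (bilin (\<Lambda> j) T)))"
      using b c(2) by simp
    also have "\<dots> \<le> (\<Sum>j\<in>?J. (norm (z $ j))\<^sup>2 * exp (2 * Re (bilin (\<Lambda> j) T)))"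
      unfolding sum_distrib_left using bl b by (intro sum_mono mult_mono ex) auto
    also have "\<dots> \<le> f T" unfolding f_def by (intro sum_mono2) auto
    finally show ?thesis .
  qed
  \<comment> \<open>R solves b c R = f 0. Outside the ball of radius R the value is at least f 0, so
    the minimum over the ball is global.\<close>
  define R where "R = f 0 / (b * c)"
  have f0: "f 0 \<ge> 0" unfolding f_def by (intro sum_nonneg) auto
  have R: "R \<ge> 0" using b c(1) f0 by (simp add: R_def)
  obtain T where T: "T \<in> cball 0 R" "\<And>U. U \<in> cball 0 R \<Longrightarrow> f T \<le> f U"
    using continuous_attains_inf[OF compact_cball _ cf, of 0 R] R by auto
  have glob: "f T \<le> f U" for U
  proof (cases "norm U \<le> R")
    case False
    have "f T \<le> f 0" using T(2)[of 0] R by simp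
    also have "\<dots> = b * (c * R)" using b c(1) by (simp add: R_def)
    also have "\<dots> \<le> b * (c * norm U)" using False b c(1) by simp
    also have "\<dots> \<le> f U" by (rule lower)
    finally show ?thesis .
  qed (use T(2)[of U] in simp)
  \<comment> \<open>The derivative of f at its minimum T in direction V is 2 Re <w, V>. Taking for V
    the conjugate of w yields w = 0.\<close>
  define w where "w = (\<Sum>i\<in>UNIV. ((norm (z $ i))\<^sup>2 * exp (2 * Re (bilin (\<Lambda> i) T))) *\<^sub>R \<Lambda> i)"
  have Rw: "Re (bilin w V) = 0" for V
  proof -
    define h where "h s = (\<Sum>i\<in>UNIV. (norm (z $ i))\<^sup>2 * exp (2 * (Re (bilin (\<Lambda> i) T) + s * Re (bilin (\<Lambda> i) V))))" for s :: real
    have h: "h s = f (T + s *\<^sub>R V)" for s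
      by (simp add: h_def f_def bilin_add bilin_scaleR)
    let ?d = "\<Sum>i\<in>UNIV. (norm (z $ i))\<^sup>2 * (exp (2 * Re (bilin (\<Lambda> i) T)) * (2 * Re (bilin (\<Lambda> i) V)))"
    have "(h has_real_derivative ?d) (at 0)"
      unfolding h_def by (auto intro!: derivative_eq_intros sum.cong)
    then have "?d = 0"
      by (rule DERIV_local_min[of _ _ _ 1]) (auto simp: h glob)
    moreover have "?d = 2 * Re (bilin w V)"
      unfolding w_def bilin_sum_left Re_sum sum_distrib_left
      by (intro sum.cong refl) (simp add: bilin_scaleR_left)
    ultimately show ?thesis by simp
  qed
  have "inner w w = Re (bilin w (\<chi> j. cnj (w $ j)))" by (simp add: Re_bilin)
  then have w0: "w = 0" using Rw by simp
  define \<sigma> :: "complex^('m option)" where "\<sigma> = (\<chi> k. case k of None \<Rightarrow> 0 | Some j \<Rightarrow> T $ j)"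
  define y where "y = g \<sigma> z"
  have wtT: "wt \<Lambda> i \<sigma> = bilin (\<Lambda> i) T" for i by (simp add: wt_eq \<sigma>_def)
  have "(norm (y $ i))\<^sup>2 = (norm (z $ i))\<^sup>2 * exp (2 * Re (bilin (\<Lambda> i) T))" for i
    by (simp add: y_def wtT norm_mult power_mult_distrib flip: exp_double)
  then have yw: "(\<Sum>i\<in>UNIV. (norm (y $ i))\<^sup>2 *\<^sub>R \<Lambda> i) = 0" using w0 by (simp add: w_def)
  have "y \<in> S" using z by (simp add: y_def)
  then have ny: "norm y > 0" using stab_nonzero by fastforce
  \<comment> \<open>The component \<open>None\<close> rescales to norm 1; this multiplies the
    vanishing sum by a positive factor and so keeps it zero.\<close>
  define \<rho> :: "complex^('m option)" where "\<rho> = axis None (of_real (- ln (norm y)))"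
  have wr: "wt \<Lambda> i \<rho> = of_real (- ln (norm y))" for i
    by (simp add: wt_eq \<rho>_def axis_def bilin_def)
  have "exp (of_real (- ln (norm y))) = complex_of_real (inverse (norm y))"
    using ny by (simp only: exp_of_real exp_minus exp_ln)
  then have r: "g \<rho> y = y /\<^sub>R norm y"
    unfolding vec_eq_iff gact_nth vector_scaleR_component wr by (simp add: scaleR_conv_of_real)
  have "g (\<rho> + \<sigma>) z \<in> moment_set"
  proof -
    have "(\<Sum>i\<in>UNIV. (norm ((y /\<^sub>R norm y) $ i))\<^sup>2 *\<^sub>R \<Lambda> i) =
        (inverse (norm y))\<^sup>2 *\<^sub>R (\<Sum>i\<in>UNIV. (norm (y $ i))\<^sup>2 *\<^sub>R \<Lambda> i)"
      by (simp add: scaleR_sum_right power_mult_distrib norm_mult)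
    then have "y /\<^sub>R norm y \<in> moment_set" using yw ny by (simp add: moment_set_def)
    then show ?thesis unfolding gact_gact[symmetric] y_def[symmetric] r .
  qed
  then show ?thesis using that by blast
qed

proposition invariant_holo_constant:
  assumes F: "\<And>z. z \<in> S \<Longrightarrow> holo F z" and inv: "\<And>z \<tau>. z \<in> S \<Longrightarrow> F (g \<tau> z) = F z"
    and z: "z \<in> S" and w: "w \<in> S"
  shows "F z = F w"
proof -
  have ne: "moment_set \<noteq> {}" using orbit_meets_moment_set[OF z] by blast
  have "continuous_on moment_set (\<lambda>z. norm (F z))"
    by (intro continuous_on_norm continuous_at_imp_continuous_on ballI holo_isCont F)
      (use moment_set_subset in blast)
  then obtain x where x: "x \<in> moment_set" "\<And>y. y \<in> moment_set \<Longrightarrow> norm (F y) \<le> norm (F x)"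
    using continuous_attains_sup[OF compact_moment_set ne] by blast
  have xS: "x \<in> S" using x(1) moment_set_subset by blast
  have max: "norm (F y) \<le> norm (F x)" if y: "y \<in> S" for y
  proof -
    obtain \<tau> where "g \<tau> y \<in> moment_set" using orbit_meets_moment_set[OF y] .
    then show ?thesis using x(2) inv[OF y] by metis
  qed
  have "F y = F x" if y: "y \<in> S" for y
  proof -
    define l where "l \<zeta> = x + \<zeta> *s (y - x)" for \<zeta>
    \<comment> \<open>For parameters outside Z the support of the point on the line contains that of
      x, so the point is stable. Z is finite; X puts 0 and 1 back, where the line passes through x
      and y themselves, and remains open and connected.\<close>
    define Z where "Z = (\<Union>i\<in>{i. x $ i \<noteq> 0 \<or> y $ i \<noteq> 0}. {\<zeta>. l \<zeta> $ i = 0})"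
    have finZ: "finite Z" unfolding Z_def
    proof (rule finite_UN_I)
      fix i assume i: "i \<in> {i. x $ i \<noteq> 0 \<or> y $ i \<noteq> 0}"
      have "{\<zeta>. l \<zeta> $ i = 0} \<subseteq> {- x $ i / (y $ i - x $ i)}"
      proof
        fix \<zeta> assume "\<zeta> \<in> {\<zeta>. l \<zeta> $ i = 0}"
        then have e: "\<zeta> * (y $ i - x $ i) = - x $ i" by (simp add: l_def algebra_simps eq_neg_iff_add_eq_0)
        then have "y $ i - x $ i \<noteq> 0" using i by auto
        then have "\<zeta> = - x $ i / (y $ i - x $ i)" using e by (rule nonzero_eq_divide_eq[THEN iffD2])
        then show "\<zeta> \<in> {- x $ i / (y $ i - x $ i)}" by simp
      qed
      then show "finite {\<zeta>. l \<zeta> $ i = 0}" by (rule finite_subset) simp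
    qed simp
    define X where "X = UNIV - (Z - {0, 1})"
    have conn: "connected X" unfolding X_def
      by (rule connected_open_delete_finite) (use finZ in auto)
    have opn: "open X" unfolding X_def using finZ by (intro open_Diff finite_imp_closed) auto
    have l01: "l 0 = x" "l 1 = y" by (simp_all add: l_def)
    have XS: "l \<zeta> \<in> S" if "\<zeta> \<in> X" for \<zeta>
    proof (cases "\<zeta> \<in> {0,1}")
      case False
      then have "l \<zeta> $ i \<noteq> 0" if "x $ i \<noteq> 0" for i using \<open>\<zeta> \<in> X\<close> that by (auto simp: X_def Z_def)
      then show ?thesis using stab_mono[OF xS] by blast
    qed (use l01 xS y in auto)
    have "(\<lambda>\<zeta>. F (l \<zeta>)) holomorphic_on X"
      unfolding holomorphic_on_def field_differentiable_def
    proof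
      fix \<zeta> assume "\<zeta> \<in> X"
      then have "holo F (x + \<zeta> *s (y - x))" using XS F l_def by metis
      from has_field_derivative_at_within[OF field_derivative_along_line[OF this]]
      show "\<exists>f'. ((\<lambda>\<zeta>. F (l \<zeta>)) has_field_derivative f') (at \<zeta> within X)"
        unfolding l_def by blast
    qed
    then have "(\<lambda>\<zeta>. F (l \<zeta>)) constant_on X"
      by (rule maximum_modulus_principle[of _ X X 0])
        (use opn conn XS max l01 in \<open>auto simp: X_def\<close>)
    moreover have "0 \<in> X" "1 \<in> X" by (auto simp: X_def)
    ultimately have "F (l 0) = F (l 1)" unfolding constant_on_def by metis
    then show ?thesis using l01 by simp
  qed
  then show ?thesis using z w by metis
qed

end

section \<open>Slice charts\<close>

text \<open>The velocity at z of the orbit in direction \<tau>, see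
  \<open>complex_derivative_orbit\<close>.\<close>

definition tang :: "('n::finite \<Rightarrow> complex^'m::finite) \<Rightarrow> complex^('m option) \<Rightarrow> complex^'n \<Rightarrow> complex^'n"
  where "tang \<Lambda> \<tau> z = (\<chi> i. wt \<Lambda> i \<tau> * z $ i)"

lemma vholo_gact: "vholo (gact \<Lambda> \<tau>) z"
  unfolding vholo_iff gact_nth by (intro allI holo_mult holo_const holo_nth)

context lvm
begin

text \<open>By \<open>wt_eq_zero_imp\<close> the vectors \<open>aug \<Lambda> i\<close> over the
  support of \<open>z0\<close> span, so m + 1 of them form a basis. N inverts the map from a group
  element to its weights at \<kappa>, and so produces the element with prescribed weights
  there.\<close>

lemma slice_labels:
  assumes z0: "z0 \<in> S"
  obtains \<kappa> :: "'m option \<Rightarrow> 'n" and N :: "complex^('m option)^('m option)"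
  where "inj \<kappa>" "\<And>k. z0 $ \<kappa> k \<noteq> 0"
    "\<And>\<tau>. N *v (\<chi> k. wt \<Lambda> (\<kappa> k) \<tau>) = \<tau>" "\<And>x k. wt \<Lambda> (\<kappa> k) (N *v x) = x $ k"
proof -
  let ?J = "{i. z0 $ i \<noteq> 0}"
  \<comment> \<open>Rows outside the support are set to 0, so that the matrix can be indexed by all
    labels without enlarging the row space.\<close>
  define A :: "complex^('m option)^'n" where "A = (\<chi> i. if z0 $ i \<noteq> 0 then aug \<Lambda> i else 0)"
  have mv: "(M *v \<tau>) $ i = bilin (M $ i) \<tau>" for M :: "complex^('m option)^'k" and \<tau> i
    by (simp add: matrix_vector_mult_def bilin_def)
  have "\<forall>\<tau>. A *v \<tau> = 0 \<longrightarrow> \<tau> = 0"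
  proof (intro allI impI)
    fix \<tau> assume a: "A *v \<tau> = 0"
    have "wt \<Lambda> i \<tau> = 0" if "z0 $ i \<noteq> 0" for i
    proof -
      have "(A *v \<tau>) $ i = 0" unfolding a by simp
      then show ?thesis using that unfolding mv by (simp add: A_def wt_def)
    qed
    then show "\<tau> = 0" by (rule wt_eq_zero_imp[OF z0])
  qed
  then have "vec.span (rows A) = UNIV"
    unfolding matrix_left_invertible_ker[symmetric] matrix_left_invertible_span_rows_gen .
  moreover have "rows A \<subseteq> insert 0 (aug \<Lambda> ` ?J)"
    by (auto simp: rows_def row_def A_def)
  then have "vec.span (rows A) \<subseteq> vec.span (aug \<Lambda> ` ?J)"
    using vec.span_mono vec.span_insert_0 by blast
  ultimately have sp: "vec.span (aug \<Lambda> ` ?J) = UNIV" by blast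
  obtain b where b: "b \<subseteq> aug \<Lambda> ` ?J" "vec.independent b" "aug \<Lambda> ` ?J \<subseteq> vec.span b"
    using vec.maximal_independent_subset by metis
  have sb: "vec.span b = UNIV"
    using sp b(3) vec.span_minimal[OF b(3) vec.subspace_span] by blast
  have "card b = CARD('m option)"
    using vec.dim_span_eq_card_independent[OF b(2)] sb by (simp add: card_cart_basis vec_dim_card)
  then obtain f where f: "bij_betw f (UNIV :: 'm option set) b"
    using finite_same_card_bij[of "UNIV :: 'm option set" b] vec.finiteI_independent[OF b(2)] by auto
  have "\<forall>k. \<exists>i. i \<in> ?J \<and> aug \<Lambda> i = f k"
  proof
    fix k
    have "f k \<in> aug \<Lambda> ` ?J" using b(1) bij_betwE[OF f] by blast
    then show "\<exists>i. i \<in> ?J \<and> aug \<Lambda> i = f k" by (metis imageE)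
  qed
  then obtain \<kappa> where \<kappa>: "\<And>k. \<kappa> k \<in> ?J" "\<And>k. aug \<Lambda> (\<kappa> k) = f k" by metis
  define M :: "complex^('m option)^('m option)" where "M = (\<chi> k. f k)"
  have M: "M *v \<tau> = (\<chi> k. wt \<Lambda> (\<kappa> k) \<tau>)" for \<tau>
    unfolding vec_eq_iff mv by (simp add: M_def wt_def \<kappa>(2))
  have "\<forall>\<tau>. M *v \<tau> = 0 \<longrightarrow> \<tau> = 0"
  proof (intro allI impI)
    fix \<tau> assume "M *v \<tau> = 0"
    then have z: "bilin (f k) \<tau> = 0" for k by (simp add: M vec_eq_iff wt_def \<kappa>(2))
    have "bilin x \<tau> = 0" if "x \<in> vec.span b" for x
      using that
    proof (induction rule: vec.span_induct)
      case base
      show ?case unfolding vec.subspace_def by (auto simp: bilin_add_left bilin_scale_left)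
    next
      case (step x)
      then show ?case using z f by (auto simp: bij_betw_def)
    qed
    then have "wt \<Lambda> i \<tau> = 0" for i using sb by (simp add: wt_def)
    then show "\<tau> = 0" by (intro wt_eq_zero_imp[OF z0])
  qed
  then obtain N where N: "N ** M = mat 1" unfolding matrix_left_invertible_ker[symmetric] by blast
  then have N': "M ** N = mat 1" by (simp add: matrix_left_right_inverse)
  show ?thesis
  proof (rule that)
    show "inj \<kappa>" using f \<kappa>(2) unfolding inj_def bij_betw_def by metis
    show "z0 $ \<kappa> k \<noteq> 0" for k using \<kappa>(1) by simp
    show "N *v (\<chi> k. wt \<Lambda> (\<kappa> k) \<tau>) = \<tau>" for \<tau>
      unfolding M[symmetric] matrix_vector_mul_assoc N by simp
    show "wt \<Lambda> (\<kappa> k) (N *v x) = x $ k" for x k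
    proof -
      have "M *v (N *v x) = x" unfolding matrix_vector_mul_assoc N' by simp
      then show ?thesis unfolding M by (simp add: vec_eq_iff)
    qed
  qed
qed

end

text \<open>As the weights at \<kappa> can be prescribed, the group can move these coordinates of a
  nearby point to those of \<open>z0\<close>. The slice is the affine space where they agree with
  \<open>z0\<close>; the remaining coordinates, listed by \<beta>, parametrise it.\<close>

locale lvm_slice = lvm \<Lambda>
  for \<Lambda> :: "'n::finite \<Rightarrow> complex ^ 'm::finite" +
  fixes z0 :: "complex^'n" and \<kappa> :: "'m option \<Rightarrow> 'n" and N :: "complex^('m option)^('m option)"
    and \<beta> :: "'v::finite \<Rightarrow> 'n"
  assumes z0: "z0 \<in> stab \<Lambda>" and \<kappa>: "inj \<kappa>" "\<And>k. z0 $ \<kappa> k \<noteq> 0"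
    and N: "\<And>\<tau>. N *v (\<chi> k. wt \<Lambda> (\<kappa> k) \<tau>) = \<tau>" "\<And>x k. wt \<Lambda> (\<kappa> k) (N *v x) = x $ k"
    and \<beta>: "bij_betw \<beta> UNIV (- range \<kappa>)"
begin

definition \<sigma>' :: "complex^'v \<Rightarrow> complex^'n"
  where "\<sigma>' u = (\<chi> i. if i \<in> range \<kappa> then 0 else u $ inv \<beta> i)"

definition \<sigma> :: "complex^'v \<Rightarrow> complex^'n"
  where "\<sigma> u = (\<chi> i. if i \<in> range \<kappa> then z0 $ i else u $ inv \<beta> i)"

definition coord :: "complex^'n \<Rightarrow> complex^'v"
  where "coord z = (\<chi> v. z $ \<beta> v)"

text \<open>For \<open>z\<close> close to the slice, \<open>retr z\<close> is the point of the slice in the same orbit.\<close>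

definition retr :: "complex^'n \<Rightarrow> complex^'n"
  where "retr z = g (N *v (\<chi> k. Ln (z0 $ \<kappa> k / z $ \<kappa> k))) z"

definition u0 :: "complex^'v" where "u0 = coord z0"

lemma \<beta>_inv [simp]: "inv \<beta> (\<beta> v) = v" "\<beta> v \<noteq> \<kappa> k" "\<kappa> k \<noteq> \<beta> v"
  using \<beta> by (auto simp: bij_betw_def)

lemma \<beta>_surj: "i \<notin> range \<kappa> \<Longrightarrow> \<beta> (inv \<beta> i) = i"
  using \<beta> by (auto simp: bij_betw_def f_inv_into_f)

lemma \<sigma>_nth [simp]: "\<sigma> u $ \<kappa> k = z0 $ \<kappa> k" "\<sigma> u $ \<beta> v = u $ v"
  by (auto simp: \<sigma>_def)

lemma coord_\<sigma> [simp]: "coord (\<sigma> u) = u"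
  by (simp add: coord_def vec_eq_iff)

lemma \<sigma>_coord: "(\<And>k. z $ \<kappa> k = z0 $ \<kappa> k) \<Longrightarrow> \<sigma> (coord z) = z"
  unfolding vec_eq_iff by (auto simp: \<sigma>_def coord_def \<beta>_surj)

lemma \<sigma>_u0 [simp]: "\<sigma> u0 = z0"
  unfolding u0_def by (rule \<sigma>_coord) simp

lemma complex_derivative_\<sigma>: "vderiv \<sigma> \<sigma>' u"
  unfolding complex_derivative_def
proof (intro conjI allI)
  show "\<sigma>' (c *s v) = c *s \<sigma>' v" for c v by (simp add: \<sigma>'_def vec_eq_iff)
  have "linear \<sigma>'" by (rule linearI) (simp_all add: \<sigma>'_def vec_eq_iff)
  then have "(\<sigma>' has_derivative \<sigma>') (at u)"
    by (simp add: bounded_linear_imp_has_derivative linear_conv_bounded_linear)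
  then have "((\<lambda>u. \<sigma> 0 + \<sigma>' u) has_derivative \<sigma>') (at u)" by (auto intro!: derivative_eq_intros)
  moreover have "\<sigma> = (\<lambda>u. \<sigma> 0 + \<sigma>' u)" by (auto simp: \<sigma>_def \<sigma>'_def vec_eq_iff)
  ultimately show "(\<sigma> has_derivative \<sigma>') (at u)" by simp
qed

lemma vholo_\<sigma>: "vholo \<sigma> u"
  unfolding vholo_def using complex_derivative_\<sigma> by blast

lemma retr_\<sigma> [simp]: "retr (\<sigma> u) = \<sigma> u"
proof -
  have "(\<chi> k. Ln (z0 $ \<kappa> k / \<sigma> u $ \<kappa> k)) = 0" using \<kappa>(2) by (simp add: vec_eq_iff)
  then show ?thesis unfolding retr_def by simp
qed

lemma q_retr [simp]: "q (retr z) = q z"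
  by (simp add: retr_def)

text \<open>Here the principal logarithms in \<open>retr\<close> are holomorphic. Since
  \<open>x / 0 = 0\<close> is a nonpositive real, a vanishing coordinate at \<kappa> is excluded as
  well.\<close>

definition near :: "(complex^'n) set"
  where "near = {z. \<forall>k. z0 $ \<kappa> k / z $ \<kappa> k \<notin> \<real>\<^sub>\<le>\<^sub>0}"

lemma near_nonzero: "z \<in> near \<Longrightarrow> z $ \<kappa> k \<noteq> 0"
  unfolding near_def by (auto dest!: spec[of _ k])

lemma \<sigma>_near: "\<sigma> u \<in> near"
  using \<kappa>(2) by (simp add: near_def)

lemma retr_near: "z \<in> near \<Longrightarrow> \<sigma> (coord (retr z)) = retr z"
  by (rule \<sigma>_coord) (use near_nonzero \<kappa>(2) in \<open>simp add: retr_def N(2)\<close>)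

lemma vholo_retr: assumes "z \<in> near" shows "vholo retr z"
proof -
  have c: "holo (\<lambda>z. Ln (z0 $ \<kappa> k / z $ \<kappa> k)) z" for k
    using assms near_nonzero[OF assms, of k]
    by (intro holo_Ln holo_divide holo_const holo_nth) (auto simp: near_def)
  have "holo (\<lambda>z. wt \<Lambda> i (N *v (\<chi> k. Ln (z0 $ \<kappa> k / z $ \<kappa> k)))) z" for i
    unfolding wt_def bilin_def matrix_vector_mult_def vec_lambda_beta
    by (intro holo_sum holo_mult holo_const c)
  then show ?thesis
    unfolding vholo_iff retr_def gact_nth by (intro allI holo_mult holo_exp holo_nth)
qed

lemma vholo_coord_retr: "z \<in> near \<Longrightarrow> vholo (\<lambda>z. coord (retr z)) z"
  using vholo_retr unfolding vholo_iff coord_def by simp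

lemma open_near: "open near"
proof -
  have "open {z::complex^'n. z $ \<kappa> k \<noteq> 0 \<and> z0 $ \<kappa> k / z $ \<kappa> k \<notin> \<real>\<^sub>\<le>\<^sub>0}" for k
  proof -
    have o: "open {z::complex^'n. z $ \<kappa> k \<noteq> 0}"
      by (intro open_Collect_neq bounded_linear.continuous_on[OF bounded_linear_vec_nth]
            continuous_on_id continuous_on_const)
    have "continuous_on {z::complex^'n. z $ \<kappa> k \<noteq> 0} (\<lambda>z. z0 $ \<kappa> k / z $ \<kappa> k)"
      by (intro continuous_on_divide bounded_linear.continuous_on[OF bounded_linear_vec_nth]
            continuous_on_id continuous_on_const) simp
    from continuous_open_preimage[OF this o, of "- \<real>\<^sub>\<le>\<^sub>0"]
    show ?thesis by (simp add: vimage_def Int_def open_Compl)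
  qed
  then have "open (\<Inter>k. {z::complex^'n. z $ \<kappa> k \<noteq> 0 \<and> z0 $ \<kappa> k / z $ \<kappa> k \<notin> \<real>\<^sub>\<le>\<^sub>0})"
    by (intro open_INT) auto
  moreover have "(\<Inter>k. {z::complex^'n. z $ \<kappa> k \<noteq> 0 \<and> z0 $ \<kappa> k / z $ \<kappa> k \<notin> \<real>\<^sub>\<le>\<^sub>0}) = near"
    using near_nonzero by (auto simp: near_def)
  ultimately show ?thesis by simp
qed

text \<open>Slices are transverse to orbits: \<tau> is chosen so that the orbit velocity matches w
  at \<kappa>, and what remains is tangent to the slice.\<close>

lemma tangent_decomposition:
  obtains \<tau> v where "w = tang \<Lambda> \<tau> (\<sigma> u) + \<sigma>' v"
proof -
  define \<tau> where "\<tau> = N *v (\<chi> k. w $ \<kappa> k / z0 $ \<kappa> k)"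
  let ?x = "w - tang \<Lambda> \<tau> (\<sigma> u)"
  have "?x $ \<kappa> k = 0" for k using \<kappa>(2) by (simp add: tang_def \<tau>_def N(2))
  then have "?x = \<sigma>' (coord ?x)"
    unfolding vec_eq_iff by (auto simp: \<sigma>'_def coord_def \<beta>_surj simp del: vector_minus_component)
  then have "w = tang \<Lambda> \<tau> (\<sigma> u) + \<sigma>' (coord ?x)" by (metis add_diff_cancel_left' diff_add_cancel add.commute)
  then show ?thesis using that by blast
qed

text \<open>Two points of a small slice which lie in the same orbit are related by a group element
  \<open>\<tau>\<close> for which the \<open>|exp (wt i \<tau>)|\<close> with \<open>i\<close> in the support of \<open>z0\<close> are all close to 1. As the
  real parts of these weights determine \<open>Re \<tau>\<^sub>0\<close> and all \<open>\<tau>\<^sub>j\<close>, the latter are small, and the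
  lattice \<open>2\<pi>\<i>\<int>\<close> leaves no choice but \<open>\<tau>\<^sub>j = 0\<close>.\<close>

lemma same_orbit_small:
  obtains e where "e > 0" "\<And>\<tau> z. \<forall>i. z0 $ i \<noteq> 0 \<longrightarrow> \<bar>Re (wt \<Lambda> i \<tau>)\<bar> < e \<Longrightarrow>
    \<forall>k. exp (wt \<Lambda> (\<kappa> k) \<tau>) = 1 \<Longrightarrow> g \<tau> z = z"
proof -
  define R :: "real \<times> (complex^'m) \<Rightarrow> real^'n"
    where "R x = (\<chi> i. if z0 $ i \<noteq> 0 then fst x + Re (bilin (\<Lambda> i) (snd x)) else 0)" for x
  have "linear R"
    by (rule linearI) (auto simp: R_def vec_eq_iff bilin_add bilin_scaleR algebra_simps)
  moreover have "inj R"
  proof -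
    have "x = 0" if "R x = 0" for x
    proof -
      define \<tau> :: "complex^('m option)"
        where "\<tau> = (\<chi> k. case k of None \<Rightarrow> of_real (fst x) | Some j \<Rightarrow> snd x $ j)"
      have "Re (wt \<Lambda> i \<tau>) = 0" if "z0 $ i \<noteq> 0" for i
      proof -
        have "R x $ i = 0" using \<open>R x = 0\<close> by simp
        then show ?thesis using that by (simp add: R_def wt_eq \<tau>_def)
      qed
      from Re_wt_eq_zero_imp[OF z0 this] have "fst x = 0" "snd x $ j = 0" for j
        by (simp_all add: \<tau>_def)
      then show ?thesis by (simp add: prod_eq_iff vec_eq_iff)
    qed
    then show ?thesis using \<open>linear R\<close> linear_injective_0 by blast
  qed
  ultimately obtain b where b: "b > 0" "\<And>x. b * norm x \<le> norm (R x)"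
    using linear_inj_bounded_below_pos by blast
  \<comment> \<open>Differences with the weight at \<open>\<kappa> None\<close> cancel
    \<open>\<tau> $ None\<close>, whose imaginary part is not controlled by R.\<close>
  define K where "K = (\<lambda>k. \<Lambda> (\<kappa> k) - \<Lambda> (\<kappa> None))"
  have "\<exists>r>0. \<forall>T. norm T < r \<longrightarrow> norm (bilin (K k) T) < 2 * pi" for k
  proof -
    have "isCont (bilin (K k)) 0" using continuous_bilin[of UNIV "K k"] by (simp add: continuous_on_eq_continuous_at)
    then have "\<exists>r>0. \<forall>T. dist T 0 < r \<longrightarrow> dist (bilin (K k) T) (bilin (K k) 0) < 2 * pi"
      unfolding continuous_at_eps_delta using pi_gt_zero by auto
    then show ?thesis by simp
  qed
  then obtain r where r: "\<And>k. r k > 0" "\<And>k T. norm T < r k \<Longrightarrow> norm (bilin (K k) T) < 2 * pi"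
    by metis
  define r0 where "r0 = Min (range r)"
  have r0: "r0 > 0" "\<And>k. r0 \<le> r k" using r(1) by (simp_all add: r0_def)
  \<comment> \<open>The norm is at most the sum of the absolute entries, hence the factor
    \<open>CARD('n)\<close>; dividing by b turns the bound for R into norm less than
    \<open>r0\<close>.\<close>
  define e where "e = b * r0 / real CARD('n)"
  have e: "e > 0" using b(1) r0(1) by (simp add: e_def)
  show ?thesis
  proof (rule that[OF e])
    fix \<tau> :: "complex^('m option)" and z
    assume small: "\<forall>i. z0 $ i \<noteq> 0 \<longrightarrow> \<bar>Re (wt \<Lambda> i \<tau>)\<bar> < e"
      and "\<forall>k. exp (wt \<Lambda> (\<kappa> k) \<tau>) = 1"
    then have one: "exp (wt \<Lambda> (\<kappa> k) \<tau>) = 1" for k by blast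
    define T where "T = (\<chi> j. \<tau> $ Some j)"
    let ?x = "(Re (\<tau> $ None), T)"
    have Rx: "\<bar>R ?x $ i\<bar> < e" for i
      using small e by (simp add: R_def wt_eq T_def)
    have "norm (R ?x) \<le> (\<Sum>i\<in>UNIV. \<bar>R ?x $ i\<bar>)" by (rule norm_le_l1_cart)
    also have "\<dots> < (\<Sum>i\<in>(UNIV::'n set). e)" by (rule sum_strict_mono) (use Rx in auto)
    also have "\<dots> = b * r0" by (simp add: e_def)
    finally have "b * norm ?x < b * r0" using b(2)[of ?x] by linarith
    then have "norm ?x < r0" using b(1) by simp
    moreover have "norm T \<le> norm ?x" by (simp add: norm_Pair real_le_rsqrt)
    ultimately have nT: "norm T < r k" for k using r0(2)[of k] by linarith
    have eq: "wt \<Lambda> (\<kappa> k) \<tau> = wt \<Lambda> (\<kappa> None) \<tau>" for k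
    proof -
      let ?d = "wt \<Lambda> (\<kappa> k) \<tau> - wt \<Lambda> (\<kappa> None) \<tau>"
      have d: "?d = bilin (K k) T" by (simp add: wt_eq K_def bilin_diff_left T_def)
      have "exp ?d = 1" by (simp add: exp_diff one)
      then obtain n :: int where n: "Re ?d = 0" "Im ?d = of_int (2 * n) * pi"
        unfolding exp_eq_1 by blast
      have "norm ?d < 2 * pi" unfolding d using r(2) nT by blast
      then have "\<bar>Im ?d\<bar> < 2 * pi" using abs_Im_le_cmod[of ?d] by linarith
      then have "\<bar>real_of_int n\<bar> < 1" using n(2) by (simp add: abs_mult)
      then have "n = 0" by linarith
      then have "?d = 0" using n by (simp add: complex_eq_iff)
      then show ?thesis by simp
    qed
    \<comment> \<open>All weights at \<kappa> equal s, and N recovers \<tau> from them; so \<tau> is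
      a scaling by exp s = 1. It acts trivially but may itself be a nonzero multiple of 2\<pi>\<i>
      in the component \<open>None\<close>.\<close>
    define s where "s = wt \<Lambda> (\<kappa> None) \<tau>"
    have "\<tau> = N *v (\<chi> k. wt \<Lambda> (\<kappa> k) \<tau>)" using N(1) by simp
    also have "(\<chi> k. wt \<Lambda> (\<kappa> k) \<tau>) = (\<chi> k. wt \<Lambda> (\<kappa> k) (axis None s))"
      using eq by (simp add: vec_eq_iff s_def) (simp add: wt_eq axis_def bilin_def)
    also have "N *v \<dots> = axis None s" by (rule N(1))
    finally have \<tau>: "\<tau> = axis None s" .
    have "exp (wt \<Lambda> i \<tau>) = 1" for i
    proof -
      have "wt \<Lambda> i \<tau> = s" unfolding \<tau> by (simp add: wt_eq axis_def bilin_def)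
      then show ?thesis using one[of None] s_def by simp
    qed
    then show "g \<tau> z = z" by (simp add: vec_eq_iff)
  qed
qed

text \<open>Near \<open>u0\<close> the moduli of the coordinates in the support of \<open>z0\<close>
  vary little, so an element relating two points of the slice has small real weights there, however
  large it is. Equality of the coordinates at \<kappa> makes the exponentials 1, and
  \<open>same_orbit_small\<close> applies.\<close>

lemma slice_neighbourhood:
  obtains r where "r > 0" "\<And>u. u \<in> ball u0 r \<Longrightarrow> \<sigma> u \<in> S" "inj_on (\<lambda>u. q (\<sigma> u)) (ball u0 r)"
proof -
  obtain e where e: "e > 0" "\<And>\<tau> z. \<forall>i. z0 $ i \<noteq> 0 \<longrightarrow> \<bar>Re (wt \<Lambda> i \<tau>)\<bar> < e \<Longrightarrow>
    \<forall>k. exp (wt \<Lambda> (\<kappa> k) \<tau>) = 1 \<Longrightarrow> g \<tau> z = z"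
    by (rule same_orbit_small, rule that)
  have c\<sigma>: "isCont (\<lambda>u. \<sigma> u $ i) u0" for i
    using vholo_isCont[OF vholo_\<sigma>] by (rule isCont_vec_nth)
  have ev: "eventually (\<lambda>u. z0 $ i \<noteq> 0 \<longrightarrow> \<sigma> u $ i \<noteq> 0 \<and> \<bar>ln (norm (\<sigma> u $ i)) - ln (norm (z0 $ i))\<bar> < e / 2) (nhds u0)" for i
  proof (cases "z0 $ i = 0")
    case False
    have t: "((\<lambda>u. \<sigma> u $ i) \<longlongrightarrow> z0 $ i) (nhds u0)"
      using c\<sigma>[of i] by (simp add: continuous_at tendsto_nhds_iff)
    have "eventually (\<lambda>u. \<sigma> u $ i \<noteq> 0) (nhds u0)"
      using tendsto_imp_eventually_ne[OF t False] .
    moreover have "((\<lambda>u. ln (norm (\<sigma> u $ i))) \<longlongrightarrow> ln (norm (z0 $ i))) (nhds u0)"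
      using False by (intro tendsto_ln tendsto_norm t) simp
    then have "eventually (\<lambda>u. dist (ln (norm (\<sigma> u $ i))) (ln (norm (z0 $ i))) < e / 2) (nhds u0)"
      using e(1) by (intro tendstoD) auto
    ultimately show ?thesis by eventually_elim (simp add: dist_real_def)
  qed simp
  have "eventually (\<lambda>u. \<forall>i. z0 $ i \<noteq> 0 \<longrightarrow> \<sigma> u $ i \<noteq> 0 \<and> \<bar>ln (norm (\<sigma> u $ i)) - ln (norm (z0 $ i))\<bar> < e / 2) (nhds u0)"
    by (rule eventually_all_finite) (rule ev)
  then obtain r where r: "r > 0" "\<And>u i. u \<in> ball u0 r \<Longrightarrow> z0 $ i \<noteq> 0 \<Longrightarrow> \<sigma> u $ i \<noteq> 0"
    "\<And>u i. u \<in> ball u0 r \<Longrightarrow> z0 $ i \<noteq> 0 \<Longrightarrow> \<bar>ln (norm (\<sigma> u $ i)) - ln (norm (z0 $ i))\<bar> < e / 2"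
    unfolding eventually_nhds_metric by (auto simp: dist_commute)
  show ?thesis
  proof (rule that[OF r(1)])
    show "\<sigma> u \<in> S" if "u \<in> ball u0 r" for u
      using stab_mono[OF z0] r(2)[OF that] by blast
    show "inj_on (\<lambda>u. q (\<sigma> u)) (ball u0 r)"
    proof (rule inj_onI)
      fix u v assume u: "u \<in> ball u0 r" and v: "v \<in> ball u0 r" and "q (\<sigma> u) = q (\<sigma> v)"
      then obtain \<tau> where \<tau>: "\<sigma> v = g \<tau> (\<sigma> u)" unfolding lproj_eq_iff by blast
      have "g \<tau> (\<sigma> u) = \<sigma> u"
      proof (rule e(2); intro allI impI)
        fix i assume i: "z0 $ i \<noteq> 0"
        have n: "norm (\<sigma> v $ i) = exp (Re (wt \<Lambda> i \<tau>)) * norm (\<sigma> u $ i)"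
          unfolding \<tau> by (simp add: norm_mult)
        have "ln (norm (\<sigma> v $ i)) = Re (wt \<Lambda> i \<tau>) + ln (norm (\<sigma> u $ i))"
          unfolding n using r(2)[OF u i] by (simp add: ln_mult)
        then show "\<bar>Re (wt \<Lambda> i \<tau>)\<bar> < e" using r(3)[OF u i] r(3)[OF v i] by linarith
      next
        fix k
        have "\<sigma> v $ \<kappa> k = exp (wt \<Lambda> (\<kappa> k) \<tau>) * \<sigma> u $ \<kappa> k" unfolding \<tau> by simp
        then show "exp (wt \<Lambda> (\<kappa> k) \<tau>) = 1" using \<kappa>(2)[of k] by simp
      qed
      then have "\<sigma> v = \<sigma> u" using \<tau> by simp
      then show "u = v" by (metis coord_\<sigma>)
    qed
  qed
qed

text \<open>The chart inverts u \<mapsto> \<open>q (\<sigma> u)\<close> on a small ball. Near a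
  point \<open>g \<tau> (\<sigma> u)\<close> of the preimage Y it is given by the explicit
  holomorphic map w \<mapsto> \<open>coord (retr (g (- \<tau>) w))\<close>; openness of Y,
  continuity and holomorphy all follow from this formula.\<close>

proposition slice_chart:
  obtains U and \<phi> :: "'n ppoint set \<Rightarrow> complex^'v"
  where "(U, \<phi>) \<in> lvm_atlas \<Lambda>" "q z0 \<in> U" "\<phi> (q z0) = u0"
    "\<And>u. u \<in> \<phi> ` U \<Longrightarrow> \<sigma> u \<in> S \<and> q (\<sigma> u) \<in> U \<and> \<phi> (q (\<sigma> u)) = u"
proof -
  obtain r where r: "r > 0" "\<And>u. u \<in> ball u0 r \<Longrightarrow> \<sigma> u \<in> S" "inj_on (\<lambda>u. q (\<sigma> u)) (ball u0 r)"
    by (rule slice_neighbourhood, rule that)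
  define X where "X = ball u0 r"
  define U where "U = (\<lambda>u. q (\<sigma> u)) ` X"
  define \<phi> where "\<phi> = inv_into X (\<lambda>u. q (\<sigma> u))"
  have oX: "open X" by (simp add: X_def)
  have XS: "\<sigma> u \<in> S" if "u \<in> X" for u using r(2) that X_def by blast
  have \<phi>q: "\<phi> (q (\<sigma> u)) = u" if "u \<in> X" for u
    unfolding \<phi>_def using r(3) that X_def by (intro inv_into_f_f[of "\<lambda>u. q (\<sigma> u)"]) auto
  have \<phi>U: "\<phi> ` U = X" unfolding U_def image_image using \<phi>q by simp
  define Y where "Y = {z \<in> S. q z \<in> U}"
  have loc: "\<exists>\<tau> u. z = g \<tau> (\<sigma> u) \<and> u \<in> X \<and> vholo (\<lambda>z. coord (retr (g (- \<tau>) z))) z \<and>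
      eventually (\<lambda>w. w \<in> Y \<and> \<phi> (q w) = coord (retr (g (- \<tau>) w))) (nhds z)" if z: "z \<in> Y" for z
  proof -
    obtain u where u: "u \<in> X" "q (\<sigma> u) = q z" using z by (auto simp: Y_def U_def)
    then obtain \<tau> where \<tau>: "z = g \<tau> (\<sigma> u)" unfolding lproj_eq_iff by blast
    define h where "h w = coord (retr (g (- \<tau>) w))" for w
    have gz: "g (- \<tau>) z = \<sigma> u" unfolding \<tau> by simp
    have vh: "vholo h z"
      unfolding h_def using \<sigma>_near
      by (intro vholo_compose[OF vholo_gact vholo_coord_retr]) (simp add: gz)
    have "isCont (g (- \<tau>)) z" by (intro vholo_isCont vholo_gact)
    then have "eventually (\<lambda>w. g (- \<tau>) w \<in> near) (nhds z)"
      using open_near \<sigma>_near[of u] unfolding continuous_at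
      by (intro topological_tendstoD[of "g (- \<tau>)" "\<sigma> u"]) (auto simp: gz tendsto_nhds_iff)
    moreover have "h z = u" by (simp add: h_def gz)
    then have "eventually (\<lambda>w. h w \<in> X) (nhds z)"
      using vholo_isCont[OF vh] oX u(1) unfolding continuous_at
      by (intro topological_tendstoD[of h "h z"]) (auto simp: tendsto_nhds_iff)
    moreover have "eventually (\<lambda>w. w \<in> S) (nhds z)"
      using open_stab z by (intro eventually_nhds_in_open) (auto simp: Y_def)
    ultimately have "eventually (\<lambda>w. w \<in> Y \<and> \<phi> (q w) = h w) (nhds z)"
    proof eventually_elim
      case (elim w)
      have "q w = q (retr (g (- \<tau>) w))" by simp
      also have "\<dots> = q (\<sigma> (h w))" unfolding h_def retr_near[OF elim(1)] ..
      finally have "q w = q (\<sigma> (h w))" .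
      then show ?case using elim \<phi>q unfolding Y_def U_def by auto
    qed
    then show ?thesis using vh u \<tau> unfolding h_def by blast
  qed
  have oY: "open Y"
    unfolding open_subopen[of Y]
  proof
    fix z assume "z \<in> Y"
    from loc[OF this] have "eventually (\<lambda>w. w \<in> Y) (nhds z)"
      by (auto elim: eventually_mono)
    then show "\<exists>T. open T \<and> z \<in> T \<and> T \<subseteq> Y" unfolding eventually_nhds by blast
  qed
  have vh: "vholo (\<lambda>w. \<phi> (q w)) z" if "z \<in> Y" for z
  proof -
    from loc[OF that] obtain \<tau> where t: "vholo (\<lambda>z. coord (retr (g (- \<tau>) z))) z"
      "eventually (\<lambda>w. w \<in> Y \<and> \<phi> (q w) = coord (retr (g (- \<tau>) w))) (nhds z)" by blast
    from t(2) have "eventually (\<lambda>w. coord (retr (g (- \<tau>) w)) = \<phi> (q w)) (nhds z)"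
      by (rule eventually_mono) simp
    with t(1) show ?thesis by (rule vholo_transform)
  qed
  have cont: "continuous_on Y (\<lambda>w. \<phi> (q w))"
    using vh vholo_isCont continuous_at_imp_continuous_on by blast
  have US: "U \<subseteq> q ` S" unfolding U_def using XS by blast
  have oU: "openin (lvm_space \<Lambda>) U"
    unfolding openin_lvm_space using US oY by (simp add: Y_def)
  have "homeomorphic_maps (subtopology (lvm_space \<Lambda>) U) (top_of_set X) \<phi> (\<lambda>u. q (\<sigma> u))"
    unfolding homeomorphic_maps_def
  proof (intro conjI ballI)
    have tU: "topspace (subtopology (lvm_space \<Lambda>) U) = U"
      using US by (auto simp: topspace_lvm_space)
    show "continuous_map (subtopology (lvm_space \<Lambda>) U) (top_of_set X) \<phi>"
      unfolding continuous_map_def tU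
    proof (intro conjI allI impI)
      show "\<phi> \<in> U \<rightarrow> topspace (top_of_set X)" using \<phi>U by auto
      fix V assume "openin (top_of_set X) V"
      then have oV: "open V" using oX by (simp add: openin_open_eq)
      have "open (Y \<inter> (\<lambda>w. \<phi> (q w)) -` V)"
        by (rule continuous_open_preimage[OF cont oY oV])
      moreover have "Y \<inter> (\<lambda>w. \<phi> (q w)) -` V = {z \<in> S. q z \<in> {x \<in> U. \<phi> x \<in> V}}"
        by (auto simp: Y_def)
      ultimately have "openin (lvm_space \<Lambda>) {x \<in> U. \<phi> x \<in> V}"
        unfolding openin_lvm_space using US by auto
      then show "openin (subtopology (lvm_space \<Lambda>) U) {x \<in> U. \<phi> x \<in> V}"
        using oU by (simp add: openin_open_subtopology)
    qed
    show "continuous_map (top_of_set X) (subtopology (lvm_space \<Lambda>) U) (\<lambda>u. q (\<sigma> u))"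
      unfolding continuous_map_def tU
    proof (intro conjI allI impI)
      show "(\<lambda>u. q (\<sigma> u)) \<in> topspace (top_of_set X) \<rightarrow> U" by (auto simp: U_def)
      fix V assume "openin (subtopology (lvm_space \<Lambda>) U) V"
      then have "openin (lvm_space \<Lambda>) V" using oU by (simp add: openin_open_subtopology)
      then have o: "open {z \<in> S. q z \<in> V}" unfolding openin_lvm_space by blast
      have "continuous_on X \<sigma>" using vholo_\<sigma> vholo_isCont continuous_at_imp_continuous_on by blast
      from continuous_open_preimage[OF this oX o]
      have "open {u \<in> X. q (\<sigma> u) \<in> V}" using XS by (simp add: vimage_def Int_def cong: conj_cong)
      then show "openin (top_of_set X) {u \<in> topspace (top_of_set X). q (\<sigma> u) \<in> V}"
        using oX by (simp add: openin_open_eq)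
    qed
    show "q (\<sigma> (\<phi> x)) = x" if "x \<in> topspace (subtopology (lvm_space \<Lambda>) U)" for x
      using that \<phi>q unfolding tU by (auto simp: U_def)
    show "\<phi> (q (\<sigma> u)) = u" if "u \<in> topspace (top_of_set X)" for u
      using that \<phi>q by simp
  qed
  then have hm: "homeomorphic_map (subtopology (lvm_space \<Lambda>) U) (top_of_set (\<phi> ` U)) \<phi>"
    unfolding homeomorphic_map_maps \<phi>U by blast
  \<comment> \<open>Submersion: u \<mapsto> \<open>g \<tau> (\<sigma> u)\<close> is a local section,
    so D composed with its derivative is the identity.\<close>
  have der: "\<exists>D. vderiv (\<lambda>w. \<phi> (q w)) D z \<and> surj D" if z: "z \<in> Y" for z
  proof -
    obtain D where D: "vderiv (\<lambda>w. \<phi> (q w)) D z" using vh[OF z] unfolding vholo_def by blast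
    obtain \<tau> u where u: "z = g \<tau> (\<sigma> u)" "u \<in> X" using loc[OF z] by blast
    have "vholo (\<lambda>u. g \<tau> (\<sigma> u)) u" by (rule vholo_compose[OF vholo_\<sigma> vholo_gact])
    then obtain E where E: "vderiv (\<lambda>u. g \<tau> (\<sigma> u)) E u" unfolding vholo_def by blast
    have "vderiv (\<lambda>u. \<phi> (q (g \<tau> (\<sigma> u)))) (\<lambda>v. D (E v)) u"
      by (rule complex_derivative_chain[OF E]) (use D u in simp)
    moreover have "eventually (\<lambda>u. \<phi> (q (g \<tau> (\<sigma> u))) = u) (nhds u)"
      by (rule eventually_mono[OF eventually_nhds_in_open[OF oX u(2)]]) (simp add: \<phi>q)
    ultimately have "vderiv (\<lambda>u. u) (\<lambda>v. D (E v)) u"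
      by (rule complex_derivative_transform)
    moreover have "vderiv (\<lambda>u. u) (\<lambda>v. v) u"
      by (simp add: complex_derivative_def)
    ultimately have "(\<lambda>v. D (E v)) = (\<lambda>v. v)" by (rule complex_derivative_unique)
    then have "surj D" by (metis surjI)
    with D show ?thesis by blast
  qed
  have "(U, \<phi>) \<in> lvm_atlas \<Lambda>"
    unfolding lvm_atlas_def mem_Collect_eq prod.case
  proof (intro conjI allI impI)
    fix z assume "z \<noteq> 0 \<and> proj_pt z \<in> lvm_V \<Lambda> \<and> lvm_orbit \<Lambda> (proj_pt z) \<in> U"
    then have "z \<in> Y" unfolding Y_def using proj_pt_in_lvm_V[of z \<Lambda>] by (simp add: lproj_def)
    from der[OF this]
    show "\<exists>D. vderiv (\<lambda>y. \<phi> (lvm_orbit \<Lambda> (proj_pt y))) D z \<and> surj D"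
      unfolding lproj_def .
  qed (use oU hm oX \<phi>U in auto)
  moreover have u0X: "u0 \<in> X" using r(1) by (simp add: X_def)
  then have "q z0 \<in> U" "\<phi> (q z0) = u0" using \<phi>q[OF u0X] by (auto simp: U_def intro!: image_eqI[of _ _ u0])
  moreover have "\<sigma> u \<in> S \<and> q (\<sigma> u) \<in> U \<and> \<phi> (q (\<sigma> u)) = u" if "u \<in> \<phi> ` U" for u
    using that XS \<phi>q unfolding \<phi>U by (auto simp: U_def)
  ultimately show ?thesis by (intro that)
qed

end

section \<open>Derivatives of arbitrary charts, transition maps and local sections\<close>

type_synonym ('n, 'v) coords = "'n ppoint set \<Rightarrow> complex^'v"

lemma complex_derivative_linear:
  assumes "vderiv f D z"
  shows "D (x + y) = D x + D y" "D (c *s x) = c *s D x" "D 0 = 0" "D (x - y) = D x - D y" "linear D"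
proof -
  show l: "linear D"
    using complex_derivativeD(1)[OF assms] has_derivative_bounded_linear bounded_linear.linear by blast
  show "D (x + y) = D x + D y" "D 0 = 0" "D (x - y) = D x - D y"
    using linear_add[OF l] linear_0[OF l] linear_diff[OF l] by blast+
  show "D (c *s x) = c *s D x" using complex_derivativeD(2)[OF assms] .
qed

lemma complex_derivative_gact: "vderiv (gact \<Lambda> \<tau>) (gact \<Lambda> \<tau>) z"
  unfolding complex_derivative_def
proof (intro conjI allI)
  show "gact \<Lambda> \<tau> (c *s v) = c *s gact \<Lambda> \<tau> v" for c v by (simp add: vec_eq_iff)
  have "linear (gact \<Lambda> \<tau>)" by (rule linearI) (simp_all add: vec_eq_iff algebra_simps)
  then show "(gact \<Lambda> \<tau> has_derivative gact \<Lambda> \<tau>) (at z)"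
    by (simp add: bounded_linear_imp_has_derivative linear_conv_bounded_linear)
qed

lemma complex_derivative_orbit: "vderiv (\<lambda>\<tau>. gact \<Lambda> \<tau> z) (\<lambda>\<tau>. tang \<Lambda> \<tau> z) 0"
  unfolding complex_derivative_vec_iff
proof
  fix i
  have "linear (wt \<Lambda> i)"
    by (rule linearI) (simp_all add: wt_add scaleR_eq_vector_scalar_mult wt_scale scaleR_conv_of_real)
  then have "(wt \<Lambda> i has_derivative wt \<Lambda> i) (at 0)"
    by (simp add: bounded_linear_imp_has_derivative linear_conv_bounded_linear)
  then have "((\<lambda>\<tau>. exp (wt \<Lambda> i \<tau>)) has_derivative (\<lambda>h. exp (wt \<Lambda> i 0) * wt \<Lambda> i h)) (at 0)"
    by (rule has_derivative_compose[OF _ DERIV_exp[unfolded has_field_derivative_def]])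
  then have "((\<lambda>\<tau>. exp (wt \<Lambda> i \<tau>) * z $ i) has_derivative (\<lambda>h. exp (wt \<Lambda> i 0) * wt \<Lambda> i h * z $ i)) (at 0)"
    by (rule has_derivative_mult_left)
  then show "complex_derivative (*) (\<lambda>\<tau>. gact \<Lambda> \<tau> z $ i) (\<lambda>\<tau>. tang \<Lambda> \<tau> z $ i) 0"
    unfolding complex_derivative_def by (simp add: tang_def wt_scale)
qed

context lvm
begin

abbreviation atlas :: "('n ppoint set, 'v::finite) chart set"
  where "atlas \<equiv> lvm_atlas \<Lambda>"

definition dchart :: "(('n, 'v::finite) coords) \<Rightarrow> complex^'n \<Rightarrow> complex^'n \<Rightarrow> complex^'v"
  where "dchart \<phi> z = frechet_derivative (\<lambda>y. \<phi> (q y)) (at z)"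

lemma atlas_dchart:
  assumes "(U, \<phi>) \<in> atlas" "z \<in> S" "q z \<in> U"
  shows "vderiv (\<lambda>y. \<phi> (q y)) (dchart \<phi> z) z" "surj (dchart \<phi> z)"
    "vholo (\<lambda>y. \<phi> (q y)) z"
proof -
  obtain D where D: "vderiv (\<lambda>y. \<phi> (q y)) D z" "surj D"
    using assms proj_pt_in_lvm_V[of z \<Lambda>] unfolding lvm_atlas_def lproj_def by blast
  have "dchart \<phi> z = D"
    unfolding dchart_def using D(1) by (auto intro: has_derivative_frechet simp: complex_derivative_def)
  with D show "vderiv (\<lambda>y. \<phi> (q y)) (dchart \<phi> z) z" "surj (dchart \<phi> z)"
    "vholo (\<lambda>y. \<phi> (q y)) z" by (auto simp: vholo_def)
qed

lemma dchart_surj: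
  assumes "(U, \<phi>) \<in> atlas" "z \<in> S" "q z \<in> U"
  obtains ws where "vs = map (dchart \<phi> z) ws"
  using atlas_dchart(2)[OF assms] ex_map_conv[of vs "dchart \<phi> z"] by (metis surjD)

lemma atlas_open:
  assumes "(U, \<phi>) \<in> atlas"
  shows "openin (lvm_space \<Lambda>) U" "U \<subseteq> q ` S" "open {z \<in> S. q z \<in> U}"
  using assms openin_lvm_space unfolding lvm_atlas_def by auto

lemma atlas_inj:
  assumes "(U, \<phi>) \<in> atlas"
  shows "inj_on \<phi> U"
proof -
  have "topspace (subtopology (lvm_space \<Lambda>) U) = U"
    using atlas_open[OF assms] by (auto simp: topspace_lvm_space)
  then show ?thesis
    using assms homeomorphic_imp_injective_map unfolding lvm_atlas_def by fastforce
qed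

lemma atlas_open_image:
  assumes "(U, \<phi>) \<in> atlas" "openin (lvm_space \<Lambda>) W" "W \<subseteq> U"
  shows "open (\<phi> ` W)"
proof -
  have h: "homeomorphic_map (subtopology (lvm_space \<Lambda>) U) (top_of_set (\<phi> ` U)) \<phi>" "open (\<phi> ` U)"
    using assms(1) unfolding lvm_atlas_def by auto
  have "openin (subtopology (lvm_space \<Lambda>) U) W"
    using assms(2,3) atlas_open(1)[OF assms(1)] by (simp add: openin_open_subtopology)
  then have "openin (top_of_set (\<phi> ` U)) (\<phi> ` W)"
    using homeomorphic_imp_open_map[OF h(1)] unfolding open_map_def by blast
  then show ?thesis using h(2) by (simp add: openin_open_eq)
qed

lemma dchart_tang:
  assumes "(U, \<phi>) \<in> atlas" "z \<in> S" "q z \<in> U"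
  shows "dchart \<phi> z (tang \<Lambda> \<tau> z) = 0"
proof -
  have "vderiv (\<lambda>\<tau>. \<phi> (q (g \<tau> z))) (\<lambda>\<tau>. dchart \<phi> z (tang \<Lambda> \<tau> z)) 0"
    by (rule complex_derivative_chain[OF complex_derivative_orbit]) (use atlas_dchart(1)[OF assms] in simp)
  moreover have "vderiv (\<lambda>\<tau>. \<phi> (q (g \<tau> z))) (\<lambda>\<tau>. 0) 0"
    by (simp add: complex_derivative_def)
  ultimately have "(\<lambda>\<tau>. dchart \<phi> z (tang \<Lambda> \<tau> z)) = (\<lambda>\<tau>. 0)" by (rule complex_derivative_unique)
  then show ?thesis by metis
qed

lemma dchart_gact:
  assumes "(U, \<phi>) \<in> atlas" "z \<in> S" "q z \<in> U"
  shows "dchart \<phi> (g \<tau> z) (g \<tau> v) = dchart \<phi> z v"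
proof -
  have "vderiv (\<lambda>y. \<phi> (q (g \<tau> y))) (\<lambda>v. dchart \<phi> (g \<tau> z) (g \<tau> v)) z"
    using assms by (intro complex_derivative_chain[OF complex_derivative_gact] atlas_dchart(1)) auto
  then have "vderiv (\<lambda>y. \<phi> (q y)) (\<lambda>v. dchart \<phi> (g \<tau> z) (g \<tau> v)) z" by simp
  from complex_derivative_unique[OF this atlas_dchart(1)[OF assms]] show ?thesis by metis
qed

text \<open>All that is used of slices from here on: an affine section with constant derivative
  \<open>\<sigma>'\<close>, transverse to the orbits. The cardinality condition says that the
  coordinates left over by \<kappa> are indexed by \<open>'v\<close>.\<close>

lemma exists_slice:
  assumes card: "CARD('v::finite) + CARD('m) + 1 = CARD('n)" and z: "z \<in> S"
  obtains U and \<phi> :: "('n, 'v::finite) coords" and \<sigma> \<sigma>'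
  where "(U, \<phi>) \<in> atlas" "q z \<in> U" "\<sigma> (\<phi> (q z)) = z"
    "\<And>u. vderiv \<sigma> \<sigma>' u"
    "\<And>y. y \<in> U \<Longrightarrow> \<sigma> (\<phi> y) \<in> S \<and> q (\<sigma> (\<phi> y)) = y"
    "\<And>u w. \<exists>\<tau> v. w = tang \<Lambda> \<tau> (\<sigma> u) + \<sigma>' v"
proof -
  obtain \<kappa> :: "'m option \<Rightarrow> 'n" and N where \<kappa>: "inj \<kappa>" "\<And>k. z $ \<kappa> k \<noteq> 0"
    "\<And>\<tau>. N *v (\<chi> k. wt \<Lambda> (\<kappa> k) \<tau>) = \<tau>" "\<And>x k. wt \<Lambda> (\<kappa> k) (N *v x) = x $ k"
    by (rule slice_labels[OF z], rule that)
  have "card (range \<kappa>) = CARD('m) + 1" using card_image[OF \<kappa>(1)] by simp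
  then have "card (- range \<kappa>) = CARD('v)" 
    using card by (simp add: Compl_eq_Diff_UNIV card_Diff_subset)
  then obtain \<beta> :: "'v \<Rightarrow> 'n" where \<beta>: "bij_betw \<beta> UNIV (- range \<kappa>)"
    using finite_same_card_bij[of "UNIV :: 'v set" "- range \<kappa>"] by auto
  interpret sl: lvm_slice \<Lambda> z \<kappa> N \<beta>
    by unfold_locales (use z \<kappa> \<beta> in auto)
  obtain U \<phi> where U: "(U, \<phi>) \<in> atlas" "q z \<in> U" "\<phi> (q z) = sl.u0"
    "\<And>u. u \<in> \<phi> ` U \<Longrightarrow> sl.\<sigma> u \<in> S \<and> q (sl.\<sigma> u) \<in> U \<and> \<phi> (q (sl.\<sigma> u)) = u"
    by (rule sl.slice_chart, rule that)
  show ?thesis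
  proof (rule that[OF U(1,2)])
    show "sl.\<sigma> (\<phi> (q z)) = z" unfolding U(3) by (rule sl.\<sigma>_u0)
    show "vderiv sl.\<sigma> sl.\<sigma>' u" for u by (rule sl.complex_derivative_\<sigma>)
    show "\<exists>\<tau> v. w = tang \<Lambda> \<tau> (sl.\<sigma> u) + sl.\<sigma>' v" for u w
      using sl.tangent_decomposition by blast
    fix y assume y: "y \<in> U"
    have "sl.\<sigma> (\<phi> y) \<in> S" "q (sl.\<sigma> (\<phi> y)) \<in> U" "\<phi> (q (sl.\<sigma> (\<phi> y))) = \<phi> y"
      using U(4)[of "\<phi> y"] y by auto
    then show "sl.\<sigma> (\<phi> y) \<in> S \<and> q (sl.\<sigma> (\<phi> y)) = y"
      using atlas_inj[OF U(1)] y by (auto dest: inj_onD)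
  qed
qed

text \<open>An arbitrary chart \<phi> is compared with a slice chart. The map h = \<phi> \<circ> q
  \<circ> \<sigma> is holomorphic; its derivative L is onto, because that of \<phi> \<circ> q is and
  kills orbit directions, hence bijective. So the local inverse G of h is differentiable, and the
  transition map is locally \<psi> \<circ> q \<circ> \<sigma> \<circ> G. Injectivity of L leaves
  only orbit directions in the kernel of \<open>dchart \<phi> z\<close>.\<close>

lemma transition_and_kernel:
  fixes \<phi> \<psi> :: "('n, 'v::finite) coords"
  assumes card: "CARD('v) + CARD('m) + 1 = CARD('n)"
    and U: "(U, \<phi>) \<in> atlas" and W: "(W, \<psi>) \<in> atlas"
    and z: "z \<in> S" "q z \<in> U" "q z \<in> W"
  shows "\<exists>F. vderiv (\<psi> \<circ> inv_into U \<phi>) F (\<phi> (q z)) \<and> (\<forall>w. F (dchart \<phi> z w) = dchart \<psi> z w)"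
    and "dchart \<phi> z w = 0 \<Longrightarrow> \<exists>\<tau>. w = tang \<Lambda> \<tau> z"
proof -
  obtain U0 and \<phi>0 :: "('n, 'v) coords" and \<sigma> \<sigma>'
    where U0: "(U0, \<phi>0) \<in> atlas" "q z \<in> U0" and \<sigma>z: "\<sigma> (\<phi>0 (q z)) = z"
    and \<sigma>: "\<And>u. vderiv \<sigma> \<sigma>' u"
    and sec: "\<And>y. y \<in> U0 \<Longrightarrow> \<sigma> (\<phi>0 y) \<in> S \<and> q (\<sigma> (\<phi>0 y)) = y"
    and dec: "\<And>u w. \<exists>\<tau> v. w = tang \<Lambda> \<tau> (\<sigma> u) + \<sigma>' v"
    by (rule exists_slice[OF card z(1)], rule that)
  define u1 where "u1 = \<phi>0 (q z)"
  define T where "T = U0 \<inter> U \<inter> W"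
  have T: "openin (lvm_space \<Lambda>) T" "q z \<in> T"
    unfolding T_def using U0 z atlas_open(1)[OF U] atlas_open(1)[OF W] atlas_open(1)[OF U0(1)] by auto
  define X0 where "X0 = \<phi>0 ` T"
  have X0: "open X0" "u1 \<in> X0"
    unfolding X0_def u1_def using T atlas_open_image[OF U0(1) T(1)] by (auto simp: T_def)
  define L where "L v = dchart \<phi> z (\<sigma>' v)" for v
  define h where "h u = \<phi> (q (\<sigma> u))" for u
  define G where "G = (\<lambda>x. \<phi>0 (inv_into U \<phi> x))"
  have \<sigma>u1: "\<sigma> u1 = z" unfolding u1_def by (rule \<sigma>z)
  note D = atlas_dchart(1)[OF U z(1,2)] and E = atlas_dchart(1)[OF W z(1,3)]
  have dh: "vderiv h L u1"
    unfolding h_def L_def by (rule complex_derivative_chain[OF \<sigma>]) (use D \<sigma>u1 in simp)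
  have \<sigma>X0: "\<sigma> u \<in> S \<and> q (\<sigma> u) \<in> U" if u: "u \<in> X0" for u
  proof -
    obtain y where y: "y \<in> T" "u = \<phi>0 y" using u unfolding X0_def by blast
    then show ?thesis using sec[of y] by (simp add: T_def)
  qed
  have "isCont h u" if "u \<in> X0" for u
    unfolding h_def
  proof (rule vholo_isCont, rule vholo_compose[of \<sigma>])
    show "vholo \<sigma> u" unfolding vholo_def using \<sigma> by blast
    show "vholo (\<lambda>y. \<phi> (q y)) (\<sigma> u)" using that atlas_dchart(3)[OF U] \<sigma>X0[OF that] by blast
  qed
  then have ch: "continuous_on X0 h" by (simp add: continuous_at_imp_continuous_on)
  have inv: "inv_into U \<phi> (\<phi> y) = y" if "y \<in> U" for y
    using that atlas_inj[OF U] by simp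
  have Gh: "G (h u) = u" if u: "u \<in> X0" for u
  proof -
    obtain y where y: "y \<in> T" "u = \<phi>0 y" using u unfolding X0_def by blast
    then show ?thesis unfolding G_def h_def using sec[of y] inv[of y] by (simp add: T_def)
  qed
  have surjL: "surj L"
  proof (rule surjI[where f="\<lambda>x. SOME v. L v = x"], rule someI_ex)
    fix x
    obtain w where w: "x = dchart \<phi> z w" using atlas_dchart(2)[OF U z(1,2)] by (meson surjD)
    obtain \<tau> v where v: "w = tang \<Lambda> \<tau> z + \<sigma>' v" using dec[of w u1] \<sigma>u1 by auto
    have "L v = x"
      unfolding w v L_def complex_derivative_linear(1)[OF D] dchart_tang[OF U z(1,2)] by simp
    then show "\<exists>v. L v = x" by blast
  qed
  have linL: "linear L" using complex_derivative_linear(5)[OF dh] .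
  \<comment> \<open>Slice and chart have the same dimension, so surjectivity suffices.\<close>
  have injL: "inj L" by (rule linear_surjective_imp_injective[OF linL surjL refl])
  obtain g' where g': "linear g'" "L \<circ> g' = id"
    using linear_surjective_right_inverse[OF linL surjL] by blast
  have Lg: "L (g' x) = x" for x using g'(2) by (metis comp_apply id_apply)
  have gL: "g' (L x) = x" for x using Lg injL by (metis injD)
  have "(G has_derivative g') (at (h u1))"
    by (rule has_derivative_inverse_strong[OF X0 ch Gh complex_derivativeD(1)[OF dh] g'(2)])
  moreover have "g' (c *s x) = c *s g' x" for c x
    by (rule injD[OF injL]) (simp add: Lg complex_derivative_linear(2)[OF dh])
  moreover have hu1: "h u1 = \<phi> (q z)" unfolding h_def \<sigma>u1 ..
  ultimately have dG: "vderiv G g' (\<phi> (q z))" by (simp add: complex_derivative_def)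
  have Gz: "G (\<phi> (q z)) = u1" using Gh[OF X0(2)] hu1 by simp
  have d1: "vderiv (\<lambda>u. \<psi> (q (\<sigma> u))) (\<lambda>v. dchart \<psi> z (\<sigma>' v)) u1"
    by (rule complex_derivative_chain[OF \<sigma>]) (use E \<sigma>u1 in simp)
  have "vderiv (\<lambda>x. \<psi> (q (\<sigma> (G x)))) (\<lambda>v. dchart \<psi> z (\<sigma>' (g' v))) (\<phi> (q z))"
    by (rule complex_derivative_chain[OF dG]) (use d1 Gz in simp)
  moreover have "eventually (\<lambda>x. \<psi> (q (\<sigma> (G x))) = (\<psi> \<circ> inv_into U \<phi>) x) (nhds (\<phi> (q z)))"
  proof (rule eventually_mono[OF eventually_nhds_in_open[of "\<phi> ` T"]])
    show "open (\<phi> ` T)" by (rule atlas_open_image[OF U T(1)]) (auto simp: T_def)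
    show "\<phi> (q z) \<in> \<phi> ` T" using T(2) by blast
    fix x assume "x \<in> \<phi> ` T"
    then obtain y where "y \<in> T" "x = \<phi> y" by blast
    then show "\<psi> (q (\<sigma> (G x))) = (\<psi> \<circ> inv_into U \<phi>) x"
      by (simp add: G_def T_def inv sec)
  qed
  ultimately have F: "vderiv (\<psi> \<circ> inv_into U \<phi>) (\<lambda>v. dchart \<psi> z (\<sigma>' (g' v))) (\<phi> (q z))"
    by (rule complex_derivative_transform)
  have key: "\<exists>\<tau> v. w = tang \<Lambda> \<tau> z + \<sigma>' v \<and> dchart \<phi> z w = L v" for w
  proof -
    obtain \<tau> v where v: "w = tang \<Lambda> \<tau> z + \<sigma>' v" using dec[of w u1] \<sigma>u1 by auto
    then have "dchart \<phi> z w = L v"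
      unfolding L_def by (simp add: complex_derivative_linear(1)[OF D] dchart_tang[OF U z(1,2)])
    with v show ?thesis by blast
  qed
  have "dchart \<psi> z (\<sigma>' (g' (dchart \<phi> z w))) = dchart \<psi> z w" for w
  proof -
    obtain \<tau> v where v: "w = tang \<Lambda> \<tau> z + \<sigma>' v" "dchart \<phi> z w = L v" using key by blast
    show ?thesis unfolding v(2) gL unfolding v(1)
      by (simp add: complex_derivative_linear(1)[OF E] dchart_tang[OF W z(1,3)])
  qed
  with F show "\<exists>F. vderiv (\<psi> \<circ> inv_into U \<phi>) F (\<phi> (q z)) \<and> (\<forall>w. F (dchart \<phi> z w) = dchart \<psi> z w)"
    by (intro exI[of _ "\<lambda>v. dchart \<psi> z (\<sigma>' (g' v))"]) simp
  show "\<exists>\<tau>. w = tang \<Lambda> \<tau> z" if "dchart \<phi> z w = 0"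
  proof -
    obtain \<tau> v where v: "w = tang \<Lambda> \<tau> z + \<sigma>' v" "dchart \<phi> z w = L v" using key by blast
    have "L v = L 0" using v(2) that linear_0[OF linL] by simp
    then have "v = 0" by (rule injD[OF injL])
    moreover have "\<sigma>' 0 = 0" using complex_derivative_linear(3)[OF \<sigma>] .
    ultimately show ?thesis using v(1) by auto
  qed
qed

lemma frechet_transition:
  fixes \<phi> \<psi> :: "('n, 'v::finite) coords"
  assumes "CARD('v) + CARD('m) + 1 = CARD('n)"
    and "(U, \<phi>) \<in> atlas" "(W, \<psi>) \<in> atlas" "z \<in> S" "q z \<in> U" "q z \<in> W"
  shows "frechet_derivative (\<psi> \<circ> inv_into U \<phi>) (at (\<phi> (q z))) (dchart \<phi> z w) = dchart \<psi> z w"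
    and "vholo (\<psi> \<circ> inv_into U \<phi>) (\<phi> (q z))"
proof -
  obtain F where F: "vderiv (\<psi> \<circ> inv_into U \<phi>) F (\<phi> (q z))"
      "\<forall>w. F (dchart \<phi> z w) = dchart \<psi> z w"
    using transition_and_kernel(1)[OF assms] by blast
  have "frechet_derivative (\<psi> \<circ> inv_into U \<phi>) (at (\<phi> (q z))) = F"
    by (rule has_derivative_frechet[OF complex_derivativeD(1)[OF F(1)]])
  then show "frechet_derivative (\<psi> \<circ> inv_into U \<phi>) (at (\<phi> (q z))) (dchart \<phi> z w) = dchart \<psi> z w"
    using F(2) by simp
  show "vholo (\<psi> \<circ> inv_into U \<phi>) (\<phi> (q z))" using F(1) unfolding vholo_def by blast
qed

text \<open>A local holomorphic section of the quotient map in any chart: a transition map into a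
  slice chart followed by the affine section of that slice.\<close>

lemma holomorphic_lift:
  fixes \<phi> :: "('n, 'v::finite) coords"
  assumes card: "CARD('v) + CARD('m) + 1 = CARD('n)"
    and U: "(U, \<phi>) \<in> atlas" and z: "z \<in> S" "q z \<in> U"
  obtains X s where "open X" "\<phi> (q z) \<in> X"
    "\<And>x. x \<in> X \<Longrightarrow> s x \<in> S \<and> q (s x) \<in> U \<and> \<phi> (q (s x)) = x \<and> vholo s x"
    "\<And>x v. x \<in> X \<Longrightarrow> dchart \<phi> (s x) (frechet_derivative s (at x) v) = v"
proof -
  obtain U0 and \<phi>0 :: "('n, 'v) coords" and \<sigma> \<sigma>'
    where U0: "(U0, \<phi>0) \<in> atlas" "q z \<in> U0" and \<sigma>z: "\<sigma> (\<phi>0 (q z)) = z"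
    and \<sigma>: "\<And>u. vderiv \<sigma> \<sigma>' u"
    and sec: "\<And>y. y \<in> U0 \<Longrightarrow> \<sigma> (\<phi>0 y) \<in> S \<and> q (\<sigma> (\<phi>0 y)) = y"
    and dec: "\<And>u w. \<exists>\<tau> v. w = tang \<Lambda> \<tau> (\<sigma> u) + \<sigma>' v"
    by (rule exists_slice[OF card z(1)], rule that)
  define X where "X = \<phi> ` (U0 \<inter> U)"
  define s where "s = (\<lambda>x. \<sigma> ((\<phi>0 \<circ> inv_into U \<phi>) x))"
  have inv: "inv_into U \<phi> (\<phi> y) = y" if "y \<in> U" for y
    using that atlas_inj[OF U] by simp
  have oX: "open X" unfolding X_def
    by (rule atlas_open_image[OF U]) (use atlas_open(1)[OF U] atlas_open(1)[OF U0(1)] in auto)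
  have zX: "\<phi> (q z) \<in> X" using z(2) U0(2) by (simp add: X_def)
  have lift: "s x \<in> S \<and> q (s x) \<in> U \<and> \<phi> (q (s x)) = x \<and> vholo s x" if x: "x \<in> X" for x
  proof -
    obtain y where y: "y \<in> U0" "y \<in> U" "x = \<phi> y" using x unfolding X_def by blast
    obtain z' where z': "z' \<in> S" "y = q z'" using atlas_open(2)[OF U] y(2) by blast
    have sx: "s x = \<sigma> (\<phi>0 y)" by (simp add: s_def y(3) inv[OF y(2)])
    have "vholo (\<phi>0 \<circ> inv_into U \<phi>) x"
      using frechet_transition(2)[OF card U U0(1) z'(1)] y z'(2) by simp
    then have "vholo s x" unfolding s_def
      by (rule vholo_compose) (use \<sigma> in \<open>auto simp: vholo_def\<close>)
    then show ?thesis unfolding sx using sec[OF y(1)] y(2,3) by simp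
  qed
  show ?thesis
  proof (rule that[OF oX zX])
    show "dchart \<phi> (s x) (frechet_derivative s (at x) v) = v" if x: "x \<in> X" for x v
    proof -
      have "vderiv (\<lambda>x. \<phi> (q (s x))) (\<lambda>v. dchart \<phi> (s x) (frechet_derivative s (at x) v)) x"
        using lift[OF x] by (intro complex_derivative_chain[OF vholo_derivative] atlas_dchart(1)[OF U]) auto
      moreover have "eventually (\<lambda>x. \<phi> (q (s x)) = x) (nhds x)"
        by (rule eventually_mono[OF eventually_nhds_in_open[OF oX x]]) (use lift in blast)
      ultimately have "vderiv (\<lambda>x. x) (\<lambda>v. dchart \<phi> (s x) (frechet_derivative s (at x) v)) x"
        by (rule complex_derivative_transform)
      moreover have "vderiv (\<lambda>x. x) (\<lambda>v. v) x" by (simp add: complex_derivative_def)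
      ultimately have "(\<lambda>v. dchart \<phi> (s x) (frechet_derivative s (at x) v)) = (\<lambda>v. v)"
        by (rule complex_derivative_unique)
      then show ?thesis by metis
    qed
  qed (use lift in auto)
qed

section \<open>The pullback of a holomorphic form to the stable set\<close>

text \<open>The pullback of \<omega> along the quotient map. The chart is chosen arbitrarily;
  \<open>pulled_eq\<close> shows that any chart around the point gives the same value.\<close>

definition pulled :: "('n ppoint set, 'v::finite) form_family \<Rightarrow> complex^'n \<Rightarrow> (complex^'n) list \<Rightarrow> complex"
  where "pulled \<omega> z vs = (case SOME c. c \<in> atlas \<and> q z \<in> fst c of
    (U, \<phi>) \<Rightarrow> \<omega> (U, \<phi>) (\<phi> (q z)) (map (dchart \<phi> z) vs))"

lemma holomorphic_formsD:
  assumes "\<omega> \<in> holomorphic_forms \<A> p" "(U, \<phi>) \<in> \<A>"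
  shows "holomorphic_form_on (\<phi> ` U) p (\<omega> (U, \<phi>))"
    "(W, \<psi>) \<in> \<A> \<Longrightarrow> y \<in> U \<Longrightarrow> y \<in> W \<Longrightarrow>
      \<omega> (U, \<phi>) (\<phi> y) = form_pullback (\<psi> \<circ> inv_into U \<phi>) (\<omega> (W, \<psi>)) (\<phi> y)"
  using assms unfolding holomorphic_forms_def by blast+

context
  fixes p :: nat and \<omega> :: "('n ppoint set, 'v::finite) form_family"
  assumes card: "CARD('v) + CARD('m) + 1 = CARD('n)"
    and \<omega>: "\<omega> \<in> holomorphic_forms atlas p"
begin

lemma pulled_eq:
  assumes U: "(U, \<phi>) \<in> atlas" and z: "z \<in> S" "q z \<in> U"
  shows "pulled \<omega> z vs = \<omega> (U, \<phi>) (\<phi> (q z)) (map (dchart \<phi> z) vs)"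
proof -
  let ?c = "SOME c :: ('n ppoint set, 'v) chart. c \<in> atlas \<and> q z \<in> fst c"
  obtain W \<psi> where c: "?c = (W, \<psi>)" by (cases ?c)
  have "?c \<in> atlas \<and> q z \<in> fst ?c" by (rule someI[of _ "(U, \<phi>)"]) (use U z in simp)
  then have W: "(W, \<psi>) \<in> atlas" "q z \<in> W" unfolding c by auto
  have iv: "inv_into U \<phi> (\<phi> (q z)) = q z" using z atlas_inj[OF U] by simp
  have "\<omega> (U, \<phi>) (\<phi> (q z)) (map (dchart \<phi> z) vs) =
      \<omega> (W, \<psi>) (\<psi> (q z)) (map (dchart \<psi> z) vs)"
    unfolding holomorphic_formsD(2)[OF \<omega> U W(1) z(2) W(2)] form_pullback_def
    by (simp add: iv o_def frechet_transition(1)[OF card U W(1) z W(2), unfolded o_def])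
  then show ?thesis unfolding pulled_def c by simp
qed

lemma obtain_chart:
  assumes "z \<in> S"
  obtains U and \<phi> :: "('n, 'v) coords" where "(U, \<phi>) \<in> atlas" "q z \<in> U"
  by (rule exists_slice[OF card assms], rule that)

lemma pulled_altf: assumes z: "z \<in> S" shows "pulled \<omega> z \<in> altf p"
proof -
  obtain U and \<phi> :: "('n, 'v) coords" where U: "(U, \<phi>) \<in> atlas" "q z \<in> U"
    by (rule obtain_chart[OF z])
  have "\<omega> (U, \<phi>) (\<phi> (q z)) \<in> altf p"
    using holomorphic_formsD(1)[OF \<omega> U(1)] U(2) unfolding holomorphic_form_on_def by blast
  then have "(\<lambda>vs. \<omega> (U, \<phi>) (\<phi> (q z)) (map (dchart \<phi> z) vs)) \<in> altf p"
    by (rule altf_linear_sub) (rule complex_derivative_linear[OF atlas_dchart(1)[OF U(1) z U(2)]])+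
  then show ?thesis unfolding pulled_eq[OF U(1) z U(2), symmetric] .
qed

lemma pulled_tang: assumes z: "z \<in> S" shows "pulled \<omega> z (us @ tang \<Lambda> \<tau> z # vs) = 0"
proof -
  obtain U and \<phi> :: "('n, 'v) coords" where U: "(U, \<phi>) \<in> atlas" "q z \<in> U"
    by (rule obtain_chart[OF z])
  have "\<omega> (U, \<phi>) (\<phi> (q z)) \<in> altf p"
    using holomorphic_formsD(1)[OF \<omega> U(1)] U(2) unfolding holomorphic_form_on_def by blast
  then show ?thesis
    by (simp add: pulled_eq[OF U(1) z U(2)] dchart_tang[OF U(1) z U(2)] altf_zero)
qed

lemma pulled_gact: assumes z: "z \<in> S" shows "pulled \<omega> (g \<tau> z) (map (g \<tau>) vs) = pulled \<omega> z vs"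
proof -
  obtain U and \<phi> :: "('n, 'v) coords" where U: "(U, \<phi>) \<in> atlas" "q z \<in> U"
    by (rule obtain_chart[OF z])
  have gz: "g \<tau> z \<in> S" "q (g \<tau> z) \<in> U" using z U(2) by auto
  show ?thesis
    unfolding pulled_eq[OF U(1) z U(2)] pulled_eq[OF U(1) gz]
    by (simp add: o_def dchart_gact[OF U(1) z U(2)])
qed

text \<open>Not only the form but also the vectors \<open>dchart \<phi> y v\<close> inserted into it
  vary with y. They are directional derivatives of \<phi> \<circ> q, and here their holomorphy is
  needed.\<close>

lemma pulled_holo: assumes z: "z \<in> S" shows "holo (\<lambda>z. pulled \<omega> z vs) z"
proof -
  obtain U and \<phi> :: "('n, 'v) coords" where U: "(U, \<phi>) \<in> atlas" "q z \<in> U"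
    by (rule obtain_chart[OF z])
  let ?Y = "{z \<in> S. q z \<in> U}"
  have oY: "open ?Y" by (rule atlas_open(3)[OF U(1)])
  have zY: "z \<in> ?Y" using z U(2) by simp
  have hf: "holomorphic_form_on (\<phi> ` U) p (\<omega> (U, \<phi>))" by (rule holomorphic_formsD(1)[OF \<omega> U(1)])
  have vq: "vholo (\<lambda>y. \<phi> (q y)) y" if "y \<in> ?Y" for y using atlas_dchart(3)[OF U(1)] that by blast
  have "holo (\<lambda>y. \<omega> (U, \<phi>) (\<phi> (q y)) (map (\<lambda>f. f y) (map (\<lambda>v y. dchart \<phi> y v) vs) @ [])) z"
  proof (rule holo_altf[OF oY zY])
    show "\<omega> (U, \<phi>) (\<phi> (q y)) \<in> altf p" if "y \<in> ?Y" for y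
      using hf that unfolding holomorphic_form_on_def by blast
    show "holo (\<lambda>y. \<omega> (U, \<phi>) (\<phi> (q y)) vs) z" if "length vs = p" for vs
    proof (rule holo_compose[OF vq[OF zY]])
      show "holo (\<lambda>x. \<omega> (U, \<phi>) x vs) (\<phi> (q z))"
        unfolding holo_def using hf that U(2) unfolding holomorphic_form_on_def by blast
    qed
    fix f assume "f \<in> set (map (\<lambda>v y. dchart \<phi> y v) vs)"
    then obtain v where "f = (\<lambda>y. dchart \<phi> y v)" by auto
    then show "vholo f z" unfolding dchart_def using vholo_directional_derivative[OF oY vq zY] by simp
  qed
  moreover have "eventually (\<lambda>y. \<omega> (U, \<phi>) (\<phi> (q y)) (map (\<lambda>f. f y) (map (\<lambda>v y. dchart \<phi> y v) vs) @ []) =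
      pulled \<omega> y vs) (nhds z)"
    by (rule eventually_mono[OF eventually_nhds_in_open[OF oY zY]]) (simp add: pulled_eq[OF U(1)] o_def)
  ultimately show ?thesis by (rule holo_transform)
qed

end

end

section \<open>Logarithmic differentials of the indispensable coordinates\<close>

locale lvm_block = lvm \<Lambda>
  for \<Lambda> :: "'n::finite \<Rightarrow> complex ^ 'm::finite" +
  fixes a0 :: 'n and a :: "'m \<Rightarrow> 'n"
  assumes bij: "bij_betw (case_option a0 a) UNIV (indispensable \<Lambda>)"
begin

abbreviation B where "B \<equiv> indisp_block \<Lambda> a0 a"

lemma indispensable_eq: "indispensable \<Lambda> = insert a0 (range a)"
  using bij by (auto simp: bij_betw_def UNIV_option_conv image_image)

lemma a_eq_iff [simp]: "a \<mu> = a \<nu> \<longleftrightarrow> \<mu> = \<nu>" "a \<mu> \<noteq> a0" "a0 \<noteq> a \<mu>"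
proof -
  have "inj (case_option a0 a)" using bij by (simp add: bij_betw_def)
  from inj_eq[OF this, of "Some \<mu>" "Some \<nu>"] inj_eq[OF this, of "Some \<mu>" None]
  show "a \<mu> = a \<nu> \<longleftrightarrow> \<mu> = \<nu>" "a \<mu> \<noteq> a0" "a0 \<noteq> a \<mu>" by auto
qed

lemma indispensable_nonzero:
  assumes "z \<in> S" "i \<in> indispensable \<Lambda>"
  shows "z $ i \<noteq> 0"
proof
  assume "z $ i = 0"
  then have "convex hull (\<Lambda> ` {j. z $ j \<noteq> 0}) \<subseteq> convex hull (\<Lambda> ` {j. j \<noteq> i})"
    by (intro hull_mono) auto
  then show False using assms by (auto simp: stab_def indispensable_def)
qed

lemma a_nonzero: "z \<in> S \<Longrightarrow> z $ a \<mu> \<noteq> 0" "z \<in> S \<Longrightarrow> z $ a0 \<noteq> 0"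
  using indispensable_nonzero by (auto simp: indispensable_eq)

lemma B_nth: "B T $ \<mu> = bilin (\<Lambda> (a \<mu>)) T - bilin (\<Lambda> a0) T"
  by (simp add: indisp_block_def bilin_diff_left)

lemma B_linear: "B (x + y) = B x + B y" "B (c *s x) = c *s B x"
  by (simp_all add: vec_eq_iff B_nth bilin_add bilin_scale algebra_simps)

text \<open>The differences of the logarithmic differentials at \<open>a \<mu>\<close> and at a0,
  applied to v. The scaling direction cancels, and the values on orbit directions fill exactly
  \<open>range B\<close>.\<close>

definition \<theta> :: "complex^'n \<Rightarrow> complex^'n \<Rightarrow> complex^'m"
  where "\<theta> z v = (\<chi> \<mu>. v $ a \<mu> / z $ a \<mu> - v $ a0 / z $ a0)"

lemma \<theta>_linear: "\<theta> z (v + w) = \<theta> z v + \<theta> z w" "\<theta> z (c *s v) = c *s \<theta> z v" "\<theta> z (v - w) = \<theta> z v - \<theta> z w"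
  by (simp_all add: \<theta>_def vec_eq_iff add_divide_distrib diff_divide_distrib algebra_simps)

lemma \<theta>_tang: "z \<in> S \<Longrightarrow> \<theta> z (tang \<Lambda> \<tau> z) = B (\<chi> j. \<tau> $ Some j)"
  using a_nonzero by (simp add: \<theta>_def vec_eq_iff tang_def B_nth wt_eq)

lemma \<theta>_gact: "\<theta> (g \<tau> z) (g \<tau> v) = \<theta> z v"
  by (simp add: \<theta>_def)

definition lift :: "complex^'m \<Rightarrow> complex^'n"
  where "lift x = (\<chi> i. if i \<in> range a then x $ inv a i else 0)"

lemma lift_nth [simp]: "lift x $ a \<mu> = x $ \<mu>" "lift x $ a0 = 0"
proof -
  have "inj a" by (simp add: inj_def)
  then show "lift x $ a \<mu> = x $ \<mu>" by (simp add: lift_def)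
  show "lift x $ a0 = 0" by (auto simp: lift_def)
qed

lemma lift_linear: "lift (x + y) = lift x + lift y" "lift (c *s x) = c *s lift x"
  by (simp_all add: lift_def vec_eq_iff)

lemma \<theta>_lift: "\<theta> 1 (lift x) = x"
  by (simp add: \<theta>_def vec_eq_iff)

lemma vholo_\<theta>:
  assumes "vholo s x" "vholo w x" "s x \<in> S"
  shows "vholo (\<lambda>x. \<theta> (s x) (w x)) x"
  unfolding vholo_iff \<theta>_def vec_lambda_beta diff_conv_add_uminus
proof
  fix \<mu>
  have "holo (\<lambda>x. w x $ a \<mu> / s x $ a \<mu> + (- 1) * (w x $ a0 / s x $ a0)) x"
    by (intro holo_add holo_mult holo_const holo_divide vholo_nth assms(1,2) a_nonzero[OF assms(3)])
  then show "holo (\<lambda>x. w x $ a \<mu> / s x $ a \<mu> + - (w x $ a0 / s x $ a0)) x" by simp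
qed

section \<open>Every holomorphic form comes from the cokernel\<close>

context
  fixes p :: nat and \<omega> :: "('n ppoint set, 'v::finite) form_family"
  assumes card: "CARD('v) + CARD('m) + 1 = CARD('n)"
    and \<omega>: "\<omega> \<in> holomorphic_forms atlas p"
begin

abbreviation "\<Omega> \<equiv> pulled \<omega>"
abbreviation pmul :: "complex^'n \<Rightarrow> complex^'n \<Rightarrow> complex^'n" where "pmul z v \<equiv> (\<chi> i. z $ i * v $ i)"

text \<open>Evaluated on vector fields invariant under the torus, a pulled back form is an invariant
  function, hence constant.\<close>

lemma pulled_pmul:
  assumes z: "z \<in> S"
  shows "\<Omega> z (map (pmul z) vs) = \<Omega> 1 vs"
proof -
  define F where "F z = \<Omega> z (map (pmul z) vs)" for z
  have "F z = F 1"
  proof (rule invariant_holo_constant[OF _ _ z one_in_stab])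
    fix z assume z: "z \<in> S"
    have "holo (\<lambda>z. \<Omega> z (map (\<lambda>f. f z) (map (\<lambda>v z. pmul z v) vs) @ [])) z"
    proof (rule holo_altf[OF open_stab z])
      show "\<Omega> y \<in> altf p" if "y \<in> S" for y using pulled_altf[OF card \<omega> that] .
      show "holo (\<lambda>y. \<Omega> y vs) z" for vs using pulled_holo[OF card \<omega> z] .
      fix f assume "f \<in> set (map (\<lambda>v z. pmul z v) vs)"
      then obtain v where f: "f = (\<lambda>z. pmul z v)" by auto
      show "vholo f z" unfolding f vholo_iff vec_lambda_beta
        by (intro allI holo_mult holo_nth holo_const)
    qed
    then show "holo F z" by (simp add: F_def[abs_def] o_def)
    fix \<tau>
    have "map (pmul (g \<tau> z)) vs = map (g \<tau>) (map (pmul z) vs)"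
      by (simp add: vec_eq_iff)
    then show "F (g \<tau> z) = F z" unfolding F_def by (simp only: pulled_gact[OF card \<omega> z])
  qed
  moreover have "pmul 1 v = v" for v by (simp add: vec_eq_iff)
  ultimately show ?thesis by (simp add: F_def)
qed

lemma pulled_one_axis:
  assumes i: "i \<notin> indispensable \<Lambda>"
  shows "\<Omega> 1 (us @ axis i 1 # vs) = 0"
proof -
  \<comment> \<open>This point is stable because i is visible, and the field of the i-th coordinate
    vector vanishes at it.\<close>
  define z :: "complex^'n" where "z = (\<chi> j. if j = i then 0 else 1)"
  have z: "z \<in> S" using i by (simp add: z_def stab_def indispensable_def)
  have "pmul z (axis i 1) = 0" by (simp add: vec_eq_iff z_def axis_def)
  then show ?thesis
    unfolding pulled_pmul[OF z, symmetric] by (simp add: altf_zero[OF pulled_altf[OF card \<omega> z]])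
qed

text \<open>Such a v is an orbit direction plus a combination of coordinate vectors of visible
  labels, and \<Omega> kills both at the point 1.\<close>

lemma pulled_one_basic:
  assumes v: "\<And>i. i \<in> indispensable \<Lambda> \<Longrightarrow> v $ i = tang \<Lambda> \<tau> 1 $ i"
  shows "\<Omega> 1 (us @ v # vs) = 0"
proof -
  note A = pulled_altf[OF card \<omega> one_in_stab]
  let ?w = "v - tang \<Lambda> \<tau> 1"
  have "\<Omega> 1 (us @ ?w # vs) = \<Omega> 1 (us @ (\<Sum>i\<in>UNIV. ?w $ i *s axis i 1) # vs)"
    by (simp only: basis_expansion)
  also have "\<dots> = (\<Sum>i\<in>UNIV. ?w $ i * \<Omega> 1 (us @ axis i 1 # vs))"
    unfolding altf_sum[OF A] altf_scale[OF A] ..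
  also have "\<dots> = 0"
  proof (rule sum.neutral, rule ballI)
    fix i
    show "?w $ i * \<Omega> 1 (us @ axis i 1 # vs) = 0"
    proof (cases "i \<in> indispensable \<Lambda>")
      case True
      then have "?w $ i = 0" using v by simp
      then show ?thesis by (simp only: mult_zero_left)
    next
      case False
      then show ?thesis using pulled_one_axis by simp
    qed
  qed
  finally have "\<Omega> 1 (us @ ?w # vs) = 0" .
  then show ?thesis
    unfolding altf_diff[OF A] pulled_tang[OF card \<omega> one_in_stab] by simp
qed

proposition form_from_cokernel:
  obtains C where "C \<in> basic_forms (range B) p"
    "\<And>U \<phi> z vs. (U, \<phi>) \<in> atlas \<Longrightarrow> z \<in> S \<Longrightarrow> q z \<in> U \<Longrightarrow>
      \<omega> (U, \<phi>) (\<phi> (q z)) (map (dchart \<phi> z) vs) = C (map (\<theta> z) vs)"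
proof -
  define C where "C xs = \<Omega> 1 (map lift xs)" for xs
  note A = pulled_altf[OF card \<omega> one_in_stab]
  have CA: "C \<in> altf p"
    unfolding C_def[abs_def] by (rule altf_linear_sub[OF A lift_linear])
  have C: "C \<in> basic_forms (range B) p"
  proof (rule basic_formsI[OF CA])
    fix us x vs assume "x \<in> range B"
    then obtain T where x: "x = B T" by blast
    \<comment> \<open>The component \<open>None\<close> is chosen so that the orbit velocity at 1
      vanishes at a0, like \<open>lift x\<close>; at \<open>a \<mu>\<close> it is then the entry of
      B T.\<close>
    define \<tau> :: "complex^('m option)"
      where "\<tau> = (\<chi> k. case k of None \<Rightarrow> - bilin (\<Lambda> a0) T | Some j \<Rightarrow> T $ j)"
    have "lift x $ i = tang \<Lambda> \<tau> 1 $ i" if "i \<in> indispensable \<Lambda>" for i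
      using that by (auto simp: indispensable_eq x B_nth tang_def wt_eq \<tau>_def)
    then show "C (us @ x # vs) = 0" unfolding C_def by (simp add: pulled_one_basic)
  qed
  have one: "\<Omega> 1 vs = C (map (\<theta> 1) vs)" for vs
  proof -
    define R where "R = {v. \<exists>\<tau>. \<forall>i\<in>indispensable \<Lambda>. v $ i = tang \<Lambda> \<tau> 1 $ i}"
    have b: "\<Omega> 1 \<in> basic_forms R p"
      by (rule basic_formsI[OF A]) (auto simp: R_def intro: pulled_one_basic)
    \<comment> \<open>At every indispensable label this difference has the entry
      \<open>w $ a0\<close>, so it agrees there with a scaling direction.\<close>
    have "w - lift (\<theta> 1 w) \<in> R" for w
      unfolding R_def mem_Collect_eq
      by (intro exI[of _ "axis None (w $ a0)"])
        (auto simp: indispensable_eq \<theta>_def tang_def wt_eq axis_def bilin_def)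
    then have "list_all2 (\<lambda>x y. x - y \<in> R) vs (map (lift \<circ> \<theta> 1) vs)"
      by (simp add: list_all2_conv_all_nth)
    from basic_forms_cong[OF b this, of "[]"] show ?thesis by (simp add: C_def)
  qed
  have torus: "\<Omega> z vs = C (map (\<theta> z) vs)" if nz: "\<And>i. z $ i \<noteq> 0" for z vs
  proof -
    have z: "z \<in> S" by (rule stab_mono[OF one_in_stab]) (rule nz)
    define ws where "ws = map (\<lambda>v. \<chi> i. v $ i / z $ i) vs"
    have "map (pmul z) ws = vs" unfolding ws_def map_map
      by (rule map_idI) (simp add: vec_eq_iff nz)
    then have "\<Omega> z vs = \<Omega> 1 ws" using pulled_pmul[OF z, of ws] by simp
    also have "\<dots> = C (map (\<theta> 1) ws)" by (rule one)
    also have "map (\<theta> 1) ws = map (\<theta> z) vs" by (simp add: ws_def \<theta>_def)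
    finally show ?thesis .
  qed
  have all: "\<Omega> z vs = C (map (\<theta> z) vs)" if z: "z \<in> S" for z vs
  proof -
    define h where "h y = \<Omega> y vs - C (map (\<theta> y) vs)" for y
    have "holo (\<lambda>y. C (map (\<lambda>f. f y) (map (\<lambda>v y. \<theta> y v) vs) @ [])) z"
    proof (rule holo_altf[OF open_UNIV UNIV_I CA holo_const])
      fix f assume "f \<in> set (map (\<lambda>v y. \<theta> y v) vs)"
      then obtain v where f: "f = (\<lambda>y. \<theta> y v)" by auto
      show "vholo f z" unfolding f using z
        by (intro vholo_\<theta>) (auto simp: vholo_iff intro: holo_nth holo_const)
    qed
    then have "isCont (\<lambda>y. C (map (\<theta> y) vs)) z" using holo_isCont by (simp add: o_def)
    then have ch: "isCont h z"
      unfolding h_def using holo_isCont[OF pulled_holo[OF card \<omega> z]] by (intro continuous_diff)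
    \<comment> \<open>A small nonzero multiple of e makes the vanishing coordinates of z nonzero and
      leaves the others alone. The identity holds at these nearby points and passes to z by
      continuity.\<close>
    define e :: "complex^'n" where "e = (\<chi> i. if z $ i = 0 then 1 else 0)"
    define l where "l t = z + t *\<^sub>R e" for t :: real
    have l: "isCont l 0" "l 0 = z" unfolding l_def by (auto intro!: continuous_intros)
    have "isCont (\<lambda>t. h (l t)) 0" by (rule isCont_o2[OF l(1)]) (simp add: l(2) ch)
    then have "((\<lambda>t. h (l t)) \<longlongrightarrow> h z) (at 0)" by (simp add: isCont_def l(2))
    moreover have "((\<lambda>t. h (l t)) \<longlongrightarrow> 0) (at 0)"
    proof (rule tendsto_eventually)
      have "h (l t) = 0" if "t \<noteq> 0" for t
      proof -
        have "l t \<in> S" by (rule stab_mono[OF z]) (auto simp: l_def e_def)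
        have "l t $ i \<noteq> 0" for i using that by (auto simp: l_def e_def)
        then show ?thesis unfolding h_def using torus[of "l t" vs] by simp
      qed
      then show "\<forall>\<^sub>F t in at 0. h (l t) = 0" by (simp add: eventually_at_filter)
    qed
    ultimately have "h z = 0" using tendsto_unique[OF at_neq_bot] by blast
    then show ?thesis by (simp add: h_def)
  qed
  show ?thesis
  proof (rule that[OF C])
    fix U and \<phi> :: "('n, 'v) coords" and z vs
    assume u: "(U, \<phi>) \<in> atlas" "z \<in> S" "q z \<in> U"
    show "\<omega> (U, \<phi>) (\<phi> (q z)) (map (dchart \<phi> z) vs) = C (map (\<theta> z) vs)"
      using pulled_eq[OF card \<omega> u] all[OF u(2)] by simp
  qed
qed

end

section \<open>The holomorphic form defined by a basic form\<close>

text \<open>The form C of the differentials \<theta>, written in a chart through a chosen point over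
  x and chosen preimages of the vectors. The value 0 elsewhere is the convention of
  \<open>holomorphic_forms\<close>.\<close>

definition form_of :: "((complex^'m) list \<Rightarrow> complex) \<Rightarrow> ('n ppoint set, 'v::finite) form_family"
  where "form_of C = (\<lambda>(U, \<phi>) x vs. if (U, \<phi>) \<in> atlas \<and> x \<in> \<phi> ` U then
    (let z = SOME z. z \<in> S \<and> q z \<in> U \<and> \<phi> (q z) = x
     in C (map (\<lambda>v. \<theta> z (SOME w. dchart \<phi> z w = v)) vs)) else 0)"

context
  fixes p :: nat and V :: "'v::finite itself" and C
  assumes card: "CARD('v) + CARD('m) + 1 = CARD('n)"
    and C: "C \<in> basic_forms (range B) p"
begin

text \<open>Another point over x differs by a group element, under which \<theta> is invariant.
  Another preimage of a vector differs by an orbit direction, which changes \<theta> by an element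
  of \<open>range B\<close>, invisible to C.\<close>

lemma form_of_eq:
  fixes \<phi> :: "('n, 'v) coords"
  assumes U: "(U, \<phi>) \<in> atlas" and z: "z \<in> S" "q z \<in> U"
  shows "form_of C (U, \<phi>) (\<phi> (q z)) (map (dchart \<phi> z) ws) = C (map (\<theta> z) ws)"
proof -
  define y where "y = (SOME y. y \<in> S \<and> q y \<in> U \<and> \<phi> (q y) = \<phi> (q z))"
  have y: "y \<in> S" "q y \<in> U" "\<phi> (q y) = \<phi> (q z)"
    using someI[of "\<lambda>y. y \<in> S \<and> q y \<in> U \<and> \<phi> (q y) = \<phi> (q z)" z] z unfolding y_def by auto
  have "q y = q z" using inj_onD[OF atlas_inj[OF U] y(3) y(2) z(2)] .
  then obtain \<tau> where \<tau>: "z = g \<tau> y" unfolding lproj_eq_iff by blast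
  define sec where "sec v = (SOME w. dchart \<phi> y w = v)" for v
  have sec: "dchart \<phi> y (sec v) = v" for v
    unfolding sec_def by (rule someI_ex) (use atlas_dchart(2)[OF U y(1,2)] in \<open>metis surjD\<close>)
  note D = complex_derivative_linear[OF atlas_dchart(1)[OF U y(1,2)]]
  have d: "\<theta> y (sec (dchart \<phi> z w)) - \<theta> z w \<in> range B" for w
  proof -
    let ?w = "g (- \<tau>) w"
    have zw: "dchart \<phi> z w = dchart \<phi> y ?w" "\<theta> z w = \<theta> y ?w"
      unfolding \<tau> using dchart_gact[OF U y(1,2), of \<tau> ?w] \<theta>_gact[of \<tau> y ?w] by simp_all
    have "dchart \<phi> y (sec (dchart \<phi> z w) - ?w) = 0" unfolding D(4) sec zw(1) by simp
    then obtain \<rho> where "sec (dchart \<phi> z w) - ?w = tang \<Lambda> \<rho> y"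
      using transition_and_kernel(2)[OF card U U y(1,2,2)] by blast
    then have "\<theta> y (sec (dchart \<phi> z w)) - \<theta> z w = B (\<chi> j. \<rho> $ Some j)"
      unfolding zw(2) \<theta>_linear(3)[symmetric] by (simp add: \<theta>_tang[OF y(1)])
    then show ?thesis by simp
  qed
  have "form_of C (U, \<phi>) (\<phi> (q z)) (map (dchart \<phi> z) ws) = C ([] @ map (\<lambda>w. \<theta> y (sec (dchart \<phi> z w))) ws)"
    unfolding form_of_def using U z by (simp add: Let_def sec_def y_def o_def)
  also have "\<dots> = C ([] @ map (\<theta> z) ws)"
    by (rule basic_forms_cong[OF C]) (simp add: list_all2_conv_all_nth d)
  finally show ?thesis by simp
qed

text \<open>The pointwise choices in \<open>form_of\<close> are replaced by a holomorphic section
  and its derivative, from which both multilinearity and holomorphy can be read off.\<close>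

lemma form_of_lift:
  fixes \<phi> :: "('n, 'v) coords"
  assumes U: "(U, \<phi>) \<in> atlas" and x0: "x0 \<in> \<phi> ` U"
  obtains X s where "open X" "x0 \<in> X"
    "\<And>x. x \<in> X \<Longrightarrow> s x \<in> S \<and> vholo s x"
    "\<And>x vs. x \<in> X \<Longrightarrow> form_of C (U, \<phi>) x vs = C (map (\<lambda>v. \<theta> (s x) (frechet_derivative s (at x) v)) vs)"
proof -
  obtain z where z: "z \<in> S" "q z \<in> U" "x0 = \<phi> (q z)" using x0 atlas_open(2)[OF U] by blast
  obtain X s where X: "open X" "\<phi> (q z) \<in> X"
    and s: "\<And>x. x \<in> X \<Longrightarrow> s x \<in> S \<and> q (s x) \<in> U \<and> \<phi> (q (s x)) = x \<and> vholo s x"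
    "\<And>x v. x \<in> X \<Longrightarrow> dchart \<phi> (s x) (frechet_derivative s (at x) v) = v"
    by (rule holomorphic_lift[OF card U z(1,2)], rule that)
  show ?thesis
  proof (rule that[OF X[folded z(3)]])
    show "s x \<in> S \<and> vholo s x" if "x \<in> X" for x using s(1)[OF that] by blast
    fix x vs assume x: "x \<in> X"
    have "map (dchart \<phi> (s x)) (map (frechet_derivative s (at x)) vs) = vs"
      unfolding map_map by (rule map_idI) (simp add: s(2)[OF x])
    then show "form_of C (U, \<phi>) x vs = C (map (\<lambda>v. \<theta> (s x) (frechet_derivative s (at x) v)) vs)"
      using form_of_eq[OF U, of "s x" "map (frechet_derivative s (at x)) vs"] s(1)[OF x] by (simp add: o_def)
  qed
qed

lemma form_of_holomorphic: "(form_of C :: ('n ppoint set, 'v) form_family) \<in> holomorphic_forms atlas p"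
  unfolding holomorphic_forms_def mem_Collect_eq
proof (intro conjI allI impI)
  fix k :: "('n ppoint set, 'v) chart" assume "k \<notin> atlas"
  then show "form_of C k = (\<lambda>_ _. 0)" unfolding form_of_def by (cases k) auto
next
  fix U and \<phi> :: "('n, 'v) coords" assume U: "(U, \<phi>) \<in> atlas"
  have CA: "C \<in> altf p" using basic_formsD(1)[OF C] .
  show "holomorphic_form_on (\<phi> ` U) p (form_of C (U, \<phi>))"
    unfolding holomorphic_form_on_def
  proof (intro conjI allI impI ballI)
    fix x assume "x \<notin> \<phi> ` U"
    then show "form_of C (U, \<phi>) x = (\<lambda>_. 0)" unfolding form_of_def by auto
  next
    fix x assume x: "x \<in> \<phi> ` U"
    obtain X s where X: "open X" "x \<in> X"
      and s: "\<And>x. x \<in> X \<Longrightarrow> s x \<in> S \<and> vholo s x"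
      "\<And>x vs. x \<in> X \<Longrightarrow> form_of C (U, \<phi>) x vs = C (map (\<lambda>v. \<theta> (s x) (frechet_derivative s (at x) v)) vs)"
      by (rule form_of_lift[OF U x], rule that)
    have "vholo s x" using s(1)[OF X(2)] by blast
    note l = complex_derivative_linear[OF vholo_derivative[OF this]]
    have "form_of C (U, \<phi>) x = (\<lambda>vs. C (map (\<lambda>v. \<theta> (s x) (frechet_derivative s (at x) v)) vs))"
      using s(2)[OF X(2)] by (rule ext)
    also have "\<dots> \<in> altf p"
      by (rule altf_linear_sub[OF CA]) (simp_all add: \<theta>_linear l(1,2))
    finally show "form_of C (U, \<phi>) x \<in> altf p" .
  next
    fix vs :: "(complex^'v) list" and x assume x: "x \<in> \<phi> ` U"
    obtain X s where X: "open X" "x \<in> X"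
      and s: "\<And>x. x \<in> X \<Longrightarrow> s x \<in> S \<and> vholo s x"
      "\<And>x vs. x \<in> X \<Longrightarrow> form_of C (U, \<phi>) x vs = C (map (\<lambda>v. \<theta> (s x) (frechet_derivative s (at x) v)) vs)"
      by (rule form_of_lift[OF U x], rule that)
    have vs: "vholo s y" if "y \<in> X" for y using s(1)[OF that] by blast
    have "holo (\<lambda>x. C (map (\<lambda>f. f x) (map (\<lambda>v x. \<theta> (s x) (frechet_derivative s (at x) v)) vs) @ [])) x"
    proof (rule holo_altf[OF open_UNIV UNIV_I CA holo_const])
      fix f assume "f \<in> set (map (\<lambda>v x. \<theta> (s x) (frechet_derivative s (at x) v)) vs)"
      then obtain v where f: "f = (\<lambda>x. \<theta> (s x) (frechet_derivative s (at x) v))" by auto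
      show "vholo f x" unfolding f using s(1)[OF X(2)]
        by (intro vholo_\<theta> vs[OF X(2)] vholo_directional_derivative[OF X(1) vs X(2)]) auto
    qed
    moreover have "eventually (\<lambda>x. C (map (\<lambda>f. f x) (map (\<lambda>v x. \<theta> (s x) (frechet_derivative s (at x) v)) vs) @ [])
        = form_of C (U, \<phi>) x vs) (nhds x)"
      by (rule eventually_mono[OF eventually_nhds_in_open[OF X]]) (simp add: s(2) o_def)
    ultimately have "holo (\<lambda>x. form_of C (U, \<phi>) x vs) x" by (rule holo_transform)
    then show "\<exists>D. complex_derivative (*) (\<lambda>y. form_of C (U, \<phi>) y vs) D x" unfolding holo_def .
  qed
next
  fix U W and \<phi> \<psi> :: "('n, 'v) coords" and y
  assume U: "(U, \<phi>) \<in> atlas" and W: "(W, \<psi>) \<in> atlas" and y: "y \<in> U" "y \<in> W"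
  \<comment> \<open>Over a point z the vectors in both charts come from the same \<open>ws\<close>,
    and both sides become \<open>C (map (\<theta> z) ws)\<close>.\<close>
  obtain z where z: "z \<in> S" "y = q z" using atlas_open(2)[OF U] y(1) by blast
  have iv: "inv_into U \<phi> (\<phi> (q z)) = q z" using y(1) z(2) atlas_inj[OF U] by simp
  show "form_of C (U, \<phi>) (\<phi> y) = form_pullback (\<psi> \<circ> inv_into U \<phi>) (form_of C (W, \<psi>)) (\<phi> y)"
  proof
    fix vs
    obtain ws where vs: "vs = map (dchart \<phi> z) ws"
      using dchart_surj[OF U z(1)] y(1) z(2) by metis
    have "form_pullback (\<psi> \<circ> inv_into U \<phi>) (form_of C (W, \<psi>)) (\<phi> y) vs =
        form_of C (W, \<psi>) (\<psi> (q z)) (map (dchart \<psi> z) ws)"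
      unfolding form_pullback_def vs z(2) map_map o_apply iv
      using frechet_transition(1)[OF card U W z(1)] y z(2) by (simp add: o_def)
    also have "\<dots> = form_of C (U, \<phi>) (\<phi> y) vs"
      unfolding vs z(2) using form_of_eq[OF U z(1)] form_of_eq[OF W z(1)] y z(2) by simp
    finally show "form_of C (U, \<phi>) (\<phi> y) vs =
      form_pullback (\<psi> \<circ> inv_into U \<phi>) (form_of C (W, \<psi>)) (\<phi> y) vs" ..
  qed
qed

end

lemma form_of_add: "form_of (\<lambda>xs. C xs + C' xs) = form_of C + form_of C'"
  by (auto simp: form_of_def fun_eq_iff Let_def)

lemma form_of_scale: "form_of (\<lambda>xs. c * C xs) = form_scale c (form_of C)"
  by (auto simp: form_of_def form_scale_def fun_eq_iff Let_def)

lemma form_of_sum: "form_of (\<lambda>xs. \<Sum>i\<in>I. C i xs) = (\<Sum>i\<in>I. form_of (C i))"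
proof (induction I rule: infinite_finite_induct)
  case (insert i I)
  then show ?case by (simp add: form_of_add)
qed (auto simp: form_of_def fun_eq_iff Let_def zero_fun_def)

text \<open>Injectivity is visible at the single point 1, where \<open>\<theta> 1\<close> has the
  right inverse \<open>lift\<close>. Surjectivity holds because a family of forms is determined by
  its values on the vectors \<open>dchart \<phi> z w\<close>.\<close>

proposition form_of_bij:
  assumes card: "CARD('v::finite) + CARD('m) + 1 = CARD('n)"
  shows "bij_betw form_of (basic_forms (range B) p)
    (holomorphic_forms (atlas :: ('n ppoint set, 'v) chart set) p)"
    (is "bij_betw _ _ ?H")
  unfolding bij_betw_def
proof (intro conjI inj_onI equalityI)
  let ?f = "form_of :: _ \<Rightarrow> ('n ppoint set, 'v) form_family"
  fix C C' assume C: "C \<in> basic_forms (range B) p" and C': "C' \<in> basic_forms (range B) p" and eq: "?f C = ?f C'"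
  obtain U and \<phi> :: "('n, 'v) coords" where U: "(U, \<phi>) \<in> atlas" "q 1 \<in> U"
    by (rule exists_slice[OF card one_in_stab], rule that)
  show "C = C'"
  proof
    fix xs
    have "map (\<theta> 1) (map lift xs) = xs" unfolding map_map by (rule map_idI) (simp add: \<theta>_lift)
    then show "C xs = C' xs"
      using form_of_eq[OF card C U(1) one_in_stab U(2), of "map lift xs"]
        form_of_eq[OF card C' U(1) one_in_stab U(2), of "map lift xs"] eq by simp
  qed
next
  show "form_of ` basic_forms (range B) p \<subseteq> ?H"
    using form_of_holomorphic[OF card] by blast
  show "?H \<subseteq> form_of ` basic_forms (range B) p"
  proof
    fix \<omega> :: "('n ppoint set, 'v) form_family" assume \<omega>: "\<omega> \<in> holomorphic_forms atlas p"
    obtain C where C: "C \<in> basic_forms (range B) p"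
      and eq: "\<And>U \<phi> z vs. (U, \<phi>) \<in> atlas \<Longrightarrow> z \<in> S \<Longrightarrow> q z \<in> U \<Longrightarrow>
        \<omega> (U, \<phi>) (\<phi> (q z)) (map (dchart \<phi> z) vs) = C (map (\<theta> z) vs)"
      by (rule form_from_cokernel[OF card \<omega>], rule that)
    have hol: "form_of C \<in> ?H"
      by (rule form_of_holomorphic[OF card C])
    have "\<omega> (U, \<phi>) x vs = form_of C (U, \<phi>) x vs" for U \<phi> x vs
    proof (cases "(U, \<phi>) \<in> atlas")
      case U: True
      show ?thesis
      proof (cases "x \<in> \<phi> ` U")
        case True
        then obtain z where z: "z \<in> S" "q z \<in> U" "x = \<phi> (q z)" using atlas_open(2)[OF U] by blast
        obtain ws where "vs = map (dchart \<phi> z) ws" by (rule dchart_surj[OF U z(1,2)])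
        then show ?thesis
          using eq[OF U z(1,2)] form_of_eq[OF card C U z(1,2)] z(3) by simp
      next
        case False
        then show ?thesis
          using holomorphic_formsD(1)[OF \<omega> U] holomorphic_formsD(1)[OF hol U]
          unfolding holomorphic_form_on_def by metis
      qed
    next
      case False
      then show ?thesis using \<omega> hol unfolding holomorphic_forms_def by simp
    qed
    then have "\<omega> = form_of C" by (auto simp: fun_eq_iff)
    then show "\<omega> \<in> form_of ` basic_forms (range B) p" using C by blast
  qed
qed

end

section \<open>Forms on the cokernel\<close>

locale coker_map =
  fixes B :: "complex^'m::finite \<Rightarrow> complex^'m"
  assumes add: "B (x + y) = B x + B y" and scale: "B (c *s x) = c *s B x"
begin

definition coset :: "complex^'m \<Rightarrow> (complex^'m) set"
  where "coset x = {x + b | b. b \<in> range B}"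

abbreviation rep :: "(complex^'m) set \<Rightarrow> complex^'m" where "rep \<equiv> inv coset"

abbreviation coker_forms :: "nat \<Rightarrow> ((complex^'m) set list \<Rightarrow> complex) set"
  where "coker_forms p \<equiv> alt_forms (coker B) coker_add (coker_scale B) p"

lemma range_B: "0 \<in> range B" "x \<in> range B \<Longrightarrow> y \<in> range B \<Longrightarrow> x + y \<in> range B"
  "x \<in> range B \<Longrightarrow> c *s x \<in> range B" "x \<in> range B \<Longrightarrow> y \<in> range B \<Longrightarrow> x - y \<in> range B"
proof -
  have "B 0 = 0" using scale[of 0 0] by simp
  then show "0 \<in> range B" by (metis rangeI)
  show a: "x + y \<in> range B" if xy: "x \<in> range B" "y \<in> range B" for x y
  proof -
    obtain u v where "x = B u" "y = B v" using xy by blast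
    then have "x + y = B (u + v)" by (simp add: add)
    then show ?thesis by blast
  qed
  show s: "c *s x \<in> range B" if x: "x \<in> range B" for c x
  proof -
    obtain u where "x = B u" using x by blast
    then have "c *s x = B (c *s u)" by (simp add: scale)
    then show ?thesis by blast
  qed
  show "x - y \<in> range B" if "x \<in> range B" "y \<in> range B"
    using a[OF that(1) s[OF that(2), of "-1"]] by simp
qed

lemma subspace_range: "vec.subspace (range B)"
  unfolding vec.subspace_def using range_B by blast

lemma mem_coset: "y \<in> coset x \<longleftrightarrow> y - x \<in> range B"
proof
  assume "y - x \<in> range B"
  then have "y = x + (y - x) \<and> y - x \<in> range B" by simp
  then show "y \<in> coset x" unfolding coset_def by blast
qed (auto simp: coset_def)

lemma coset_eq_iff: "coset x = coset y \<longleftrightarrow> x - y \<in> range B"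
proof
  assume "coset x = coset y"
  moreover have "x \<in> coset x" using range_B(1) by (simp add: mem_coset)
  ultimately show "x - y \<in> range B" by (simp add: mem_coset)
next
  assume d: "x - y \<in> range B"
  then have d': "y - x \<in> range B" using range_B(4)[OF range_B(1) d] by simp
  show "coset x = coset y"
    unfolding set_eq_iff mem_coset
  proof
    fix w
    show "w - x \<in> range B \<longleftrightarrow> w - y \<in> range B"
      using range_B(2)[OF _ d, of "w - x"] range_B(2)[OF _ d', of "w - y"] by auto
  qed
qed

lemma coker_eq: "coker B = range coset"
  by (simp add: coker_def coset_def[abs_def])

lemma coker_add_coset: "coker_add (coset x) (coset y) = coset (x + y)"
proof (intro equalityI subsetI)
  fix w assume "w \<in> coker_add (coset x) (coset y)"
  then obtain u v where w: "w = u + v" "u - x \<in> range B" "v - y \<in> range B"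
    by (auto simp: coker_add_def mem_coset)
  show "w \<in> coset (x + y)"
    using range_B(2)[OF w(2,3)] by (simp add: mem_coset w(1) algebra_simps)
next
  fix w assume "w \<in> coset (x + y)"
  then have "w = x + (w - x) \<and> x \<in> coset x \<and> w - x \<in> coset y"
    using range_B(1) by (simp add: mem_coset algebra_simps)
  then show "w \<in> coker_add (coset x) (coset y)" unfolding coker_add_def by blast
qed

lemma coker_scale_coset: "coker_scale B c (coset x) = coset (c *s x)"
proof (intro equalityI subsetI)
  fix w assume "w \<in> coker_scale B c (coset x)"
  then obtain u b where w: "w = c *s u + b" "u - x \<in> range B" "b \<in> range B"
    by (auto simp: coker_scale_def mem_coset)
  have "c *s (u - x) + b \<in> range B" using range_B(2)[OF range_B(3)[OF w(2)] w(3)] .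
  then show "w \<in> coset (c *s x)" by (simp add: mem_coset w(1) vector_ssub_ldistrib algebra_simps)
next
  fix w assume "w \<in> coset (c *s x)"
  then have "w = c *s x + (w - c *s x) \<and> x \<in> coset x \<and> w - c *s x \<in> range B"
    using range_B(1) by (simp add: mem_coset)
  then show "w \<in> coker_scale B c (coset x)" unfolding coker_scale_def by blast
qed

lemma coset_rep: "X \<in> coker B \<Longrightarrow> coset (rep X) = X"
  unfolding coker_eq by (rule f_inv_into_f)

lemma rep_coset: "rep (coset x) - x \<in> range B"
  using coset_rep[of "coset x"] coset_eq_iff coker_eq by blast

lemma coker_formsD:
  assumes "A \<in> coker_forms p"
  shows "A (map coset us @ coset (x + y) # map coset vs) =
      A (map coset us @ coset x # map coset vs) + A (map coset us @ coset y # map coset vs)"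
    and "A (map coset us @ coset (c *s x) # map coset vs) = c * A (map coset us @ coset x # map coset vs)"
    and "\<not> distinct xs \<Longrightarrow> A (map coset xs) = 0" "length Xs \<noteq> p \<Longrightarrow> A Xs = 0"
proof -
  let ?X = "map coset us @ coset x # map coset vs"
  have m: "\<forall>Xs i. length Xs = p \<and> set Xs \<subseteq> coker B \<and> i < p \<longrightarrow>
      (\<forall>x\<in>coker B. \<forall>y\<in>coker B. A (Xs[i := coker_add x y]) = A (Xs[i := x]) + A (Xs[i := y])) \<and>
      (\<forall>c. \<forall>x\<in>coker B. A (Xs[i := coker_scale B c x]) = c * A (Xs[i := x]))"
    and z: "\<And>Xs. \<not> (length Xs = p \<and> set Xs \<subseteq> coker B) \<Longrightarrow> A Xs = 0"
    and d: "\<And>Xs. length Xs = p \<Longrightarrow> set Xs \<subseteq> coker B \<Longrightarrow> \<not> distinct Xs \<Longrightarrow> A Xs = 0"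
    using assms unfolding alt_forms_def by blast+
  show l: "length Xs \<noteq> p \<Longrightarrow> A Xs = 0" for Xs using z by blast
  show "A (map coset xs) = 0" if "\<not> distinct xs"
    using d[of "map coset xs"] l[of "map coset xs"] that by (auto simp: coker_eq distinct_map)
  have "A (?X[length us := coker_add (coset x) (coset y)]) = A (?X[length us := coset x]) + A (?X[length us := coset y]) \<and>
      A (?X[length us := coker_scale B c (coset x)]) = c * A (?X[length us := coset x])"
    if "length ?X = p"
  proof -
    have "length ?X = p \<and> set ?X \<subseteq> coker B \<and> length us < p" using that by (auto simp: coker_eq)
    from m[rule_format, OF this] show ?thesis by (simp add: coker_eq del: list_update.simps list_update_append)
  qed
  then show "A (map coset us @ coset (x + y) # map coset vs) =
      A (map coset us @ coset x # map coset vs) + A (map coset us @ coset y # map coset vs)"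
    "A (map coset us @ coset (c *s x) # map coset vs) = c * A (map coset us @ coset x # map coset vs)"
    unfolding coker_add_coset coker_scale_coset
    by (cases "length ?X = p"; simp add: l list_update_append)+
qed

definition of_coker :: "((complex^'m) set list \<Rightarrow> complex) \<Rightarrow> (complex^'m) list \<Rightarrow> complex"
  where "of_coker A xs = A (map coset xs)"

lemma of_coker_basic:
  assumes A: "A \<in> coker_forms p"
  shows "of_coker A \<in> basic_forms (range B) p"
proof (rule basic_formsI)
  show "of_coker A \<in> altf p"
    by (rule altfI) (simp_all add: of_coker_def coker_formsD[OF A])
  fix us x vs assume "x \<in> range B"
  \<comment> \<open>Written as 0 times a vector, the zero coset is handled by homogeneity.\<close>
  then have "coset x = coset (0 *s x)" by (simp add: coset_eq_iff)
  then show "of_coker A (us @ x # vs) = 0"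
    using coker_formsD(2)[OF A, of us 0 x vs] by (simp add: of_coker_def)
qed

definition to_coker :: "nat \<Rightarrow> ((complex^'m) list \<Rightarrow> complex) \<Rightarrow> (complex^'m) set list \<Rightarrow> complex"
  where "to_coker p C Xs = (if length Xs = p \<and> set Xs \<subseteq> coker B then C (map rep Xs) else 0)"

text \<open>The choice of representatives \<open>rep\<close> is linear only modulo
  \<open>range B\<close>, and a basic form does not see the difference.\<close>

lemma to_coker_form:
  assumes C: "C \<in> basic_forms (range B) p"
  shows "to_coker p C \<in> coker_forms p"
  unfolding alt_forms_def mem_Collect_eq
proof (intro conjI allI impI ballI)
  note CA = basic_formsD(1)[OF C]
  have cong: "C (us @ x # vs) = C (us @ y # vs)" if "x - y \<in> range B" for us x y vs
    by (rule basic_forms_cong[OF C]) (use that range_B(1) in \<open>simp add: list_all2_conv_all_nth nth_Cons'\<close>)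
  have upd: "to_coker p C (Xs[i := X]) = C (take i (map rep Xs) @ rep X # drop (Suc i) (map rep Xs))"
    if "length Xs = p \<and> set Xs \<subseteq> coker B \<and> i < p" "X \<in> coker B" for Xs i X
  proof -
    have "set (Xs[i := X]) \<subseteq> coker B" using that set_update_subset_insert[of Xs i X] by blast
    then show ?thesis
      using that by (simp add: to_coker_def upd_conv_take_nth_drop take_map drop_map)
  qed
  fix Xs :: "(complex^'m) set list" and i
  {
    fix X Y assume X: "length Xs = p \<and> set Xs \<subseteq> coker B \<and> i < p" "X \<in> coker B" "Y \<in> coker B"
    have e: "coset (rep X + rep Y) = coker_add X Y"
      unfolding coker_add_coset[symmetric] coset_rep[OF X(2)] coset_rep[OF X(3)] ..
    then have m: "coker_add X Y \<in> coker B" unfolding coker_eq by (metis rangeI)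
    have "rep (coker_add X Y) - (rep X + rep Y) \<in> range B" using rep_coset[of "rep X + rep Y"] e by simp
    then show "to_coker p C (Xs[i := coker_add X Y]) = to_coker p C (Xs[i := X]) + to_coker p C (Xs[i := Y])"
      unfolding upd[OF X(1,2)] upd[OF X(1,3)] upd[OF X(1) m] altf_add[OF CA, symmetric] by (rule cong)
  }
  {
    fix c X assume X: "length Xs = p \<and> set Xs \<subseteq> coker B \<and> i < p" "X \<in> coker B"
    have e: "coset (c *s rep X) = coker_scale B c X"
      unfolding coker_scale_coset[symmetric] coset_rep[OF X(2)] ..
    then have m: "coker_scale B c X \<in> coker B" unfolding coker_eq by (metis rangeI)
    have "rep (coker_scale B c X) - c *s rep X \<in> range B" using rep_coset[of "c *s rep X"] e by simp
    then show "to_coker p C (Xs[i := coker_scale B c X]) = c * to_coker p C (Xs[i := X])"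
      unfolding upd[OF X(1,2)] upd[OF X(1) m] altf_scale[OF CA, symmetric] by (rule cong)
  }
  {
    assume "length Xs = p \<and> set Xs \<subseteq> coker B \<and> \<not> distinct Xs"
    then have "\<not> distinct (map rep Xs)" using distinct_map by blast
    then show "to_coker p C Xs = 0" by (simp add: to_coker_def altf_not_distinct[OF CA])
  }
qed (auto simp: to_coker_def)

lemma of_to_coker:
  assumes C: "C \<in> basic_forms (range B) p"
  shows "of_coker (to_coker p C) = C"
proof
  fix xs
  show "of_coker (to_coker p C) xs = C xs"
  proof (cases "length xs = p")
    case True
    then have "of_coker (to_coker p C) xs = C ([] @ map (\<lambda>x. rep (coset x)) xs)"
      by (auto simp: of_coker_def to_coker_def coker_eq o_def)
    also have "\<dots> = C ([] @ xs)"
      by (rule basic_forms_cong[OF C]) (simp add: list_all2_conv_all_nth rep_coset)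
    finally show ?thesis by simp
  next
    case False
    then show ?thesis
      using altf_length[OF basic_formsD(1)[OF C]] by (simp add: of_coker_def to_coker_def)
  qed
qed

lemma of_coker_bij: "bij_betw of_coker (coker_forms p) (basic_forms (range B) p)"
  unfolding bij_betw_def
proof (intro conjI inj_onI equalityI)
  fix A A' assume A: "A \<in> coker_forms p" "A' \<in> coker_forms p" and eq: "of_coker A = of_coker A'"
  show "A = A'"
  proof
    fix Xs
    show "A Xs = A' Xs"
    proof (cases "set Xs \<subseteq> coker B")
      case True
      then have "map coset (map rep Xs) = Xs"
        unfolding map_map by (intro map_idI) (auto simp: coset_rep)
      then show ?thesis using eq unfolding of_coker_def by metis
    next
      case False
      then show ?thesis using A unfolding alt_forms_def by simp
    qed
  qed
next
  show "of_coker ` coker_forms p \<subseteq> basic_forms (range B) p" using of_coker_basic by blast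
  show "basic_forms (range B) p \<subseteq> of_coker ` coker_forms p"
    using of_to_coker to_coker_form by (metis image_eqI subsetI)
qed

end

section \<open>Rank of the block, the isomorphism and the Hodge numbers\<close>

context lvm_block
begin

sublocale coker_map B
  by unfold_locales (rule B_linear)+

lemma matrix_B: "matrix B *v x = B x"
proof -
  have "bilin y (axis j 1) = y $ j" for y :: "complex^'m" and j
    by (simp add: bilin_def axis_def if_distrib cong: if_cong)
  then show ?thesis
    by (simp add: vec_eq_iff matrix_def matrix_vector_mult_def B_nth)
      (simp add: bilin_def sum_subtractf left_diff_distrib)
qed

lemma rank_B: "rank (matrix B) = vec.dim (range B)"
  unfolding rank_eq_dim_range matrix_B ..

lemma H0_iso:
  assumes card: "CARD('v::finite) + CARD('m) + 1 = CARD('n)"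
  shows "H0_iso_alt_forms (atlas :: ('n ppoint set, 'v) chart set) p (coker B) coker_add (coker_scale B)"
proof -
  let ?H = "holomorphic_forms (atlas :: ('n ppoint set, 'v) chart set) p"
  define \<Psi> where "\<Psi> = (form_of :: _ \<Rightarrow> ('n ppoint set, 'v) form_family) \<circ> of_coker"
  have bij: "bij_betw \<Psi> (coker_forms p) ?H"
    unfolding \<Psi>_def by (rule bij_betw_trans[OF of_coker_bij form_of_bij[OF card]])
  define \<Phi> where "\<Phi> = inv_into (coker_forms p) \<Psi>"
  have inv: "\<Phi> (\<Psi> A) = A" if "A \<in> coker_forms p" for A
    unfolding \<Phi>_def using bij that by (simp add: bij_betw_inv_into_left)
  have \<Phi>: "\<Phi> \<omega> \<in> coker_forms p" "\<Psi> (\<Phi> \<omega>) = \<omega>" if "\<omega> \<in> ?H" for \<omega>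
    unfolding \<Phi>_def using bij_betwE[OF bij_betw_inv_into[OF bij]] bij_betw_inv_into_right[OF bij] that
    by simp_all
  have add: "\<Psi> (A + A') = \<Psi> A + \<Psi> A'" for A A'
    unfolding \<Psi>_def o_apply form_of_add[symmetric] by (rule arg_cong[of _ _ form_of]) (simp add: of_coker_def fun_eq_iff)
  have scl: "\<Psi> (\<lambda>xs. c * A xs) = form_scale c (\<Psi> A)" for c A
    unfolding \<Psi>_def o_apply form_of_scale[symmetric] by (rule arg_cong[of _ _ form_of]) (simp add: of_coker_def fun_eq_iff)
  show ?thesis
    unfolding H0_iso_alt_forms_def
  proof (intro exI[of _ \<Phi>] conjI ballI allI)
    show "bij_betw \<Phi> ?H (coker_forms p)" unfolding \<Phi>_def by (rule bij_betw_inv_into[OF bij])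
    show "\<Phi> (\<omega> + \<eta>) = \<Phi> \<omega> + \<Phi> \<eta>" if "\<omega> \<in> ?H" "\<eta> \<in> ?H" for \<omega> \<eta>
    proof -
      have "\<Phi> (\<Psi> (\<Phi> \<omega> + \<Phi> \<eta>)) = \<Phi> \<omega> + \<Phi> \<eta>"
        by (rule inv[OF alt_forms_add[OF \<Phi>(1)[OF that(1)] \<Phi>(1)[OF that(2)]]])
      then show ?thesis unfolding add \<Phi>(2)[OF that(1)] \<Phi>(2)[OF that(2)] .
    qed
    show "\<Phi> (form_scale c \<omega>) = (\<lambda>xs. c * \<Phi> \<omega> xs)" if "\<omega> \<in> ?H" for c \<omega>
    proof -
      have "\<Phi> (\<Psi> (\<lambda>xs. c * \<Phi> \<omega> xs)) = (\<lambda>xs. c * \<Phi> \<omega> xs)"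
        by (rule inv[OF alt_forms_scale[OF \<Phi>(1)[OF that]]])
      then show ?thesis unfolding scl \<Phi>(2)[OF that] .
    qed
  qed
qed

text \<open>The bijection \<open>form_of\<close> commutes with finite linear combinations, so it
  carries the wedge basis of basic forms, indexed by the p-subsets of a set of \<delta> elements, to
  a basis of the holomorphic forms.\<close>

lemma hodge:
  assumes card: "CARD('v::finite) + CARD('m) + 1 = CARD('n)" and \<delta>: "\<delta> = CARD('m) - rank (matrix B)"
  shows "has_hodge_p0 (atlas :: ('n ppoint set, 'v) chart set) p (\<delta> choose p)"
proof -
  interpret fs: vector_space "form_scale :: complex \<Rightarrow> ('n ppoint set, 'v) form_family \<Rightarrow> _"
    by (rule vector_space_form_scale)
  let ?H = "holomorphic_forms (atlas :: ('n ppoint set, 'v) chart set) p"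
  let ?f = "form_of :: _ \<Rightarrow> ('n ppoint set, 'v) form_family"
  let ?K = "{K. K \<subseteq> {..<\<delta>} \<and> card K = p}"
  obtain A where A: "\<And>K. K \<subseteq> {..<\<delta>} \<Longrightarrow> card K = p \<Longrightarrow> A K \<in> basic_forms (range B) p"
    "\<And>C. C \<in> basic_forms (range B) p \<Longrightarrow> \<exists>c. \<forall>xs. C xs = (\<Sum>K\<in>?K. c K * A K xs)"
    "\<And>c K. \<forall>xs. (\<Sum>K\<in>?K. c K * A K xs) = 0 \<Longrightarrow> K \<subseteq> {..<\<delta>} \<Longrightarrow> card K = p \<Longrightarrow> c K = 0"
    by (rule basic_forms_basis[OF subspace_range \<delta>[unfolded rank_B], of p], rule that)
  have finK: "finite ?K" by (rule finite_subset[of _ "Pow {..<\<delta>}"]) auto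
  have bij: "bij_betw ?f (basic_forms (range B) p) ?H" by (rule form_of_bij[OF card])
  have comb: "?f (\<lambda>xs. \<Sum>K\<in>?K. c K * A K xs) = (\<Sum>K\<in>?K. form_scale (c K) (?f (A K)))" for c
    unfolding form_of_sum form_of_scale ..
  have indep: "c K = 0" if "(\<Sum>K\<in>?K. form_scale (c K) (?f (A K))) = 0" "K \<in> ?K" for c K
  proof -
    have "?f (\<lambda>xs. \<Sum>K\<in>?K. c K * A K xs) = ?f (\<lambda>_. 0)"
      unfolding comb that(1) by (auto simp: form_of_def fun_eq_iff)
    moreover have "(\<lambda>xs. \<Sum>K\<in>?K. c K * A K xs) \<in> basic_forms (range B) p"
      using A(1) by (intro basic_forms_sum) auto
    ultimately have "(\<lambda>xs. \<Sum>K\<in>?K. c K * A K xs) = (\<lambda>_. 0)"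
      using inj_onD[OF bij_betw_imp_inj_on[OF bij] _ _ basic_forms_zero] by blast
    then have "\<forall>xs. (\<Sum>K\<in>?K. c K * A K xs) = 0" unfolding fun_eq_iff .
    from A(3)[OF this] that(2) show ?thesis by blast
  qed
  \<comment> \<open>Independence was shown for the family indexed by subsets, whereas the dimension
    counts the set b of its members. Two equal members would satisfy the relation with coefficients
    1 and - 1.\<close>
  have inj: "inj_on (\<lambda>K. ?f (A K)) ?K"
  proof (rule inj_onI, rule ccontr)
    fix K J assume K: "K \<in> ?K" "J \<in> ?K" "?f (A K) = ?f (A J)" "K \<noteq> J"
    define c :: "nat set \<Rightarrow> complex" where "c L = (if L = K then 1 else if L = J then - 1 else 0)" for L
    have "(\<Sum>L\<in>?K. form_scale (c L) (?f (A L))) = (\<Sum>L\<in>{K, J}. form_scale (c L) (?f (A L)))"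
      using K finK by (intro sum.mono_neutral_right) (auto simp: c_def)
    also have "\<dots> = ?f (A K) - ?f (A J)" using K(4) by (simp add: c_def)
    finally have "(\<Sum>L\<in>?K. form_scale (c L) (?f (A L))) = 0" using K(3) by simp
    from indep[OF this K(1)] show False by (simp add: c_def)
  qed
  define b where "b = (\<lambda>K. ?f (A K)) ` ?K"
  have fin: "finite b" unfolding b_def using finK by (rule finite_imageI)
  have span: "fs.span b = ?H"
  proof (rule equalityI)
    show "fs.span b \<subseteq> ?H"
    proof (rule fs.span_minimal[OF _ subspace_holomorphic_forms])
      show "b \<subseteq> ?H" unfolding b_def using A(1) bij_betwE[OF bij] by blast
    qed
    show "?H \<subseteq> fs.span b"
    proof
      fix \<omega> assume "\<omega> \<in> ?H"
      then obtain C where C: "C \<in> basic_forms (range B) p" "\<omega> = ?f C"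
        using bij unfolding bij_betw_def by blast
      obtain c where "\<forall>xs. C xs = (\<Sum>K\<in>?K. c K * A K xs)" using A(2)[OF C(1)] by blast
      then have "C = (\<lambda>xs. \<Sum>K\<in>?K. c K * A K xs)" by auto
      then have "\<omega> = (\<Sum>K\<in>?K. form_scale (c K) (?f (A K)))" using C(2) comb by simp
      also have "\<dots> \<in> fs.span b"
        by (intro fs.span_sum fs.span_scale fs.span_base) (auto simp: b_def)
      finally show "\<omega> \<in> fs.span b" .
    qed
  qed
  have "fs.independent b"
  proof (rule fs.independent_if_scalars_zero[OF fin])
    fix f x assume s: "(\<Sum>x\<in>b. form_scale (f x) x) = 0" and "x \<in> b"
    then obtain K where K: "K \<in> ?K" "x = ?f (A K)" unfolding b_def by blast
    have "(\<Sum>K\<in>?K. form_scale (f (?f (A K))) (?f (A K))) = 0"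
      using s unfolding b_def by (subst (asm) sum.reindex[OF inj]) (simp add: o_def)
    from indep[OF this K(1)] show "f x = 0" unfolding K(2) .
  qed
  moreover have "fs.span b = fs.span ?H"
    using span fs.span_span by metis
  ultimately have "fs.dim ?H = card b" by (intro fs.dim_eq_card)
  also have "\<dots> = card ?K" unfolding b_def by (rule card_image[OF inj])
  also have "\<dots> = \<delta> choose p" using n_subsets[of "{..<\<delta>}" p] by simp
  finally show ?thesis unfolding has_hodge_p0_def using fin span by blast
qed

end

theorem theorem10p7:
  fixes \<Lambda> :: "'n::finite \<Rightarrow> complex ^ 'm::finite"
    and a0 :: 'n and a :: "'m \<Rightarrow> 'n"
    and \<A> :: "('n ppoint set, 'v::finite) chart set"
    and B :: "complex ^ 'm \<Rightarrow> complex ^ 'm"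
    and \<delta> p :: nat
  assumes "admissible \<Lambda>"
    and "minimally_stable \<Lambda>"
    and "polytopal \<Lambda>"
    and "lvm_d \<Lambda> \<ge> 1"
    and "bij_betw (case_option a0 a) UNIV (indispensable \<Lambda>)"
    and "CARD('v) = CARD('n) - CARD('m) - 1"
    and "\<A> = lvm_atlas \<Lambda>"
    and "B = indisp_block \<Lambda> a0 a"
    and "\<delta> = CARD('m) - rank (matrix B)"
    and "p \<le> CARD('v)"
  shows "H0_iso_alt_forms \<A> p (coker B) coker_add (coker_scale B) \<and>
    has_hodge_p0 \<A> p (\<delta> choose p)"
proof -
  interpret lvm_block \<Lambda> a0 a by unfold_locales (rule assms(1), rule assms(5))
  \<comment> \<open>The dimension is given by a truncated subtraction of naturals; the m + 1
    distinct indispensable labels show that nothing is cut off.\<close>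
  have "CARD('m) + 1 = card (indispensable \<Lambda>)"
    using bij_betw_same_card[OF assms(5)] by simp
  also have "\<dots> \<le> CARD('n)" by (rule card_mono) auto
  finally have card: "CARD('v) + CARD('m) + 1 = CARD('n)" using assms(6) by simp
  show ?thesis
    unfolding assms(7,8) using H0_iso[OF card] hodge[OF card assms(9)[unfolded assms(8)]] by blast
qed

end
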